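(* Let $N\ge3$ and let $d\mu=\mu(x)\,dx$ be a positive measure (not necessarily a probability measure) on $\mathbb{R}^N$ with density $\mu$. Write $c_0(N):=\left(\frac{N-2}{2}\right)^2$ and $U_\mu:=\frac14\left|\frac{\nabla\mu}{\mu}\right|^2-\frac12\frac{\Delta\mu}{\mu}$. Assume: (1) $\mu\ge 0$, $\mu^{1/2}\in H^1_{loc}(\mathbb{R}^N)$, $\Delta\mu\in L^1_{loc}(\mathbb{R}^N)$; (2) the constant $c_{0,\mu}:=\liminf_{x\to 0}\left(c_0(N)-|x|^2U_\mu(x)\right)$ is finite; (3) for every $R>0$ the function $U:=U_\mu-\frac{1}{|x|^2}\limsup_{x\to0}|x|^2U_\mu$ is bounded from above in $\mathbb{R}^N\setminus B_R$; (4) there exists $R_0>0$ such that $|x|^2U(x)\le \frac14\frac{1}{|\log|x||^2}$ for all $x\in B_{R_0}$. Then there exists a constant $C_\mu$ such that for any $\varphi\in H^1_\mu$ $$c_{0,\mu}\int_{\mathbb{R}^N}\frac{\varphi^2}{|x|^2}\,d\mu\le\int_{\mathbb{R}^N}|\nabla\varphi|^2\,d\mu+C_\mu\int_{\mathbb{R}^N}\varphi^2\,d\mu.$$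
   Context: $B_R$ denotes the open ball of $\mathbb{R}^N$ of radius $R$ centered at $0$. $L^2_\mu:=L^2(\mathbb{R}^N,d\mu)$, and $H^1_\mu$ is the Sobolev space of functions in $L^2_\mu$ whose weak first derivatives belong to $L^2_\mu$; $C_c^\infty(\mathbb{R}^N)$ is dense in $H^1_\mu$ when $\mu^{1/2}\in H^1_{loc}(\mathbb{R}^N)$ (known fact). Functions $\varphi$ are real-valued. *)

theory Defs
  imports "HOL-Analysis.Analysis"
begin

definition partial_deriv :: "'a::euclidean_space \<Rightarrow> ('a \<Rightarrow> real) \<Rightarrow> 'a \<Rightarrow> real" where
  "partial_deriv b f x = frechet_derivative f (at x) b"

definition laplacian :: "('a::euclidean_space \<Rightarrow> real) \<Rightarrow> 'a \<Rightarrow> real" where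
  "laplacian f x = (\<Sum>b\<in>Basis. partial_deriv b (partial_deriv b f) x)"

fun C_diff :: "nat \<Rightarrow> ('a::euclidean_space \<Rightarrow> real) \<Rightarrow> bool" where
  "C_diff 0 f \<longleftrightarrow> continuous_on UNIV f"
| "C_diff (Suc k) f \<longleftrightarrow>
     (\<forall>x. f differentiable (at x)) \<and> (\<forall>b\<in>Basis. C_diff k (partial_deriv b f))"

definition test_function :: "('a::euclidean_space \<Rightarrow> real) \<Rightarrow> bool" where
  "test_function \<eta> \<longleftrightarrow> (\<forall>k. C_diff k \<eta>) \<and> compact (closure {x. \<eta> x \<noteq> 0})"

definition L1_loc :: "('a::euclidean_space \<Rightarrow> 'b::euclidean_space) \<Rightarrow> bool" where
  "L1_loc f \<longleftrightarrow> (\<forall>K. compact K \<longrightarrow> f absolutely_integrable_on K)"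

definition L2_loc :: "('a::euclidean_space \<Rightarrow> 'b::euclidean_space) \<Rightarrow> bool" where
  "L2_loc f \<longleftrightarrow> f \<in> borel_measurable lebesgue \<and> L1_loc (\<lambda>x. (norm (f x))\<^sup>2)"

definition has_weak_gradient :: "('a::euclidean_space \<Rightarrow> real) \<Rightarrow> ('a \<Rightarrow> 'a) \<Rightarrow> bool" where
  "has_weak_gradient f G \<longleftrightarrow> L1_loc f \<and> L1_loc G \<and>
     (\<forall>\<eta>. test_function \<eta> \<longrightarrow> (\<forall>b\<in>Basis.
        (LINT x|lebesgue. f x * partial_deriv b \<eta> x) = - (LINT x|lebesgue. (G x \<bullet> b) * \<eta> x)))"

definition has_weak_laplacian :: "('a::euclidean_space \<Rightarrow> real) \<Rightarrow> ('a \<Rightarrow> real) \<Rightarrow> bool" where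
  "has_weak_laplacian f h \<longleftrightarrow> L1_loc f \<and> L1_loc h \<and>
     (\<forall>\<eta>. test_function \<eta> \<longrightarrow>
        (LINT x|lebesgue. f x * laplacian \<eta> x) = (LINT x|lebesgue. h x * \<eta> x))"

text \<open>Weak derivatives are unique only up to Lebesgue null sets. The next two functions pick a
  representative, so they may only be used in ways that do not depend on null sets.\<close>

definition weak_gradient :: "('a::euclidean_space \<Rightarrow> real) \<Rightarrow> 'a \<Rightarrow> 'a" where
  "weak_gradient f = (SOME G. has_weak_gradient f G)"

definition weak_laplacian :: "('a::euclidean_space \<Rightarrow> real) \<Rightarrow> 'a \<Rightarrow> real" where
  "weak_laplacian f = (SOME h. has_weak_laplacian f h)"

definition H1_loc :: "('a::euclidean_space \<Rightarrow> real) \<Rightarrow> bool" where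
  "H1_loc f \<longleftrightarrow> L2_loc f \<and> (\<exists>G. has_weak_gradient f G \<and> L2_loc G)"

definition weighted :: "('a::euclidean_space \<Rightarrow> real) \<Rightarrow> 'a measure" where
  "weighted \<mu> = density lebesgue (\<lambda>x. ennreal (\<mu> x))"

definition L2_weighted :: "('a::euclidean_space \<Rightarrow> real) \<Rightarrow> ('a \<Rightarrow> 'b::euclidean_space) \<Rightarrow> bool" where
  "L2_weighted \<mu> f \<longleftrightarrow> f \<in> borel_measurable lebesgue \<and> integrable (weighted \<mu>) (\<lambda>x. (norm (f x))\<^sup>2)"

definition H1_weighted :: "('a::euclidean_space \<Rightarrow> real) \<Rightarrow> ('a \<Rightarrow> real) set" where
  "H1_weighted \<mu> =
     {\<phi>. L2_weighted \<mu> \<phi> \<and> (\<exists>G. has_weak_gradient \<phi> G \<and> L2_weighted \<mu> G)}"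

definition hardy_const :: "nat \<Rightarrow> real" where
  "hardy_const N = ((real N - 2) / 2)\<^sup>2"

text \<open>If \<open>sqrt \<mu>\<close> is in \<open>H1_loc\<close>, then \<open>\<mu>\<close> has the weak gradient
  \<open>2 sqrt \<mu> \<nabla>(sqrt \<mu>)\<close>, so \<open>weak_gradient \<mu>\<close> is meaningful. At zeros of \<open>\<mu>\<close>
  the value below is an artefact of division by zero; such points form a null set of
  \<open>weighted \<mu>\<close>.\<close>

definition U_mu :: "('a::euclidean_space \<Rightarrow> real) \<Rightarrow> 'a \<Rightarrow> real" where
  "U_mu \<mu> x = 1/4 * (norm (weak_gradient \<mu> x /\<^sub>R \<mu> x))\<^sup>2 - 1/2 * (weak_laplacian \<mu> x / \<mu> x)"

text \<open>\<open>U_mu \<mu>\<close> is determined only almost everywhere. Its lower and upper limits at the origin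
  are therefore the essential ones, that is, limits along the filter of those sets that
  contain \<open>\<mu>\<close>-almost every point of some punctured neighbourhood of \<open>0\<close>.\<close>

definition ess_at_0 :: "('a::euclidean_space \<Rightarrow> real) \<Rightarrow> 'a filter" where
  "ess_at_0 \<mu> = inf (at 0) (ae_filter (weighted \<mu>))"

definition c0_mu :: "('a::euclidean_space \<Rightarrow> real) \<Rightarrow> ereal" where
  "c0_mu \<mu> = Liminf (ess_at_0 \<mu>) (\<lambda>x. ereal (hardy_const DIM('a) - (norm x)\<^sup>2 * U_mu \<mu> x))"

text \<open>The upper limit is a real number whenever \<open>c0_mu \<mu>\<close> is finite.\<close>

definition U_rem :: "('a::euclidean_space \<Rightarrow> real) \<Rightarrow> 'a \<Rightarrow> real" where
  "U_rem \<mu> x = U_mu \<mu> x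
     - 1 / (norm x)\<^sup>2 * real_of_ereal (Limsup (ess_at_0 \<mu>) (\<lambda>y. ereal ((norm y)\<^sup>2 * U_mu \<mu> y)))"

end

theory Submission
  imports Defs
begin

text \<open>Write \<open>s = \<mu>\<^bsup>1/2\<^esup>\<close>, so that \<open>s\<^sup>2 U\<^sub>\<mu> = \<bar>\<nabla>s\<bar>\<^sup>2 - \<Delta>\<mu>/2\<close> where \<open>\<mu> > 0\<close>. For bounded, compactly supported
  \<open>\<phi>\<close> and a vector field \<open>\<Gamma>\<close>, integrating \<open>\<bar>s \<nabla>\<phi> + \<phi> \<nabla>s + s \<phi> \<Gamma>\<bar>\<^sup>2 \<ge> 0\<close> over \<open>{\<mu> > 0}\<close> and integrating the mixed
  terms by parts gives
  \<open>\<integral>\<bar>\<nabla>\<phi>\<bar>\<^sup>2 d\<mu> \<ge> \<integral>\<phi>\<^sup>2 (div \<Gamma> - \<bar>\<Gamma>\<bar>\<^sup>2 - U\<^sub>\<mu>) d\<mu>\<close>.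
  With \<open>\<Gamma> = - \<nabla>w/w\<close> and \<open>w\<close> the ground state \<open>\<bar>x\<bar>\<^bsup>-(N-2)/2\<^esup> \<bar>log \<bar>x\<bar>\<bar>\<^bsup>1/2\<^esup>\<close> of the logarithmically improved Hardy
  inequality, \<open>div \<Gamma> - \<bar>\<Gamma>\<bar>\<^sup>2\<close> equals \<open>c\<^sub>0(N)/\<bar>x\<bar>\<^sup>2 + 1/(4 \<bar>x\<bar>\<^sup>2 log\<^sup>2 \<bar>x\<bar>)\<close> near the origin, which absorbs
  the hypothesis on \<open>U\<close> there; away from the origin everything is bounded. The delicate integration by parts is
  \<open>\<integral>\<nabla>(\<phi>\<^sup>2) \<cdot> \<nabla>\<mu> = - \<integral>\<phi>\<^sup>2 \<Delta>\<mu>\<close>, because \<open>\<nabla>\<mu>\<close> is only locally integrable and \<open>\<nabla>\<phi>\<close> is square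
  integrable only against \<open>\<mu>\<close>. It is obtained by mollifying \<open>\<mu>\<close> and damping large values of \<open>\<mu>\<close>, using
  \<open>\<bar>\<nabla>\<mu>\<^sub>\<delta>\<bar>\<^sup>2 \<le> 4 \<mu>\<^sub>\<delta> (\<bar>\<nabla>s\<bar>\<^sup>2)\<^sub>\<delta>\<close>; no density of test functions in the weighted space is needed.\<close>

section \<open>Smooth kernels\<close>

text \<open>The constants fit without slack. Put \<tau> = |x|^2, m = (N - 2)/2, and let \<Lambda> be
  the upper limit of |x|^2 times the potential. The constant of the theorem is then m^2 - \<Lambda>,
  so adding the potential to the Hardy weight cancels \<Lambda> and leaves m^2/\<tau> plus the
  remainder. As ln \<tau> = 2 ln |x|, the remainder allowed near 0 is exactly (1/ln
  \<tau>)^2/\<tau>, factor 1/4 included: this is what the ground state yields. Its field is singular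
  at 0, so it is used with \<tau> = |x|^2 + \<epsilon>. The shift causes an error of favourable
  sign, and Fatou's lemma restores the singular weight. In the delicate integration by parts the
  order of limits matters. At fixed damping the mollification is removed first, by dominated
  convergence with majorants that move with the mollification; only then is the damping released,
  under a bound by |\<nabla>s|^2 uniform in the parameter. Beforehand the test function is
  multiplied by a factor that is at most a multiple of s, which turns square integrability against
  \<mu> into plain square integrability.\<close>

definition flat :: "nat \<Rightarrow> real \<Rightarrow> real" where
  "flat m t = (if t \<le> 0 then 0 else exp (- inverse t) * inverse t ^ m)"

lemma flat_tendsto_0: "(flat m \<longlongrightarrow> 0) (at 0)"
proof -
  have "((\<lambda>t. (inverse t) ^ m / exp (inverse t)) \<longlongrightarrow> (0::real)) (at_right 0)"
    by (rule filterlim_compose[OF tendsto_power_div_exp_0 filterlim_inverse_at_top_right])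
  then have R: "(flat m \<longlongrightarrow> 0) (at_right 0)"
    by (rule tendsto_cong[THEN iffD1, rotated])
       (auto simp: eventually_at_filter flat_def exp_minus divide_inverse mult.commute)
  have L: "(flat m \<longlongrightarrow> 0) (at_left 0)"
    by (rule tendsto_cong[THEN iffD1, OF _ tendsto_const])
       (auto simp: eventually_at_filter flat_def)
  from L R show ?thesis by (simp add: filterlim_split_at)
qed

text \<open>The powers of \<open>inverse t\<close> are carried along because differentiation then
  stays inside the family, up to linear combinations; no closed form of higher derivatives is ever
  required.\<close>

lemma flat_has_derivative:
  "(flat m has_real_derivative (flat (m + 2) t - real m * flat (m + 1) t)) (at t)"
proof (cases "t = 0")
  case True
  \<comment> \<open>At 0 the difference quotient is itself the next member of the family, which
    tends to 0.\<close>
  have "(\<lambda>h. (flat m (0 + h) - flat m 0) / h) = flat (Suc m)"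
    by (auto simp: flat_def fun_eq_iff divide_inverse)
  then show ?thesis
    using flat_tendsto_0[of "Suc m"] True by (simp add: DERIV_def flat_def)
next
  case False
  show ?thesis
  proof (cases "t < 0")
    case True
    have "((\<lambda>_. 0) has_real_derivative 0) (at t)" by simp
    then have "(flat m has_real_derivative 0) (at t)"
      by (rule DERIV_cong_ev[THEN iffD1, rotated 3])
         (use True in \<open>auto simp: flat_def intro!: eventually_nhds_in_open[of "{..<0}", THEN eventually_mono]\<close>)
    then show ?thesis using True by (simp add: flat_def)
  next
    case nn: False
    with False have t: "t > 0" by simp
    have 1: "(inverse has_real_derivative - (inverse t ^ 2)) (at t)"
      using DERIV_inverse[of t] t by (simp add: power2_eq_square)
    have 2: "((\<lambda>t. exp (- inverse t)) has_real_derivative exp (- inverse t) * inverse t ^ 2) (at t)"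
      using DERIV_chain2[OF DERIV_exp DERIV_minus[OF 1]] by simp
    have 3: "((\<lambda>t. inverse t ^ m) has_real_derivative - (real m * inverse t ^ (m + 1))) (at t)"
      by (rule DERIV_cong[OF DERIV_power[OF 1, of m]]) (cases m; simp add: power2_eq_square)
    have "((\<lambda>t. exp (- inverse t) * inverse t ^ m) has_real_derivative
        (flat (m + 2) t - real m * flat (m + 1) t)) (at t)"
      by (rule DERIV_cong[OF DERIV_mult[OF 2 3]])
         (use t in \<open>simp add: flat_def algebra_simps power2_eq_square\<close>)
    then show ?thesis
      by (rule DERIV_cong_ev[THEN iffD1, rotated 3])
         (use t in \<open>auto simp: flat_def intro!: eventually_nhds_in_open[of "{0<..}", THEN eventually_mono]\<close>)
  qed
qed

text \<open>Each generator vanishes outside (-1, 1), and closure under sums and multiples is all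
  that the product rule asks for, so the span is stable under differentiation.\<close>

inductive bump_span :: "(real \<Rightarrow> real) \<Rightarrow> bool" where
  base: "bump_span (\<lambda>t. flat m (1 + t) * flat n (1 - t))"
| add: "bump_span f \<Longrightarrow> bump_span g \<Longrightarrow> bump_span (\<lambda>t. f t + g t)"
| cmul: "bump_span f \<Longrightarrow> bump_span (\<lambda>t. c * f t)"

lemma bump_span_derivative:
  assumes "bump_span f"
  shows "\<exists>f'. bump_span f' \<and> (\<forall>t. (f has_real_derivative f' t) (at t))"
  using assms
proof induction
  case (base m n)
  let ?f' = "\<lambda>t. (flat (m + 2) (1 + t) * flat n (1 - t) + (- real m) * (flat (m + 1) (1 + t) * flat n (1 - t)))
     + ((-1) * (flat m (1 + t) * flat (n + 2) (1 - t)) + real n * (flat m (1 + t) * flat (n + 1) (1 - t)))"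
  have "bump_span ?f'" by (intro bump_span.intros)
  moreover have "((\<lambda>t. flat m (1 + t) * flat n (1 - t)) has_real_derivative ?f' t) (at t)" for t
  proof -
    have 1: "((\<lambda>t. flat m (1 + t)) has_real_derivative (flat (m + 2) (1 + t) - real m * flat (m + 1) (1 + t)) * 1) (at t)"
      by (rule DERIV_chain2[OF flat_has_derivative]) (auto intro!: derivative_eq_intros)
    have 2: "((\<lambda>t. flat n (1 - t)) has_real_derivative (flat (n + 2) (1 - t) - real n * flat (n + 1) (1 - t)) * (-1)) (at t)"
      by (rule DERIV_chain2[OF flat_has_derivative]) (auto intro!: derivative_eq_intros)
    show ?thesis
      by (rule DERIV_cong[OF DERIV_mult[OF 1 2]]) (simp add: algebra_simps)
  qed
  ultimately show ?case by blast
next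
  case (add f g)
  then obtain f' g' where "bump_span f'" "bump_span g'"
    "\<And>t. (f has_real_derivative f' t) (at t)" "\<And>t. (g has_real_derivative g' t) (at t)" by blast
  then show ?case by (intro exI[of _ "\<lambda>t. f' t + g' t"]) (auto intro: bump_span.add DERIV_add)
next
  case (cmul f c)
  then obtain f' where "bump_span f'" "\<And>t. (f has_real_derivative f' t) (at t)" by blast
  then show ?case by (intro exI[of _ "\<lambda>t. c * f' t"]) (auto intro: bump_span.cmul DERIV_cmult)
qed

text \<open>The whole sequence \<open>d\<close> of derivatives is delivered, not just a smooth
  function: smoothness of products in several variables is proved below by recording which
  derivative sits in each factor.\<close>

lemma smooth_bump:
  "\<exists>d :: nat \<Rightarrow> real \<Rightarrow> real. (\<forall>k t. (d k has_real_derivative d (Suc k) t) (at t)) \<and>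
    (\<forall>t. d 0 t \<ge> 0) \<and> d 0 0 > 0 \<and> (\<forall>t. \<bar>t\<bar> \<ge> 1 \<longrightarrow> d 0 t = 0)"
proof -
  define g where "g t = flat 0 (1 + t) * flat 0 (1 - t)" for t
  have "\<exists>d. \<forall>k. (bump_span (d k) \<and> (k = 0 \<longrightarrow> d k = g)) \<and> (\<forall>t. (d k has_real_derivative d (Suc k) t) (at t))"
    by (rule dependent_nat_choice[where P = "\<lambda>k f. bump_span f \<and> (k = 0 \<longrightarrow> f = g)" and Q = "\<lambda>k f f'. \<forall>t. (f has_real_derivative f' t) (at t)"])
       (use bump_span_derivative bump_span.base[of 0 0] in \<open>auto simp: g_def[abs_def]\<close>)
  then obtain d where d: "d 0 = g" "\<And>k t. (d k has_real_derivative d (Suc k) t) (at t)" by blast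
  show ?thesis
    by (rule exI[of _ d]) (auto simp: d g_def flat_def)
qed

text \<open>The map \<open>k\<close> is a multi-index: a partial derivative in direction
  \<open>b\<close> raises \<open>k b\<close> by one and contributes the factor \<open>l\<close>. The
  class of these products is therefore closed under partial derivatives. Shifts \<open>p\<close> and
  a possibly negative \<open>l\<close> cover the reflected translates of a kernel.\<close>

lemma prod_scaled_has_derivative:
  fixes d :: "nat \<Rightarrow> real \<Rightarrow> real" and k :: "'a::euclidean_space \<Rightarrow> nat"
  assumes d: "\<And>k t. (d k has_real_derivative d (Suc k) t) (at t)"
  shows "((\<lambda>y::'a. c * (\<Prod>b\<in>Basis. d (k b) (p b + l * (y \<bullet> b)))) has_derivative
     (\<lambda>h. \<Sum>b\<in>Basis. (c * l * (\<Prod>b'\<in>Basis. d ((k(b := Suc (k b))) b') (p b' + l * (y \<bullet> b')))) * (h \<bullet> b))) (at y)"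
proof -
  have 1: "((\<lambda>y::'a. d (k b) (p b + l * (y \<bullet> b))) has_derivative (\<lambda>h. d (Suc (k b)) (p b + l * (y \<bullet> b)) * (l * (h \<bullet> b)))) (at y)" for b
    by (rule has_derivative_compose[OF _ d[unfolded has_field_derivative_def], of "\<lambda>y. p b + l * (y \<bullet> b)"])
       (auto intro!: derivative_eq_intros)
  have 2: "(\<Prod>b'\<in>Basis. d ((k(b := Suc (k b))) b') (p b' + l * (y \<bullet> b')))
    = d (Suc (k b)) (p b + l * (y \<bullet> b)) * (\<Prod>b'\<in>Basis - {b}. d (k b') (p b' + l * (y \<bullet> b')))" if "b \<in> Basis" for b :: 'a
  proof -
    have "(\<Prod>b'\<in>Basis - {b}. d ((k(b := Suc (k b))) b') (p b' + l * (y \<bullet> b'))) = (\<Prod>b'\<in>Basis - {b}. d (k b') (p b' + l * (y \<bullet> b')))"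
      by (rule prod.cong) auto
    then show ?thesis using that by (subst prod.remove[of _ b]) auto
  qed
  show ?thesis
    by (rule has_derivative_eq_rhs[OF has_derivative_mult_right[OF has_derivative_prod[OF 1]]])
       (auto simp: fun_eq_iff sum_distrib_left 2 algebra_simps simp del: fun_upd_apply intro!: sum.cong)
qed

lemma C_diff_prod_scaled:
  fixes d :: "nat \<Rightarrow> real \<Rightarrow> real" and k :: "'a::euclidean_space \<Rightarrow> nat"
  assumes d: "\<And>k t. (d k has_real_derivative d (Suc k) t) (at t)"
  shows "C_diff j (\<lambda>y::'a. c * (\<Prod>b\<in>Basis. d (k b) (p b + l * (y \<bullet> b))))"
proof (induction j arbitrary: c k)
  case 0
  have "(\<lambda>y::'a. c * (\<Prod>b\<in>Basis. d (k b) (p b + l * (y \<bullet> b)))) differentiable (at x)" for x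
    using prod_scaled_has_derivative[of d, OF d] unfolding differentiable_def by blast
  then show ?case
    by (auto intro!: continuous_at_imp_continuous_on differentiable_imp_continuous_within)
next
  case (Suc j)
  have "partial_deriv b (\<lambda>y::'a. c * (\<Prod>b\<in>Basis. d (k b) (p b + l * (y \<bullet> b))))
     = (\<lambda>y. (c * l) * (\<Prod>b'\<in>Basis. d ((k(b := Suc (k b))) b') (p b' + l * (y \<bullet> b'))))" if "b \<in> Basis" for b
    unfolding partial_deriv_def fun_eq_iff
    by (subst frechet_derivative_at[OF prod_scaled_has_derivative[of d, OF d], symmetric])
       (use that in \<open>simp add: inner_Basis if_distrib[of "\<lambda>x. _ * x"] sum.delta' cong: if_cong\<close>)
  then show ?case
    using Suc differentiableI[OF prod_scaled_has_derivative[of d c k p l, OF d]]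
    by (simp del: fun_upd_apply differentiable_cmult_left_iff)
qed

text \<open>The reflected translates are listed separately because they are what convolution inserts
  into the weak identities, as functions of the integration variable.\<close>

lemma kernel_exists:
  assumes "r > 0"
  obtains \<rho> :: "'a::euclidean_space \<Rightarrow> real"
  where "\<And>x. test_function (\<lambda>y. \<rho> (x - y))" "test_function \<rho>" "\<And>z. \<rho> z \<ge> 0"
    "\<And>z. norm z \<ge> r \<Longrightarrow> \<rho> z = 0" "integrable lborel \<rho>" "integral\<^sup>L lborel \<rho> = 1"
proof -
  obtain d where d: "\<And>k t. (d k has_real_derivative d (Suc k) t) (at t)"
    "\<And>t. d 0 t \<ge> 0" "d 0 0 > (0::real)" "\<And>t. \<bar>t\<bar> \<ge> 1 \<Longrightarrow> d 0 t = 0"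
    using smooth_bump by blast
  \<comment> \<open>With this scale a nonzero product forces every coordinate below
    \<open>r / DIM('a)\<close>, hence the sum of the absolute coordinates, and with it the norm,
    below \<open>r\<close>.\<close>
  define l where "l = real DIM('a) / r"
  have l: "l > 0" using assms by (simp add: l_def)
  define g where "g z = (\<Prod>b\<in>Basis. d 0 (l * (z \<bullet> b)))" for z :: 'a
  have g0: "g z = 0" if "norm z \<ge> r" for z
  proof (rule ccontr)
    assume nz: "g z \<noteq> 0"
    have "\<bar>z \<bullet> b\<bar> < r / DIM('a)" if "b \<in> Basis" for b
    proof -
      have "d 0 (l * (z \<bullet> b)) \<noteq> 0" using nz that by (auto simp: g_def)
      then have "\<bar>l * (z \<bullet> b)\<bar> < 1" using d(4)[of "l * (z \<bullet> b)"] by linarith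
      then show ?thesis using assms l by (auto simp: l_def abs_mult field_simps)
    qed
    then have "(\<Sum>b\<in>Basis. \<bar>z \<bullet> b\<bar>) < (\<Sum>b\<in>(Basis::'a set). r / DIM('a))"
      by (intro sum_strict_mono) auto
    also have "\<dots> = r" by simp
    finally show False using norm_le_l1[of z] that by linarith
  qed
  have gpos: "g z \<ge> 0" for z unfolding g_def by (intro prod_nonneg) (auto simp: d)
  have C: "C_diff j (\<lambda>y. c * g (x + s *\<^sub>R y))" for j c x s
    using C_diff_prod_scaled[of d j c "\<lambda>_. 0" "\<lambda>b. l * (x \<bullet> b)" "l * s", OF d(1)]
    by (simp add: g_def inner_add_left algebra_simps)
  have cont: "continuous_on UNIV g" using C[of 0 1 0 1] by simp
  have "integrable lborel (\<lambda>z. indicat_real (cball 0 r) z *\<^sub>R g z)"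
    by (rule borel_integrable_compact[unfolded set_integrable_def, of "cball 0 r" g])
       (auto intro: continuous_on_subset[OF cont])
  also have "(\<lambda>z. indicat_real (cball 0 r) z *\<^sub>R g z) = g"
    using g0 by (auto simp: fun_eq_iff indicator_def)
  finally have int: "integrable lborel g" .
  have "integral\<^sup>L lborel g > 0"
  proof -
    have "integral\<^sup>L lborel g \<noteq> 0"
    proof
      assume "integral\<^sup>L lborel g = 0"
      then have "AE z in lborel. g z = 0"
        using integral_nonneg_eq_0_iff_AE[OF int] gpos by auto
      moreover have "open {z. g z \<noteq> 0}"
        by (rule open_Collect_neq[OF cont]) auto
      moreover have "0 \<in> {z. g z \<noteq> 0}" using d(3) by (auto simp: g_def)
      moreover have "negligible {z. g z \<noteq> 0}"
        using \<open>AE z in lborel. g z = 0\<close> by (simp add: negligible_iff_null_sets AE_iff_null_sets AE_completion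
          borel_open \<open>open {z. g z \<noteq> 0}\<close>)
      ultimately show False using open_not_negligible by blast
    qed
    moreover have "integral\<^sup>L lborel g \<ge> 0" using gpos by simp
    ultimately show ?thesis by linarith
  qed
  define c where "c = 1 / integral\<^sup>L lborel g"
  have c: "c > 0" using \<open>integral\<^sup>L lborel g > 0\<close> by (simp add: c_def)
  have K: "compact (closure {y. c * g (x + s *\<^sub>R y) \<noteq> 0})" if "\<bar>s\<bar> = 1" for x s
  proof -
    have "{y. c * g (x + s *\<^sub>R y) \<noteq> 0} \<subseteq> cball 0 (r + norm x)"
    proof
      fix y assume "y \<in> {y. c * g (x + s *\<^sub>R y) \<noteq> 0}"
      then have "norm (x + s *\<^sub>R y) < r" using g0 by (metis (mono_tags, lifting) mem_Collect_eq mult_zero_right not_le)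
      moreover have "norm (s *\<^sub>R y) \<le> norm (x + s *\<^sub>R y) + norm x"
        using norm_triangle_ineq4[of "x + s *\<^sub>R y" x] by simp
      ultimately show "y \<in> cball 0 (r + norm x)" using that by simp
    qed
    then show ?thesis by (meson bounded_cball bounded_subset compact_closure)
  qed
  show ?thesis
  proof (rule that[of "\<lambda>z. c * g z"])
    show "test_function (\<lambda>y. c * g (x - y))" for x
      using C[of _ c x "-1"] K[of "-1" x] by (auto simp: test_function_def)
    show "test_function (\<lambda>y. c * g y)"
      using C[of _ c 0 1] K[of 1 0] by (auto simp: test_function_def)
    show "integrable lborel (\<lambda>z. c * g z)" using int by simp
    show "integral\<^sup>L lborel (\<lambda>z. c * g z) = 1"
      using \<open>integral\<^sup>L lborel g > 0\<close> by (simp add: c_def)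
  qed (use c gpos g0 in auto)
qed

section \<open>Continuously differentiable functions\<close>

text \<open>Classical counterpart of \<open>has_weak_gradient\<close>: the gradient is an explicit
  vector field, so both notions have the same shape in integrations by parts.\<close>

definition C1_gradient :: "('a::euclidean_space \<Rightarrow> real) \<Rightarrow> ('a \<Rightarrow> 'a) \<Rightarrow> bool" where
  "C1_gradient f F \<longleftrightarrow> (\<forall>x. (f has_derivative (\<lambda>h. F x \<bullet> h)) (at x)) \<and> continuous_on UNIV F"

lemma C1_gradient_continuous: "C1_gradient f F \<Longrightarrow> continuous_on UNIV f" "C1_gradient f F \<Longrightarrow> continuous_on UNIV F"
  unfolding C1_gradient_def
  by (auto intro!: continuous_at_imp_continuous_on dest: has_derivative_continuous)

lemma C1_gradient_measurable:
  assumes "C1_gradient f F"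
  shows "f \<in> borel_measurable borel" "F \<in> borel_measurable borel"
    "f \<in> borel_measurable lebesgue" "F \<in> borel_measurable lebesgue"
proof -
  show "f \<in> borel_measurable borel" "F \<in> borel_measurable borel"
    using C1_gradient_continuous[OF assms] by (auto intro: borel_measurable_continuous_onI)
  then show "f \<in> borel_measurable lebesgue" "F \<in> borel_measurable lebesgue"
    by (simp_all add: measurable_completion)
qed

lemma C1_gradient_zero:
  assumes "C1_gradient f F" "open S" "\<And>x. x \<in> S \<Longrightarrow> f x = c" "x \<in> S"
  shows "F x = 0"
proof -
  have "(f has_derivative (\<lambda>h. 0)) (at x)"
    by (rule has_derivative_transform_within_open[OF has_derivative_const assms(2,4)])
       (use assms(3) in auto)
  moreover have "(f has_derivative (\<lambda>h. F x \<bullet> h)) (at x)"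
    using assms(1) by (simp add: C1_gradient_def)
  ultimately have "(\<lambda>h. F x \<bullet> h) = (\<lambda>h. 0)" by (rule has_derivative_unique[rotated])
  then have "F x \<bullet> F x = 0" by metis
  then show ?thesis by simp
qed

lemma C1_gradient_mult:
  assumes "C1_gradient f F" "C1_gradient g G"
  shows "C1_gradient (\<lambda>x. f x * g x) (\<lambda>x. f x *\<^sub>R G x + g x *\<^sub>R F x)"
  using assms C1_gradient_continuous[OF assms(1)] C1_gradient_continuous[OF assms(2)]
  unfolding C1_gradient_def
  by (auto intro!: continuous_intros derivative_eq_intros simp: inner_add_left fun_eq_iff)

lemma C1_gradient_compose:
  assumes "C1_gradient f F" "\<And>t. (\<beta> has_real_derivative \<beta>' t) (at t)" "continuous_on UNIV \<beta>'"
  shows "C1_gradient (\<lambda>x. \<beta> (f x)) (\<lambda>x. \<beta>' (f x) *\<^sub>R F x)"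
proof -
  have "((\<lambda>x. \<beta> (f x)) has_derivative (\<lambda>h. (\<beta>' (f x) *\<^sub>R F x) \<bullet> h)) (at x)" for x
  proof -
    have "(f has_derivative (\<lambda>h. F x \<bullet> h)) (at x)" using assms(1) by (simp add: C1_gradient_def)
    from DERIV_compose_FDERIV[OF assms(2) this] show ?thesis
      by (rule has_derivative_eq_rhs) (auto simp: fun_eq_iff)
  qed
  moreover have "continuous_on UNIV (\<lambda>x. \<beta>' (f x) *\<^sub>R F x)"
    using C1_gradient_continuous[OF assms(1)]
    by (intro continuous_intros continuous_on_compose2[OF assms(3)]) auto
  ultimately show ?thesis unfolding C1_gradient_def by blast
qed

lemma C1_gradient_norm_sq: "C1_gradient (\<lambda>x. (norm x)\<^sup>2) (\<lambda>x. 2 *\<^sub>R x)"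
  unfolding C1_gradient_def power2_norm_eq_inner
  by (auto intro!: continuous_intros derivative_eq_intros simp: inner_commute fun_eq_iff)

lemma C1_gradient_mvt:
  assumes "C1_gradient f F"
  shows "\<exists>u\<in>{0..1}. f (x + h) - f x = F (x + u *\<^sub>R h) \<bullet> h"
proof -
  have "((\<lambda>s. f (x + s *\<^sub>R h)) has_real_derivative F (x + s *\<^sub>R h) \<bullet> h) (at s)" for s
  proof -
    have "(f has_derivative (\<lambda>v. F (x + s *\<^sub>R h) \<bullet> v)) (at (x + s *\<^sub>R h))"
      using assms(1) by (simp add: C1_gradient_def)
    then have "((\<lambda>s. f (x + s *\<^sub>R h)) has_derivative (\<lambda>t. F (x + s *\<^sub>R h) \<bullet> (t *\<^sub>R h))) (at s)"
      by (rule has_derivative_compose[rotated]) (auto intro!: derivative_eq_intros)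
    then show ?thesis
      unfolding has_field_derivative_def by (rule has_derivative_eq_rhs) (auto simp: fun_eq_iff)
  qed
  then obtain z where "0 < z" "z < 1" "f (x + 1 *\<^sub>R h) - f (x + 0 *\<^sub>R h) = (1 - 0) * (F (x + z *\<^sub>R h) \<bullet> h)"
    using MVT2[of 0 1 "\<lambda>s. f (x + s *\<^sub>R h)" "\<lambda>s. F (x + s *\<^sub>R h) \<bullet> h"] by auto
  then show ?thesis by (intro bexI[of _ z]) auto
qed

lemma bounded_of_compact_support:
  fixes F :: "'a::euclidean_space \<Rightarrow> 'b::real_normed_vector"
  assumes "continuous_on UNIV F" "\<And>x. norm x > R \<Longrightarrow> F x = 0"
  obtains B where "B > 0" "\<And>x. norm (F x) \<le> B"
proof -
  have "bounded (F ` cball 0 R)"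
    by (intro compact_imp_bounded compact_continuous_image continuous_on_subset[OF assms(1)]) auto
  then obtain B where B: "B > 0" "\<And>x. x \<in> cball 0 R \<Longrightarrow> norm (F x) \<le> B"
    unfolding bounded_pos by auto
  have "norm (F x) \<le> B" for x
    using B assms(2)[of x] by (cases "norm x \<le> R") auto
  with B(1) show ?thesis by (rule that)
qed

lemma uniformly_continuous_of_compact_support:
  fixes F :: "'a::euclidean_space \<Rightarrow> 'b::real_normed_vector"
  assumes "continuous_on UNIV F" "\<And>x. norm x > R \<Longrightarrow> F x = 0"
  shows "uniformly_continuous_on UNIV F"
proof -
  have u: "uniformly_continuous_on (cball 0 (R + 1)) F"
    by (intro compact_uniformly_continuous continuous_on_subset[OF assms(1)]) auto
  show ?thesis
    unfolding uniformly_continuous_on_def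
  proof (intro allI impI)
    fix e :: real assume e: "e > 0"
    from u[unfolded uniformly_continuous_on_def, rule_format, OF e] obtain d
      where d: "d > 0" "\<And>x y. x \<in> cball 0 (R + 1) \<Longrightarrow> y \<in> cball 0 (R + 1) \<Longrightarrow> dist y x < d \<Longrightarrow> dist (F y) (F x) < e"
      by metis
    have "dist (F y) (F x) < e" if xy: "dist y x < min d 1" for x y
    proof (cases "norm x > R \<and> norm y > R")
      case True
      then show ?thesis using assms(2) e by simp
    next
      case False
      have "norm y \<le> norm x + dist y x" "norm x \<le> norm y + dist y x"
        using norm_triangle_ineq2[of y x] norm_triangle_ineq2[of x y] by (auto simp: dist_norm norm_minus_commute)
      then have "x \<in> cball 0 (R + 1)" "y \<in> cball 0 (R + 1)" using xy False by auto
      then show ?thesis using d xy by auto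
    qed
    then show "\<exists>d>0. \<forall>x\<in>UNIV. \<forall>x'\<in>UNIV. dist x' x < d \<longrightarrow> dist (F x') (F x) < e"
      using d(1) by (intro exI[of _ "min d 1"]) auto
  qed
qed

text \<open>Translation invariance of Lebesgue measure replaces any boundary argument: difference
  quotients of \<open>f\<close> integrate to 0, converge to the directional derivative, and are
  dominated through the mean value theorem.\<close>

lemma C1_gradient_integral_zero:
  fixes f :: "'a::euclidean_space \<Rightarrow> real"
  assumes C: "C1_gradient f F" and z: "\<And>x. norm x \<ge> R \<Longrightarrow> f x = 0"
  shows "integrable lebesgue F" "integral\<^sup>L lebesgue F = 0"
proof -
  have Fz: "F x = 0" if "norm x > R" for x
    by (rule C1_gradient_zero[OF C, of "{x. norm x > R}" 0])
       (use that z in \<open>auto intro!: open_Collect_less continuous_intros\<close>)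
  obtain B where B: "B > 0" "\<And>x. norm (F x) \<le> B"
    using bounded_of_compact_support[OF C1_gradient_continuous(2)[OF C] Fz] by blast
  have m: "f \<in> borel_measurable borel" "F \<in> borel_measurable borel"
    using C1_gradient_measurable[OF C] by auto
  have ib: "integrable lborel (\<lambda>x::'a. B * indicator (cball 0 R) x :: real)" for B R
    using emeasure_lborel_cball_finite[of "0::'a" R] by (intro integrable_mult_right integrable_real_indicator) (simp_all)
  have iF: "integrable lborel F"
    by (rule Bochner_Integration.integrable_bound[OF ib[of B R]])
       (use m B Fz in \<open>auto simp: indicator_def not_le\<close>)
  have bf: "norm (f x) \<le> B * (2 * \<bar>R\<bar> + 1)" for x
  proof (cases "norm x \<ge> R")
    case True then show ?thesis using z B by simp
  next
    case False
    obtain b :: 'a where b: "b \<in> Basis" using nonempty_Basis by blast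
    \<comment> \<open>This displacement is long enough to reach a zero of \<open>f\<close> from any
      point of the ball, so the mean value theorem bounds \<open>f x\<close> itself.\<close>
    define h where "h = (R + norm x) *\<^sub>R b"
    have "R + norm x \<ge> 0" using False norm_ge_zero[of x] by linarith
    then have nh: "norm h = R + norm x" using b by (simp add: h_def)
    obtain u where "f (x + h) - f x = F (x + u *\<^sub>R h) \<bullet> h" using C1_gradient_mvt[OF C] by blast
    moreover have "norm (x + h) \<ge> R" using norm_triangle_ineq2[of h "-x"] nh by (auto simp: add.commute)
    ultimately have "norm (f x) \<le> norm (F (x + u *\<^sub>R h)) * norm h"
      using z Cauchy_Schwarz_ineq2[of "F (x + u *\<^sub>R h)" h] by (auto simp: abs_minus_commute)
    also have "\<dots> \<le> B * (2 * \<bar>R\<bar> + 1)"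
      using B False nh \<open>R + norm x \<ge> 0\<close> by (intro mult_mono) auto
    finally show ?thesis .
  qed
  have if_: "integrable lborel f"
    by (rule Bochner_Integration.integrable_bound[OF ib[of "B * (2 * \<bar>R\<bar> + 1)" R]])
       (use m bf z in \<open>auto simp: indicator_def not_le less_imp_le intro!: AE_I2 order_trans[OF _ abs_ge_self]\<close>)
  have "integral\<^sup>L lborel (\<lambda>x. F x \<bullet> v) = 0" for v
  proof -
    define t :: "nat \<Rightarrow> real" where "t n = inverse (real (Suc n))" for n
    have t: "t n > 0" "t n \<le> 1" for n by (auto simp: t_def divide_simps)
    have t0: "t \<longlonglongrightarrow> 0" unfolding t_def by (rule LIMSEQ_inverse_real_of_nat)
    define g where "g n x = (f (x + t n *\<^sub>R v) - f x) / t n" for n x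
    have shift: "integrable lborel (\<lambda>x. f (x + c))" "integral\<^sup>L lborel (\<lambda>x. f (x + c)) = integral\<^sup>L lborel f" for c
    proof -
      have "f \<in> borel_measurable (distr lborel borel ((+) c))" using m by simp
      then show "integrable lborel (\<lambda>x. f (x + c))" "integral\<^sup>L lborel (\<lambda>x. f (x + c)) = integral\<^sup>L lborel f"
        using integrable_distr_eq[of "(+) c" lborel borel f] integral_distr[of "(+) c" lborel borel f] if_ m
        by (auto simp: lborel_distr_plus add.commute)
    qed
    have "(\<lambda>n. integral\<^sup>L lborel (g n)) \<longlonglongrightarrow> integral\<^sup>L lborel (\<lambda>x. F x \<bullet> v)"
    proof (rule integral_dominated_convergence[where w = "\<lambda>x::'a. (B * norm v) * indicator (cball 0 (R + norm v)) x"])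
      show "integrable lborel (\<lambda>x::'a. (B * norm v) * indicator (cball 0 (R + norm v)) x :: real)" by (rule ib)
      show "(\<lambda>x. F x \<bullet> v) \<in> borel_measurable lborel" using m by simp
      show "g n \<in> borel_measurable lborel" for n unfolding g_def using m by simp
      show "AE x in lborel. (\<lambda>n. g n x) \<longlonglongrightarrow> F x \<bullet> v"
      proof (rule AE_I2)
        fix x
        have "(f has_derivative (\<lambda>h. F x \<bullet> h)) (at x)" using C by (simp add: C1_gradient_def)
        then have "((\<lambda>s. f (x + s *\<^sub>R v)) has_derivative (\<lambda>s. F x \<bullet> (s *\<^sub>R v))) (at 0)"
          by (intro has_derivative_compose[where g = f and f = "\<lambda>s. x + s *\<^sub>R v", rotated])
             (auto intro!: derivative_eq_intros)
        then have "((\<lambda>s. f (x + s *\<^sub>R v)) has_real_derivative F x \<bullet> v) (at 0)"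
          unfolding has_field_derivative_def by (rule has_derivative_eq_rhs) (auto simp: fun_eq_iff)
        then have "((\<lambda>s. (f (x + s *\<^sub>R v) - f x) / s) \<longlongrightarrow> F x \<bullet> v) (at 0)"
          unfolding DERIV_def by simp
        then show "(\<lambda>n. g n x) \<longlonglongrightarrow> F x \<bullet> v" unfolding g_def
          by (rule filterlim_compose) (use t t0 in \<open>auto simp: filterlim_at less_imp_neq[symmetric] dest: less_imp_neq\<close>)
      qed
      show "AE x in lborel. norm (g n x) \<le> (B * norm v) * indicator (cball 0 (R + norm v)) x" for n
      proof (rule AE_I2)
        fix x
        show "norm (g n x) \<le> (B * norm v) * indicator (cball 0 (R + norm v)) x"
        proof (cases "norm x \<le> R + norm v")
          case True
          obtain u where u: "f (x + t n *\<^sub>R v) - f x = F (x + u *\<^sub>R t n *\<^sub>R v) \<bullet> (t n *\<^sub>R v)"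
            using C1_gradient_mvt[OF C] by blast
          then have "g n x = F (x + u *\<^sub>R t n *\<^sub>R v) \<bullet> v" using t[of n] by (simp add: g_def)
          then have "norm (g n x) \<le> norm (F (x + u *\<^sub>R t n *\<^sub>R v)) * norm v"
            using Cauchy_Schwarz_ineq2 by auto
          also have "\<dots> \<le> B * norm v" using B by (intro mult_right_mono) auto
          finally show ?thesis using True by simp
        next
          case False
          have "t n * norm v \<le> norm v" using t[of n] by (simp add: mult_left_le_one_le)
          moreover have "norm (x + t n *\<^sub>R v) \<ge> norm x - t n * norm v"
            using norm_triangle_ineq2[of x "- (t n *\<^sub>R v)"] t[of n] by simp
          moreover have "norm v \<ge> 0" by simp
          ultimately have "norm (x + t n *\<^sub>R v) \<ge> R" "norm x \<ge> R" using False by linarith+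
          then show ?thesis using z False by (simp add: g_def)
        qed
      qed
    qed
    moreover have "integral\<^sup>L lborel (g n) = 0" for n
      unfolding g_def using shift[of "t n *\<^sub>R v"] if_ by simp
    ultimately show ?thesis by (simp add: LIMSEQ_const_iff)
  qed
  then have "integral\<^sup>L lborel F \<bullet> v = 0" for v
    using integral_inner_left[OF iF, of v] by simp
  then have "integral\<^sup>L lborel F = 0" by (metis inner_eq_zero_iff)
  then show "integral\<^sup>L lebesgue F = 0" "integrable lebesgue F"
    using integral_completion[of F lborel] integrable_completion[of F lborel] m iF by auto
qed

section \<open>Mollification\<close>

lemma L1_loc_integrable_cball:
  "L1_loc f \<Longrightarrow> integrable lebesgue (\<lambda>x. indicat_real (cball 0 R) x *\<^sub>R f x)"
  unfolding L1_loc_def set_integrable_def by (simp add: compact_cball)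

lemma L1_loc_measurable:
  assumes "L1_loc f" shows "f \<in> borel_measurable lebesgue"
proof (rule borel_measurable_LIMSEQ_metric)
  show "(\<lambda>x. indicat_real (cball 0 (real n)) x *\<^sub>R f x) \<in> borel_measurable lebesgue" for n
    using L1_loc_integrable_cball[OF assms] by (rule borel_measurable_integrable)
  fix x :: 'a
  obtain N where N: "norm x \<le> real N" using real_arch_simple by blast
  show "(\<lambda>n. indicat_real (cball 0 (real n)) x *\<^sub>R f x) \<longlonglongrightarrow> f x"
    by (rule tendsto_eventually) (use N in \<open>auto simp: eventually_sequentially intro!: exI[of _ N]\<close>)
qed

lemma L1_locI:
  assumes "f \<in> borel_measurable lebesgue"
    and "\<And>R. integrable lebesgue (\<lambda>x. indicat_real (cball 0 R) x *\<^sub>R f x)"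
  shows "L1_loc f"
  unfolding L1_loc_def
proof (intro allI impI)
  fix K :: "'a set" assume K: "compact K"
  from compact_imp_bounded[OF K] obtain R where "\<And>x. x \<in> K \<Longrightarrow> norm x \<le> R" unfolding bounded_iff by blast
  then have "K \<subseteq> cball 0 R" by auto
  moreover have "K \<in> sets lebesgue" using lmeasurable_compact[OF K] by blast
  moreover have "set_integrable lebesgue (cball 0 R) f"
    unfolding set_integrable_def by (rule assms)
  ultimately show "f absolutely_integrable_on K"
    by (intro set_integrable_subset[of lebesgue "cball 0 R" f K])
qed

lemma integrable_L1_loc_bound:
  fixes f :: "'a::euclidean_space \<Rightarrow> 'b::euclidean_space" and g :: "'a \<Rightarrow> 'c::euclidean_space"
  assumes "L1_loc f" "g \<in> borel_measurable lebesgue"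
    and "\<And>x. norm (g x) \<le> B * norm (f x)" "\<And>x. norm x > R \<Longrightarrow> g x = 0"
  shows "integrable lebesgue g"
proof (rule Bochner_Integration.integrable_bound)
  show "integrable lebesgue (\<lambda>x. B * norm (indicat_real (cball 0 R) x *\<^sub>R f x))"
    by (intro integrable_mult_right integrable_norm L1_loc_integrable_cball assms)
  show "AE x in lebesgue. norm (g x) \<le> norm (B * norm (indicat_real (cball 0 R) x *\<^sub>R f x))"
  proof (rule AE_I2)
    fix x
    show "norm (g x) \<le> norm (B * norm (indicat_real (cball 0 R) x *\<^sub>R f x))"
      using assms(3)[of x] assms(4)[of x] by (cases "norm x \<le> R") auto
  qed
qed (rule assms)

lemma L1_loc_bound:
  fixes f :: "'a::euclidean_space \<Rightarrow> 'b::euclidean_space" and g :: "'a \<Rightarrow> 'c::euclidean_space"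
  assumes "L1_loc f" "g \<in> borel_measurable lebesgue" and "\<And>x. norm (g x) \<le> B * norm (f x)"
  shows "L1_loc g"
proof (rule L1_locI)
  show "integrable lebesgue (\<lambda>x. indicat_real (cball 0 R) x *\<^sub>R g x)" for R
  proof (rule integrable_L1_loc_bound[OF assms(1), where R = R])
    show "norm (indicat_real (cball 0 R) x *\<^sub>R g x) \<le> B * norm (f x)" for x
      using assms(3)[of x] order_trans[OF norm_ge_zero assms(3)[of x]] by (cases "norm x \<le> R") auto
    show "(\<lambda>x. indicat_real (cball 0 R) x *\<^sub>R g x) \<in> borel_measurable lebesgue"
      using assms(2) by (intro borel_measurable_scaleR borel_measurable_indicator) auto
  qed auto
qed (rule assms)

lemma L1_loc_add:
  fixes f g :: "'a::euclidean_space \<Rightarrow> 'b::euclidean_space"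
  assumes "L1_loc f" "L1_loc g" shows "L1_loc (\<lambda>x. f x + g x)"
proof (rule L1_locI)
  show "(\<lambda>x. f x + g x) \<in> borel_measurable lebesgue"
    by (intro borel_measurable_add L1_loc_measurable assms)
  show "integrable lebesgue (\<lambda>x. indicat_real (cball 0 R) x *\<^sub>R (f x + g x))" for R
    using Bochner_Integration.integrable_add[OF assms[THEN L1_loc_integrable_cball]] by (simp add: scaleR_add_right)
qed

lemma L1_loc_const: "L1_loc (\<lambda>_::'a::euclidean_space. c :: 'b::euclidean_space)"
proof (rule L1_locI)
  show "integrable lebesgue (\<lambda>x. indicat_real (cball 0 R) (x::'a) *\<^sub>R c)" for R
  proof (rule integrable_scaleR_left, rule integrable_real_indicator)
    show "emeasure lebesgue (cball (0::'a) R) < \<infinity>"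
      using emeasure_lborel_cball_finite[of "0::'a" R] by simp
  qed simp
qed simp

definition mollify :: "('a::euclidean_space \<Rightarrow> real) \<Rightarrow> ('a \<Rightarrow> 'b::euclidean_space) \<Rightarrow> 'a \<Rightarrow> 'b" where
  "mollify k f x = (LINT y|lebesgue. k (x - y) *\<^sub>R f y)"

lemma borel_measurable_reflect:
  fixes k :: "'a::euclidean_space \<Rightarrow> 'b::euclidean_space"
  assumes "k \<in> borel_measurable borel"
  shows "(\<lambda>y. k (x - y)) \<in> borel_measurable lebesgue"
proof -
  have "(\<lambda>y. k (x - y)) \<in> borel_measurable borel" using assms by measurable
  then show ?thesis by (simp add: measurable_completion)
qed

lemma norm_diff_gt: "norm (x - y) > r" if "norm y > norm x + r" for x y :: "'a::real_normed_vector"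
  using norm_triangle_ineq2[of y x] that by (simp add: norm_minus_commute)

lemma mollify_integrable:
  fixes f :: "'a::euclidean_space \<Rightarrow> 'b::euclidean_space"
  assumes "L1_loc f" "continuous_on UNIV k" "\<And>x. norm x > r \<Longrightarrow> k x = 0"
  shows "integrable lebesgue (\<lambda>y. k (x - y) *\<^sub>R f y)"
proof -
  obtain B where B: "\<And>x. norm (k x) \<le> B"
    using bounded_of_compact_support[OF assms(2,3)] by blast
  show ?thesis
  proof (rule integrable_L1_loc_bound[OF assms(1)])
    show "(\<lambda>y. k (x - y) *\<^sub>R f y) \<in> borel_measurable lebesgue"
      using L1_loc_measurable[OF assms(1)] borel_measurable_reflect[of k x] assms(2)
      by (intro borel_measurable_scaleR) (auto intro: borel_measurable_continuous_onI)
    show "norm (k (x - y) *\<^sub>R f y) \<le> B * norm (f y)" for y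
      using B[of "x - y"] by (auto intro: mult_right_mono)
    show "k (x - y) *\<^sub>R f y = 0" if "norm y > norm x + r" for y
      using assms(3) norm_diff_gt[OF that] by simp
  qed
qed

lemma mollify_grad_integrable:
  fixes f :: "'a::euclidean_space \<Rightarrow> real" and K :: "'a \<Rightarrow> 'b::euclidean_space"
  assumes "L1_loc f" "continuous_on UNIV K" "\<And>x. norm x > r \<Longrightarrow> K x = 0"
  shows "integrable lebesgue (\<lambda>y. f y *\<^sub>R K (x - y))"
proof -
  obtain B where B: "\<And>x. norm (K x) \<le> B"
    using bounded_of_compact_support[OF assms(2,3)] by blast
  show ?thesis
  proof (rule integrable_L1_loc_bound[OF assms(1)])
    show "(\<lambda>y. f y *\<^sub>R K (x - y)) \<in> borel_measurable lebesgue"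
      using L1_loc_measurable[OF assms(1)] borel_measurable_reflect[of K x] assms(2)
      by (intro borel_measurable_scaleR) (auto intro: borel_measurable_continuous_onI)
    show "norm (f y *\<^sub>R K (x - y)) \<le> B * norm (f y)" for y
      using B[of "x - y"] by (auto simp: mult.commute[of B] intro: mult_left_mono)
    show "f y *\<^sub>R K (x - y) = 0" if "norm y > norm x + r" for y
      using assms(3) norm_diff_gt[OF that] by simp
  qed
qed

text \<open>All derivatives fall on the kernel. Since \<open>f\<close> is merely locally integrable,
  the estimates rest on the uniform continuity of the compactly supported \<open>K\<close>.\<close>

lemma mollify_C1:
  fixes f :: "'a::euclidean_space \<Rightarrow> real"
  assumes f: "L1_loc f" and k: "C1_gradient k K" and z: "\<And>x. norm x \<ge> r \<Longrightarrow> k x = 0"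
  shows "C1_gradient (mollify k f) (\<lambda>x. LINT y|lebesgue. f y *\<^sub>R K (x - y))"
proof -
  note c = C1_gradient_continuous[OF k]
  have Kz: "K x = 0" if "norm x > r" for x
    by (rule C1_gradient_zero[OF k, of "{x. norm x > r}" 0])
       (use that z in \<open>auto intro!: open_Collect_less continuous_intros\<close>)
  note uc = uniformly_continuous_of_compact_support[OF c(2), of r, OF Kz, unfolded uniformly_continuous_on_def]
  \<comment> \<open>The L1 norm of \<open>f\<close> over a ball that contains the supports of all
    integrands below as long as the displacement is shorter than 1; it is the constant in both
    estimates.\<close>
  define A where "A x = (LINT y|lebesgue. norm (indicat_real (cball 0 (norm x + r + 1)) y *\<^sub>R f y))" for x :: 'a
  have A: "integrable lebesgue (\<lambda>y. norm (indicat_real (cball 0 (norm x + r + 1)) y *\<^sub>R f y))" for x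
    using L1_loc_integrable_cball[OF f] by simp
  have A0: "A x \<ge> 0" for x unfolding A_def by (rule integral_nonneg_AE) auto
  have far: "norm (x - y) > r + 1" if "y \<notin> cball 0 (norm x + r + 1)" for x y :: 'a
    using norm_diff_gt[of x "r + 1" y] that by auto
  have far2: "norm (x - y + v) > r" if "y \<notin> cball 0 (norm x + r + 1)" "norm v < 1" for x y v :: 'a
    using far[OF that(1)] norm_triangle_ineq2[of "x - y" "- v"] that(2) by simp
  have est: "\<exists>d>0. \<forall>v. norm v < d \<longrightarrow> norm ((LINT y|lebesgue. f y *\<^sub>R K (x + v - y)) - (LINT y|lebesgue. f y *\<^sub>R K (x - y))) \<le> e * A x"
    "\<exists>d>0. \<forall>v. norm v < d \<longrightarrow> norm (mollify k f (x + v) - mollify k f x - (LINT y|lebesgue. f y *\<^sub>R K (x - y)) \<bullet> v) \<le> e * A x * norm v"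
    if e: "e > 0" for e x
  proof -
    obtain d where d: "d > 0" "\<And>x y. dist y x < d \<Longrightarrow> dist (K y) (K x) < e"
      using uc e by blast
    have Kd: "norm (K (x + v - y) - K (x - y)) \<le> e" if "norm v < min d 1" for v y
      using d(2)[of "x + v - y" "x - y"] that by (auto simp: dist_norm less_imp_le)
    have "norm ((LINT y|lebesgue. f y *\<^sub>R K (x + v - y)) - (LINT y|lebesgue. f y *\<^sub>R K (x - y))) \<le> e * A x"
      if v: "norm v < min d 1" for v
    proof -
      have "(LINT y|lebesgue. f y *\<^sub>R K (x + v - y)) - (LINT y|lebesgue. f y *\<^sub>R K (x - y))
        = (LINT y|lebesgue. f y *\<^sub>R K (x + v - y) - f y *\<^sub>R K (x - y))"
        by (rule Bochner_Integration.integral_diff[symmetric]; rule mollify_grad_integrable[OF f c(2) Kz])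
      also have "norm \<dots> \<le> (LINT y|lebesgue. e * norm (indicat_real (cball 0 (norm x + r + 1)) y *\<^sub>R f y))"
      proof (rule Bochner_Integration.integral_norm_bound_integral)
        show "integrable lebesgue (\<lambda>y. f y *\<^sub>R K (x + v - y) - f y *\<^sub>R K (x - y))"
          by (rule Bochner_Integration.integrable_diff; rule mollify_grad_integrable[OF f c(2) Kz])
        show "norm (f y *\<^sub>R K (x + v - y) - f y *\<^sub>R K (x - y)) \<le> e * norm (indicat_real (cball 0 (norm x + r + 1)) y *\<^sub>R f y)" for y
        proof (cases "y \<in> cball 0 (norm x + r + 1)")
          case True
          have "norm (f y *\<^sub>R K (x + v - y) - f y *\<^sub>R K (x - y)) = norm (f y) * norm (K (x + v - y) - K (x - y))"
            by (simp flip: scaleR_diff_right)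
          also have "\<dots> \<le> norm (f y) * e" using Kd[OF v] by (intro mult_left_mono) auto
          finally show ?thesis using True by (simp add: mult.commute)
        next
          case False
          then show ?thesis using far[OF False] far2[OF False, of v] Kz v
            by (simp add: algebra_simps)
        qed
      qed (intro integrable_mult_right A)
      also have "\<dots> = e * A x" by (simp add: A_def)
      finally show ?thesis .
    qed
    then show "\<exists>d>0. \<forall>v. norm v < d \<longrightarrow> norm ((LINT y|lebesgue. f y *\<^sub>R K (x + v - y)) - (LINT y|lebesgue. f y *\<^sub>R K (x - y))) \<le> e * A x"
      using d by (intro exI[of _ "min d 1"]) auto
    have "norm (mollify k f (x + v) - mollify k f x - (LINT y|lebesgue. f y *\<^sub>R K (x - y)) \<bullet> v) \<le> e * A x * norm v"
      if v: "norm v < min d 1" for v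
    proof -
      have i1: "integrable lebesgue (\<lambda>y. k (x - y) *\<^sub>R f y)" for x
        by (rule mollify_integrable[OF f c(1), of r]) (use z in auto)
      have i2: "integrable lebesgue (\<lambda>y. f y *\<^sub>R K (x - y))"
        by (rule mollify_grad_integrable[OF f c(2) Kz])
      have "mollify k f (x + v) - mollify k f x - (LINT y|lebesgue. f y *\<^sub>R K (x - y)) \<bullet> v
        = (LINT y|lebesgue. (k (x + v - y) *\<^sub>R f y - k (x - y) *\<^sub>R f y) - (f y *\<^sub>R K (x - y)) \<bullet> v)"
        unfolding mollify_def integral_inner_left[OF i2, symmetric]
          Bochner_Integration.integral_diff[OF i1[of "x + v"] i1[of x], symmetric]
        by (rule Bochner_Integration.integral_diff[symmetric])
           (intro Bochner_Integration.integrable_diff i1, intro integrable_inner_left i2)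
      also have "norm \<dots> \<le> (LINT y|lebesgue. e * norm v * norm (indicat_real (cball 0 (norm x + r + 1)) y *\<^sub>R f y))"
      proof (rule Bochner_Integration.integral_norm_bound_integral)
        show "integrable lebesgue (\<lambda>y. (k (x + v - y) *\<^sub>R f y - k (x - y) *\<^sub>R f y) - (f y *\<^sub>R K (x - y)) \<bullet> v)"
          using i1 i2 by (intro Bochner_Integration.integrable_diff integrable_inner_left) auto
        show "norm ((k (x + v - y) *\<^sub>R f y - k (x - y) *\<^sub>R f y) - (f y *\<^sub>R K (x - y)) \<bullet> v) \<le> e * norm v * norm (indicat_real (cball 0 (norm x + r + 1)) y *\<^sub>R f y)" for y
        proof (cases "y \<in> cball 0 (norm x + r + 1)")
          case True
          obtain u where u: "u \<in> {0..1}" "k (x - y + v) - k (x - y) = K (x - y + u *\<^sub>R v) \<bullet> v"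
            using C1_gradient_mvt[OF k] by blast
          have "norm (u *\<^sub>R v) \<le> norm v" using u by (simp add: mult_left_le_one_le)
          then have uv: "norm (u *\<^sub>R v) < min d 1" using v by linarith
          have "(k (x + v - y) *\<^sub>R f y - k (x - y) *\<^sub>R f y) - (f y *\<^sub>R K (x - y)) \<bullet> v
            = f y * ((K (x + u *\<^sub>R v - y) - K (x - y)) \<bullet> v)"
          proof -
            have e: "x + v - y = x - y + v" "x + u *\<^sub>R v - y = x - y + u *\<^sub>R v" by auto
            have "(k (x + v - y) *\<^sub>R f y - k (x - y) *\<^sub>R f y) = f y * (K (x - y + u *\<^sub>R v) \<bullet> v)"
              unfolding e u(2)[symmetric] by (simp add: left_diff_distrib mult.commute[of "f y"])
            then show ?thesis
              unfolding e by (simp add: inner_diff_left right_diff_distrib)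
          qed
          also have "norm \<dots> \<le> norm (f y) * (e * norm v)"
            unfolding norm_mult
            by (intro mult_left_mono order_trans[OF Cauchy_Schwarz_ineq2[folded real_norm_def]] mult_right_mono Kd[OF uv]) auto
          finally show ?thesis using True by (simp add: mult_ac)
        next
          case False
          have e: "x + v - y = x - y + v" by simp
          from False show ?thesis
            using far[OF False] far2[OF False, of v] Kz[of "x - y"] Kz[of "x - y + v"] z[of "x - y"] z[of "x - y + v"] v
            unfolding e by simp
        qed
      qed (intro integrable_mult_right A)
      also have "\<dots> = e * A x * norm v" by (simp add: A_def mult_ac)
      finally show ?thesis .
    qed
    then show "\<exists>d>0. \<forall>v. norm v < d \<longrightarrow> norm (mollify k f (x + v) - mollify k f x - (LINT y|lebesgue. f y *\<^sub>R K (x - y)) \<bullet> v) \<le> e * A x * norm v"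
      using d by (intro exI[of _ "min d 1"]) auto
  qed
  \<comment> \<open>The summand 1 guards against \<open>A x = 0\<close>.\<close>
  have sm: "e / (A x + 1) * A x \<le> e" if "e > 0" for e x
    using that A0[of x] by (simp add: field_simps)
  show ?thesis
    unfolding C1_gradient_def
  proof (intro conjI allI)
    fix x
    show "(mollify k f has_derivative (\<lambda>h. (LINT y|lebesgue. f y *\<^sub>R K (x - y)) \<bullet> h)) (at x)"
      unfolding has_derivative_at_alt
    proof (intro conjI allI impI)
      show "bounded_linear (\<lambda>h. (LINT y|lebesgue. f y *\<^sub>R K (x - y)) \<bullet> h)" by (rule bounded_linear_inner_right)
      fix e :: real assume e: "e > 0"
      then have "e / (A x + 1) > 0" using A0[of x] by auto
      from est(2)[OF this, of x] obtain d where d: "d > 0" "\<And>v. norm v < d \<Longrightarrow>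
        norm (mollify k f (x + v) - mollify k f x - (LINT y|lebesgue. f y *\<^sub>R K (x - y)) \<bullet> v) \<le> e / (A x + 1) * A x * norm v"
        by blast
      show "\<exists>d>0. \<forall>y. norm (y - x) < d \<longrightarrow> norm (mollify k f y - mollify k f x - (LINT y|lebesgue. f y *\<^sub>R K (x - y)) \<bullet> (y - x)) \<le> e * norm (y - x)"
      proof (intro exI conjI allI impI)
        fix y assume "norm (y - x) < d"
        from d(2)[OF this] have "norm (mollify k f y - mollify k f x - (LINT y|lebesgue. f y *\<^sub>R K (x - y)) \<bullet> (y - x)) \<le> e / (A x + 1) * A x * norm (y - x)"
          by simp
        also have "\<dots> \<le> e * norm (y - x)" by (intro mult_right_mono sm e) auto
        finally show "norm (mollify k f y - mollify k f x - (LINT y|lebesgue. f y *\<^sub>R K (x - y)) \<bullet> (y - x)) \<le> e * norm (y - x)" .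
      qed (rule d)
    qed
  next
    show "continuous_on UNIV (\<lambda>x. LINT y|lebesgue. f y *\<^sub>R K (x - y))"
      unfolding continuous_on_iff
    proof (intro ballI allI impI)
      fix x and e :: real assume e: "e > 0"
      then have "e / 2 / (A x + 1) > 0" using A0[of x] by auto
      from est(1)[OF this, of x] obtain d where d: "d > 0" "\<And>v. norm v < d \<Longrightarrow>
        norm ((LINT y|lebesgue. f y *\<^sub>R K (x + v - y)) - (LINT y|lebesgue. f y *\<^sub>R K (x - y))) \<le> e / 2 / (A x + 1) * A x"
        by blast
      show "\<exists>d>0. \<forall>x'\<in>UNIV. dist x' x < d \<longrightarrow> dist (LINT y|lebesgue. f y *\<^sub>R K (x' - y)) (LINT y|lebesgue. f y *\<^sub>R K (x - y)) < e"
      proof (intro exI conjI ballI impI)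
        fix x' assume "dist x' x < d"
        then have "norm (x' - x) < d" by (simp add: dist_norm)
        note d(2)[OF this]
        also have "e / 2 / (A x + 1) * A x \<le> e / 2" by (rule sm) (use e in simp)
        also have "e / 2 < e" using e by simp
        finally show "dist (LINT y|lebesgue. f y *\<^sub>R K (x' - y)) (LINT y|lebesgue. f y *\<^sub>R K (x - y)) < e"
          unfolding dist_norm by simp
      qed (rule d)
    qed
  qed
qed

lemma integrable_mult_compact_support:
  fixes f :: "'a::euclidean_space \<Rightarrow> real" and K :: "'a \<Rightarrow> 'b::euclidean_space"
  assumes "L1_loc f" "continuous_on UNIV K" "\<And>x. norm x > R \<Longrightarrow> K x = 0"
  shows "integrable lebesgue (\<lambda>y. f y *\<^sub>R K y)"
proof -
  have "integrable lebesgue (\<lambda>y. f y *\<^sub>R (\<lambda>z. K (- z)) (0 - y))"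
    by (rule mollify_grad_integrable[OF assms(1), of _ R])
       (use assms(3) in \<open>auto intro!: continuous_intros continuous_on_compose2[OF assms(2)]\<close>)
  then show ?thesis by simp
qed

section \<open>Test functions, mollifiers and mollified weak derivatives\<close>

lemma test_function_C1:
  assumes "test_function \<eta>"
  shows "C1_gradient \<eta> (\<lambda>x. \<Sum>b\<in>Basis. partial_deriv b \<eta> x *\<^sub>R b)"
proof -
  have C: "C_diff (Suc 0) \<eta>" using assms unfolding test_function_def by blast
  then have d: "(\<eta> has_derivative frechet_derivative \<eta> (at x)) (at x)" for x
    by (simp flip: frechet_derivative_works)
  have eq: "frechet_derivative \<eta> (at x) = (\<lambda>h. (\<Sum>b\<in>Basis. partial_deriv b \<eta> x *\<^sub>R b) \<bullet> h)" for x
  proof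
    fix h
    interpret linear "frechet_derivative \<eta> (at x)" using d has_derivative_linear by blast
    have "frechet_derivative \<eta> (at x) h = frechet_derivative \<eta> (at x) (\<Sum>b\<in>Basis. (h \<bullet> b) *\<^sub>R b)"
      by (simp add: euclidean_representation)
    also have "\<dots> = (\<Sum>b\<in>Basis. partial_deriv b \<eta> x *\<^sub>R b) \<bullet> h"
      by (simp add: sum scale partial_deriv_def inner_sum_left mult.commute inner_commute[of h])
    finally show "frechet_derivative \<eta> (at x) h = (\<Sum>b\<in>Basis. partial_deriv b \<eta> x *\<^sub>R b) \<bullet> h" .
  qed
  show ?thesis
    unfolding C1_gradient_def
  proof (intro conjI allI)
    show "(\<eta> has_derivative (\<lambda>h. (\<Sum>b\<in>Basis. partial_deriv b \<eta> x *\<^sub>R b) \<bullet> h)) (at x)" for x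
      using d[of x] unfolding eq .
    show "continuous_on UNIV (\<lambda>x. \<Sum>b\<in>Basis. partial_deriv b \<eta> x *\<^sub>R b)"
      using C by (intro continuous_intros) auto
  qed
qed

lemma C1_gradient_partial_deriv:
  assumes "C1_gradient f F" shows "partial_deriv b f x = F x \<bullet> b"
proof -
  have "(f has_derivative (\<lambda>h. F x \<bullet> h)) (at x)" using assms by (simp add: C1_gradient_def)
  from frechet_derivative_at[OF this] show ?thesis unfolding partial_deriv_def by metis
qed

lemma test_function_support:
  assumes "test_function \<eta>"
  shows "\<exists>R>0. \<forall>x. norm x \<ge> R \<longrightarrow> \<eta> x = 0"
proof -
  have "bounded {x. \<eta> x \<noteq> 0}"
    using assms unfolding test_function_def
    by (meson bounded_subset closure_subset compact_imp_bounded)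
  then obtain B where "B > 0" "\<And>x. \<eta> x \<noteq> 0 \<Longrightarrow> norm x \<le> B"
    unfolding bounded_pos by auto
  then show ?thesis by (intro exI[of _ "B + 1"]) force
qed

lemma test_function_partial_deriv:
  assumes "test_function \<eta>" "b \<in> Basis"
  shows "test_function (partial_deriv b \<eta>)"
  unfolding test_function_def
proof
  show "\<forall>k. C_diff k (partial_deriv b \<eta>)"
  proof
    fix k
    have "C_diff (Suc k) \<eta>" using assms unfolding test_function_def by blast
    then show "C_diff k (partial_deriv b \<eta>)" using assms(2) by simp
  qed
  have "{x. partial_deriv b \<eta> x \<noteq> 0} \<subseteq> closure {x. \<eta> x \<noteq> 0}"
  proof
    fix x assume x: "x \<in> {x. partial_deriv b \<eta> x \<noteq> 0}"
    show "x \<in> closure {x. \<eta> x \<noteq> 0}"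
    proof (rule ccontr)
      assume "x \<notin> closure {x. \<eta> x \<noteq> 0}"
      then have "(\<Sum>b\<in>Basis. partial_deriv b \<eta> x *\<^sub>R b) = 0"
        by (intro C1_gradient_zero[OF test_function_C1[OF assms(1)], of "- closure {x. \<eta> x \<noteq> 0}" 0])
           (use closure_subset[of "{x. \<eta> x \<noteq> 0}"] in auto)
      then have "(\<Sum>b\<in>Basis. partial_deriv b \<eta> x *\<^sub>R b) \<bullet> b = 0" by simp
      with C1_gradient_partial_deriv[OF test_function_C1[OF assms(1)], of b x] x show False by simp
    qed
  qed
  then show "compact (closure {x. partial_deriv b \<eta> x \<noteq> 0})"
    using assms(1) unfolding test_function_def
    by (meson bounded_subset compact_closure compact_imp_bounded)
qed

lemma partial_deriv_reflect:
  assumes "C1_gradient \<rho> K"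
  shows "partial_deriv b (\<lambda>y. \<rho> (x - y)) y = - (K (x - y) \<bullet> b)"
proof -
  have "(\<rho> has_derivative (\<lambda>h. K (x - y) \<bullet> h)) (at (x - y))"
    using assms by (simp add: C1_gradient_def)
  then have "((\<lambda>y. \<rho> (x - y)) has_derivative (\<lambda>h. K (x - y) \<bullet> (- h))) (at y)"
    by (rule has_derivative_compose[rotated]) (auto intro!: derivative_eq_intros)
  from frechet_derivative_at[OF this] show ?thesis unfolding partial_deriv_def by (metis inner_minus_right inner_minus_left)
qed

text \<open>The number \<open>r\<close> only bounds the support: kernels for different
  \<open>r\<close> need not be rescalings of one another.\<close>

definition mollifier :: "real \<Rightarrow> ('a::euclidean_space \<Rightarrow> real) \<Rightarrow> ('a \<Rightarrow> 'a) \<Rightarrow> bool" where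
  "mollifier r \<rho> K \<longleftrightarrow> (\<forall>x. test_function (\<lambda>y. \<rho> (x - y))) \<and> C1_gradient \<rho> K \<and> (\<forall>z. \<rho> z \<ge> 0) \<and>
    (\<forall>z. norm z \<ge> r \<longrightarrow> \<rho> z = 0) \<and> integrable lborel \<rho> \<and> integral\<^sup>L lborel \<rho> = 1"

lemma mollifier_exists:
  assumes "r > 0" shows "\<exists>(\<rho>::'a::euclidean_space \<Rightarrow> real) K. mollifier r \<rho> K"
proof -
  obtain \<rho> :: "'a \<Rightarrow> real" where "\<And>x. test_function (\<lambda>y. \<rho> (x - y))" "test_function \<rho>" "\<And>z. \<rho> z \<ge> 0"
    "\<And>z. norm z \<ge> r \<Longrightarrow> \<rho> z = 0" "integrable lborel \<rho>" "integral\<^sup>L lborel \<rho> = 1"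
    using kernel_exists[OF assms] by blast
  then show ?thesis unfolding mollifier_def using test_function_C1[of \<rho>] by blast
qed

lemma mollifierD:
  assumes "mollifier r \<rho> K"
  shows "test_function (\<lambda>y. \<rho> (x - y))" "C1_gradient \<rho> K" "\<rho> z \<ge> 0"
    "norm z \<ge> r \<Longrightarrow> \<rho> z = 0" "integrable lborel \<rho>" "integral\<^sup>L lborel \<rho> = 1"
    "continuous_on UNIV \<rho>" "continuous_on UNIV K" "norm z > r \<Longrightarrow> K z = 0"
proof -
  show C: "C1_gradient \<rho> K" using assms by (simp add: mollifier_def)
  show "continuous_on UNIV \<rho>" "continuous_on UNIV K" using C1_gradient_continuous[OF C] by auto
  show "norm z > r \<Longrightarrow> K z = 0"
    by (rule C1_gradient_zero[OF C, of "{x. norm x > r}" 0])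
       (use assms in \<open>auto simp: mollifier_def intro!: open_Collect_less continuous_intros\<close>)
qed (use assms in \<open>auto simp: mollifier_def\<close>)

lemma mollify_integrable':
  assumes "mollifier r \<rho> K" "L1_loc f"
  shows "integrable lebesgue (\<lambda>y. \<rho> (x - y) *\<^sub>R f y)"
  by (rule mollify_integrable[OF assms(2) mollifierD(7)[OF assms(1)], of r])
     (use mollifierD(4)[OF assms(1)] in auto)

lemma mollify_inner:
  assumes "mollifier r \<rho> K" "L1_loc f"
  shows "mollify \<rho> f x \<bullet> b = mollify \<rho> (\<lambda>y. f y \<bullet> b) x"
  unfolding mollify_def
  by (subst integral_inner_left[OF mollify_integrable'[OF assms], symmetric]) simp

text \<open>The reflected kernel is a test function of \<open>y\<close>; the sign from the
  reflection cancels the sign in the weak identity.\<close>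

lemma mollify_weak_gradient:
  assumes m: "mollifier r \<rho> K" and w: "has_weak_gradient f F"
  shows "(LINT y|lebesgue. f y *\<^sub>R K (x - y)) = mollify \<rho> F x"
proof (rule euclidean_eqI)
  fix b :: 'a assume b: "b \<in> Basis"
  have L: "L1_loc f" "L1_loc F" using w unfolding has_weak_gradient_def by auto
  have "(LINT y|lebesgue. f y * partial_deriv b (\<lambda>y. \<rho> (x - y)) y) = - (LINT y|lebesgue. (F y \<bullet> b) * \<rho> (x - y))"
    using w b mollifierD(1)[OF m, of x] unfolding has_weak_gradient_def by blast
  then have *: "(LINT y|lebesgue. f y * (K (x - y) \<bullet> b)) = (LINT y|lebesgue. (F y \<bullet> b) * \<rho> (x - y))"
    by (simp add: partial_deriv_reflect[OF mollifierD(2)[OF m]])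
  have "(LINT y|lebesgue. f y *\<^sub>R K (x - y)) \<bullet> b = (LINT y|lebesgue. f y * (K (x - y) \<bullet> b))"
    by (subst integral_inner_left[symmetric])
       (use mollify_grad_integrable[OF L(1) mollifierD(8)[OF m] mollifierD(9)[OF m]] in auto)
  also have "\<dots> = mollify \<rho> F x \<bullet> b"
    unfolding * mollify_inner[OF m L(2)] by (simp add: mollify_def mult.commute)
  finally show "(LINT y|lebesgue. f y *\<^sub>R K (x - y)) \<bullet> b = mollify \<rho> F x \<bullet> b" .
qed

lemma mollify_has_gradient:
  assumes "mollifier r \<rho> K" "has_weak_gradient f F"
  shows "C1_gradient (mollify \<rho> f) (mollify \<rho> F)"
  using mollify_C1[OF _ mollifierD(2)[OF assms(1)], of f r] mollifierD(4)[OF assms(1)]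
    mollify_weak_gradient[OF assms] assms(2)
  by (auto simp: has_weak_gradient_def)

lemma mollify_continuous:
  assumes m: "mollifier r \<rho> K" and f: "L1_loc f"
  shows "continuous_on UNIV (mollify \<rho> f)"
proof -
  have "continuous_on UNIV (\<lambda>x. mollify \<rho> f x \<bullet> b)" if "b \<in> Basis" for b
  proof -
    have "L1_loc (\<lambda>y. f y \<bullet> b)"
      by (rule L1_loc_bound[OF f, where B = "norm b"])
         (use L1_loc_measurable[OF f] in \<open>auto simp: mult.commute[of "norm b"] Cauchy_Schwarz_ineq2\<close>)
    from C1_gradient_continuous(1)[OF mollify_C1[OF this mollifierD(2)[OF m] mollifierD(4)[OF m]]]
    show ?thesis unfolding mollify_inner[OF m f] .
  qed
  then show ?thesis using continuous_on_componentwise[of UNIV "mollify \<rho> f"] by auto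
qed

text \<open>In classical terms, the divergence of the mollified gradient is the mollified Laplacian.
  The weak gradient identity is applied with the test function \<open>partial_deriv b\<close> of the
  kernel, which moves the remaining derivative onto the kernel; only the sum over \<open>b\<close>
  can be compared with \<open>h\<close>.\<close>

lemma mollify_weak_laplacian:
  assumes m: "mollifier r \<rho> K" and g: "has_weak_gradient \<mu> W" and l: "has_weak_laplacian \<mu> h"
  shows "\<exists>D. (\<forall>b. C1_gradient (\<lambda>x. mollify \<rho> W x \<bullet> b) (D b)) \<and>
     (\<forall>x. (\<Sum>b\<in>Basis. D b x \<bullet> b) = mollify \<rho> h x)"
proof (intro exI conjI allI)
  have L: "L1_loc W" "L1_loc h" using g l unfolding has_weak_gradient_def has_weak_laplacian_def by auto
  have Lb: "L1_loc (\<lambda>y. W y \<bullet> b)" for b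
    by (rule L1_loc_bound[OF L(1), where B = "norm b"])
       (use L1_loc_measurable[OF L(1)] in \<open>auto simp: mult.commute[of "norm b"] Cauchy_Schwarz_ineq2\<close>)
  show "C1_gradient (\<lambda>x. mollify \<rho> W x \<bullet> b) (\<lambda>x. LINT y|lebesgue. (W y \<bullet> b) *\<^sub>R K (x - y))" for b
    unfolding mollify_inner[OF m L(1)]
    using mollify_C1[OF Lb mollifierD(2)[OF m] mollifierD(4)[OF m]] by simp
  fix x
  let ?\<eta> = "\<lambda>y. \<rho> (x - y)"
  have t: "test_function ?\<eta>" by (rule mollifierD(1)[OF m])
  have pd: "partial_deriv b ?\<eta> = (\<lambda>y. - (K (x - y) \<bullet> b))" for b
    by (rule ext, rule partial_deriv_reflect[OF mollifierD(2)[OF m]])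
  have int: "integrable lebesgue (\<lambda>y. \<mu> y * partial_deriv b (partial_deriv b ?\<eta>) y)" if b: "b \<in> Basis" for b
  proof -
    have t2: "test_function (partial_deriv b (partial_deriv b ?\<eta>))"
      using t b by (intro test_function_partial_deriv)
    obtain R where R: "\<And>x. norm x \<ge> R \<Longrightarrow> partial_deriv b (partial_deriv b ?\<eta>) x = 0"
      using test_function_support[OF t2] by blast
    show ?thesis
      using integrable_mult_compact_support[of \<mu> "partial_deriv b (partial_deriv b ?\<eta>)" R] g R
        C1_gradient_continuous(1)[OF test_function_C1[OF t2]]
      by (simp add: has_weak_gradient_def)
  qed
  have "(\<Sum>b\<in>Basis. (LINT y|lebesgue. (W y \<bullet> b) *\<^sub>R K (x - y)) \<bullet> b)
      = (\<Sum>b\<in>Basis. LINT y|lebesgue. (W y \<bullet> b) * (K (x - y) \<bullet> b))"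
    by (intro sum.cong refl, subst integral_inner_left[symmetric])
       (use mollify_grad_integrable[OF Lb mollifierD(8)[OF m] mollifierD(9)[OF m]] in auto)
  also have "\<dots> = (\<Sum>b\<in>Basis. LINT y|lebesgue. \<mu> y * partial_deriv b (partial_deriv b ?\<eta>) y)"
  proof (intro sum.cong refl)
    fix b :: 'a assume b: "b \<in> Basis"
    have "(LINT y|lebesgue. \<mu> y * partial_deriv b (partial_deriv b ?\<eta>) y)
       = - (LINT y|lebesgue. (W y \<bullet> b) * partial_deriv b ?\<eta> y)"
      using g b test_function_partial_deriv[OF t b] unfolding has_weak_gradient_def by blast
    then show "(LINT y|lebesgue. (W y \<bullet> b) * (K (x - y) \<bullet> b)) = (LINT y|lebesgue. \<mu> y * partial_deriv b (partial_deriv b ?\<eta>) y)"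
      by (simp add: pd)
  qed
  also have "\<dots> = (LINT y|lebesgue. \<mu> y * laplacian ?\<eta> y)"
    unfolding laplacian_def sum_distrib_left
    by (rule Bochner_Integration.integral_sum[symmetric]) (rule int)
  also have "\<dots> = (LINT y|lebesgue. h y * ?\<eta> y)"
    using l t unfolding has_weak_laplacian_def by blast
  also have "\<dots> = mollify \<rho> h x" by (simp add: mollify_def mult.commute)
  finally show "(\<Sum>b\<in>Basis. (LINT y|lebesgue. (W y \<bullet> b) *\<^sub>R K (x - y)) \<bullet> b) = mollify \<rho> h x" .
qed

section \<open>Convergence of mollifications in the mean\<close>

lemma nn_integral_reflect:
  fixes f :: "'a::euclidean_space \<Rightarrow> ennreal"
  assumes [measurable]: "f \<in> borel_measurable borel"
  shows "(\<integral>\<^sup>+y. f (x - y) \<partial>lborel) = (\<integral>\<^sup>+y. f y \<partial>lborel)"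
proof -
  have "(\<integral>\<^sup>+y. f y \<partial>lborel) = (\<integral>\<^sup>+y. f y \<partial>(density (distr lborel borel (\<lambda>y. x + (-1) *\<^sub>R y)) (\<lambda>_. \<bar>- 1 :: real\<bar> ^ DIM('a))))"
    by (subst lborel_affine[of "-1" x, symmetric]) auto
  also have "\<dots> = (\<integral>\<^sup>+y. f (x - y) \<partial>lborel)"
    by (subst nn_integral_density, simp, simp, subst nn_integral_distr) auto
  finally show ?thesis by simp
qed

lemma nn_integral_shift:
  fixes f :: "'a::euclidean_space \<Rightarrow> ennreal"
  assumes [measurable]: "f \<in> borel_measurable borel"
  shows "(\<integral>\<^sup>+y. f (y - x) \<partial>lborel) = (\<integral>\<^sup>+y. f y \<partial>lborel)"
  using nn_integral_reflect[of "\<lambda>y. f (- y)" x] nn_integral_reflect[of f 0] by simp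

lemma mollifier_nn_integral:
  fixes \<rho> :: "'a::euclidean_space \<Rightarrow> real"
  assumes m: "mollifier r \<rho> K"
  shows "(\<integral>\<^sup>+y. ennreal (\<rho> (y - x)) \<partial>lborel) = 1" "(\<integral>\<^sup>+y. ennreal (\<rho> (x - y)) \<partial>lborel) = 1"
    "integrable lebesgue (\<lambda>y. \<rho> (x - y))" "(LINT y|lebesgue. \<rho> (x - y)) = 1"
proof -
  have b[measurable]: "\<rho> \<in> borel_measurable borel"
    using mollifierD(7)[OF m] by (rule borel_measurable_continuous_onI)
  have 1: "(\<integral>\<^sup>+y. ennreal (\<rho> y) \<partial>lborel) = 1"
    using nn_integral_eq_integral[OF mollifierD(5)[OF m]] mollifierD(3,6)[OF m] by simp
  show "(\<integral>\<^sup>+y. ennreal (\<rho> (y - x)) \<partial>lborel) = 1"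
    using nn_integral_shift[of "\<lambda>y. ennreal (\<rho> y)" x] 1 by simp
  show 2: "(\<integral>\<^sup>+y. ennreal (\<rho> (x - y)) \<partial>lborel) = 1"
    using nn_integral_reflect[of "\<lambda>y. ennreal (\<rho> y)" x] 1 by simp
  have i: "has_bochner_integral lborel (\<lambda>y. \<rho> (x - y)) 1"
    by (rule has_bochner_integral_nn_integral) (use 2 mollifierD(3)[OF m] in auto)
  have "(\<lambda>y. \<rho> (x - y)) \<in> borel_measurable lborel" by simp
  from integrable_completion[OF this] integral_completion[OF this] i
  show "integrable lebesgue (\<lambda>y. \<rho> (x - y))" "(LINT y|lebesgue. \<rho> (x - y)) = 1"
    by (auto simp: has_bochner_integral_iff)
qed

text \<open>The L1 case of Young's inequality, localised: seen from the ball of radius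
  \<open>R\<close>, a kernel of radius \<open>r\<close> reaches no further than
  \<open>R + r\<close>.\<close>

lemma mollify_contraction:
  fixes g :: "'a::euclidean_space \<Rightarrow> 'b::euclidean_space"
  assumes m: "mollifier r \<rho> K" and g: "L1_loc g"
  shows "(\<integral>\<^sup>+x. ennreal (norm (mollify \<rho> g x)) * indicator (cball 0 R) x \<partial>lebesgue)
     \<le> (\<integral>\<^sup>+y. ennreal (norm (g y)) * indicator (cball 0 (R + r)) y \<partial>lebesgue)"
proof -
  have b[measurable]: "\<rho> \<in> borel_measurable borel"
    using mollifierD(7)[OF m] by (rule borel_measurable_continuous_onI)
  have [measurable]: "cball (0::'a) c \<in> sets borel" for c by simp
  have "(\<lambda>y. ennreal (norm (g y))) \<in> borel_measurable lebesgue"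
    using L1_loc_measurable[OF g] by measurable
  \<comment> \<open>The exchange of integrals is carried out over \<open>lborel\<close>, so the
    Lebesgue measurable norm of \<open>g\<close> is replaced by a Borel representative.\<close>
  from completion_ex_borel_measurable[OF this] obtain \<gamma>
    where \<gamma>[measurable]: "\<gamma> \<in> borel_measurable lborel" and eq: "AE y in lborel. ennreal (norm (g y)) = \<gamma> y"
    by blast
  have 1: "ennreal (norm (mollify \<rho> g x)) \<le> (\<integral>\<^sup>+y. ennreal (\<rho> (x - y)) * \<gamma> y \<partial>lborel)" for x
  proof -
    have "ennreal (norm (mollify \<rho> g x)) \<le> (\<integral>\<^sup>+y. ennreal (norm (\<rho> (x - y) *\<^sub>R g y)) \<partial>lebesgue)"
      unfolding mollify_def by (rule integral_norm_bound_ennreal[OF mollify_integrable'[OF m g]])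
    also have "\<dots> = (\<integral>\<^sup>+y. ennreal (\<rho> (x - y)) * \<gamma> y \<partial>lborel)"
      unfolding nn_integral_completion
      by (rule nn_integral_cong_AE, rule AE_mp[OF eq], rule AE_I2)
         (use mollifierD(3)[OF m] in \<open>auto simp: ennreal_mult abs_of_nonneg\<close>)
    finally show ?thesis .
  qed
  have "(\<integral>\<^sup>+x. ennreal (norm (mollify \<rho> g x)) * indicator (cball 0 R) x \<partial>lebesgue)
    \<le> (\<integral>\<^sup>+x. (\<integral>\<^sup>+y. ennreal (\<rho> (x - y)) * \<gamma> y \<partial>lborel) * indicator (cball 0 R) x \<partial>lborel)"
    unfolding nn_integral_completion by (intro nn_integral_mono mult_right_mono 1) auto
  also have "\<dots> = (\<integral>\<^sup>+x. (\<integral>\<^sup>+y. ennreal (\<rho> (x - y)) * \<gamma> y * indicator (cball 0 R) x \<partial>lborel) \<partial>lborel)"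
    by (intro nn_integral_cong nn_integral_multc[symmetric]) measurable
  also have "\<dots> = (\<integral>\<^sup>+y. (\<integral>\<^sup>+x. ennreal (\<rho> (x - y)) * \<gamma> y * indicator (cball 0 R) x \<partial>lborel) \<partial>lborel)"
    by (rule lborel_pair.Fubini'[symmetric]) measurable
  also have "\<dots> \<le> (\<integral>\<^sup>+y. (\<integral>\<^sup>+x. ennreal (\<rho> (x - y)) * (\<gamma> y * indicator (cball 0 (R + r)) y) \<partial>lborel) \<partial>lborel)"
  proof (intro nn_integral_mono)
    fix x y :: 'a
    have "\<rho> (x - y) = 0" if "norm x \<le> R" "norm y > R + r"
      using mollifierD(4)[OF m, of "x - y"] norm_triangle_ineq2[of y x] that by (simp add: norm_minus_commute)
    then show "ennreal (\<rho> (x - y)) * \<gamma> y * indicator (cball 0 R) x \<le> ennreal (\<rho> (x - y)) * (\<gamma> y * indicator (cball 0 (R + r)) y)"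
      by (auto simp: indicator_def not_le)
  qed
  also have "\<dots> = (\<integral>\<^sup>+y. \<gamma> y * indicator (cball 0 (R + r)) y \<partial>lborel)"
    by (subst nn_integral_multc) (auto simp: mollifier_nn_integral[OF m])
  also have "\<dots> = (\<integral>\<^sup>+y. ennreal (norm (g y)) * indicator (cball 0 (R + r)) y \<partial>lebesgue)"
    unfolding nn_integral_completion
    by (rule nn_integral_cong_AE, rule AE_mp[OF eq], rule AE_I2) auto
  finally show ?thesis .
qed

lemma L1_loc_continuous:
  fixes g :: "'a::euclidean_space \<Rightarrow> 'b::euclidean_space"
  assumes "continuous_on UNIV g"
  shows "L1_loc g"
proof (rule L1_locI)
  have b: "g \<in> borel_measurable borel" using assms by (rule borel_measurable_continuous_onI)
  then show m: "g \<in> borel_measurable lebesgue" by (simp add: measurable_completion)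
  fix R
  have "bounded (g ` cball 0 R)"
    by (intro compact_imp_bounded compact_continuous_image continuous_on_subset[OF assms]) auto
  then obtain B where B: "B > 0" "\<And>x. norm x \<le> R \<Longrightarrow> norm (g x) \<le> B"
    unfolding bounded_pos by auto
  show "integrable lebesgue (\<lambda>x. indicat_real (cball 0 R) x *\<^sub>R g x)"
  proof (rule integrable_L1_loc_bound[OF L1_loc_const[of B], where B = 1 and R = R])
    show "(\<lambda>x. indicat_real (cball 0 R) x *\<^sub>R g x) \<in> borel_measurable lebesgue"
      using m by (intro borel_measurable_scaleR borel_measurable_indicator) auto
    show "norm (indicat_real (cball 0 R) x *\<^sub>R g x) \<le> 1 * norm B" for x
      using B by (cases "norm x \<le> R") auto
  qed auto
qed

text \<open>The retraction onto the closed ball of radius \<open>M\<close>. Applied to approximants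
  it supplies a constant majorant on bounded sets.\<close>

definition radial_clamp :: "real \<Rightarrow> 'b::real_normed_vector \<Rightarrow> 'b" where
  "radial_clamp M v = (M / max M (norm v)) *\<^sub>R v"

lemma radial_clamp_props:
  fixes v :: "'b::real_normed_vector"
  assumes "M > 0"
  shows "norm (radial_clamp M v) \<le> M" "norm (radial_clamp M v - v) \<le> norm v" "norm v \<le> M \<Longrightarrow> radial_clamp M v = v"
    "continuous_on S (radial_clamp M :: 'b \<Rightarrow> 'b)"
proof -
  have p: "max M (norm v) > 0" for v :: 'b using assms by (simp add: less_max_iff_disj)
  show "norm (radial_clamp M v) \<le> M"
    using assms p[of v] unfolding radial_clamp_def by (auto simp: divide_le_eq max_def)
  show "norm v \<le> M \<Longrightarrow> radial_clamp M v = v" using assms by (simp add: radial_clamp_def max_def)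
  have "radial_clamp M v - v = (M / max M (norm v) - 1) *\<^sub>R v" by (simp add: radial_clamp_def scaleR_diff_left)
  moreover have "\<bar>M / max M (norm v) - 1\<bar> \<le> 1" using assms p[of v] by (auto simp: abs_le_iff divide_le_eq le_divide_eq)
  ultimately show "norm (radial_clamp M v - v) \<le> norm v" by (simp add: mult_left_le_one_le)
  show "continuous_on S (radial_clamp M :: 'b \<Rightarrow> 'b)" unfolding radial_clamp_def
    using p less_imp_neq[OF p] by (intro continuous_intros) (auto dest: sym)
qed

lemma nn_integral_dominated_tendsto_0:
  fixes u :: "nat \<Rightarrow> 'a \<Rightarrow> real"
  assumes "\<And>n. u n \<in> borel_measurable M" "integrable M w"
    "AE x in M. (\<lambda>n. u n x) \<longlonglongrightarrow> 0" "\<And>n. AE x in M. norm (u n x) \<le> w x" "\<And>n x. u n x \<ge> 0"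
  shows "(\<lambda>n. \<integral>\<^sup>+x. ennreal (u n x) \<partial>M) \<longlonglongrightarrow> 0"
proof -
  have "(\<lambda>n. integral\<^sup>L M (u n)) \<longlonglongrightarrow> integral\<^sup>L M (\<lambda>x. 0)"
    by (rule integral_dominated_convergence[OF _ assms(1) assms(2,3,4)]) auto
  moreover have "(\<integral>\<^sup>+x. ennreal (u n x) \<partial>M) = ennreal (integral\<^sup>L M (u n))" for n
  proof (rule nn_integral_eq_integral)
    show "integrable M (u n)"
      by (rule Bochner_Integration.integrable_bound[OF assms(2,1)], rule AE_mp[OF assms(4)[of n]]) auto
  qed (use assms(5) in auto)
  ultimately show ?thesis using tendsto_ennrealI by fastforce
qed

text \<open>Large values are clamped first. Then \<open>measurable_on\<close> yields continuous
  functions converging off a negligible set, and clamping these as well makes dominated convergence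
  applicable on the ball.\<close>

lemma L1_loc_approx_continuous:
  fixes f :: "'a::euclidean_space \<Rightarrow> 'b::euclidean_space"
  assumes f: "L1_loc f" and e: "e > 0"
  shows "\<exists>g. continuous_on UNIV g \<and>
    (\<integral>\<^sup>+x. ennreal (norm (f x - g x)) * indicator (cball 0 R) x \<partial>lebesgue) < ennreal e"
proof -
  note fm = L1_loc_measurable[OF f]
  have cm: "radial_clamp M \<in> borel_measurable borel" if "M > 0" for M :: real
    using radial_clamp_props(4)[OF that, of UNIV] by (rule borel_measurable_continuous_onI)
  have lim: "\<exists>n. (\<integral>\<^sup>+x. ennreal (u n x) \<partial>lebesgue) < ennreal (e/2)"
    if "(\<lambda>n. \<integral>\<^sup>+x. ennreal (u n x) \<partial>lebesgue) \<longlonglongrightarrow> 0" for u :: "nat \<Rightarrow> 'a \<Rightarrow> real"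
    using order_tendstoD(2)[OF that, of "ennreal (e/2)"] e by (auto simp: eventually_sequentially)
  have "(\<lambda>n. \<integral>\<^sup>+x. ennreal (indicat_real (cball 0 R) x * norm (f x - radial_clamp (real (Suc n)) (f x))) \<partial>lebesgue) \<longlonglongrightarrow> 0"
  proof (rule nn_integral_dominated_tendsto_0[where w = "\<lambda>x. norm (indicat_real (cball 0 R) x *\<^sub>R f x)"])
    show "(\<lambda>x. indicat_real (cball 0 R) x * norm (f x - radial_clamp (real (Suc n)) (f x))) \<in> borel_measurable lebesgue" for n
      using measurable_compose[OF fm cm[of "real (Suc n)"]] fm
      by (intro borel_measurable_times borel_measurable_norm[THEN measurable_compose[rotated]] borel_measurable_diff borel_measurable_indicator) auto
    show "integrable lebesgue (\<lambda>x. norm (indicat_real (cball 0 R) x *\<^sub>R f x))"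
      by (rule integrable_norm, rule L1_loc_integrable_cball[OF f])
    show "AE x in lebesgue. (\<lambda>n. indicat_real (cball 0 R) x * norm (f x - radial_clamp (real (Suc n)) (f x))) \<longlonglongrightarrow> 0"
    proof (rule AE_I2, rule tendsto_eventually)
      fix x
      obtain N where "norm (f x) \<le> real N" using real_arch_simple by blast
      then have "radial_clamp (real (Suc n)) (f x) = f x" if "n \<ge> N" for n
        using that by (intro radial_clamp_props) auto
      then show "\<forall>\<^sub>F n in sequentially. indicat_real (cball 0 R) x * norm (f x - radial_clamp (real (Suc n)) (f x)) = 0"
        by (auto simp: eventually_sequentially intro!: exI[of _ N])
    qed
    show "AE x in lebesgue. norm (indicat_real (cball 0 R) x * norm (f x - radial_clamp (real (Suc n)) (f x))) \<le> norm (indicat_real (cball 0 R) x *\<^sub>R f x)" for n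
      by (rule AE_I2) (use radial_clamp_props(2)[of "real (Suc n)"] in \<open>auto simp: norm_minus_commute intro!: mult_left_mono\<close>)
  qed auto
  from lim[OF this] obtain n where n: "(\<integral>\<^sup>+x. ennreal (indicat_real (cball 0 R) x * norm (f x - radial_clamp (real (Suc n)) (f x))) \<partial>lebesgue) < ennreal (e/2)"
    by blast
  define M where "M = real (Suc n)"
  have M: "M > 0" by (simp add: M_def)
  have "f measurable_on UNIV" using fm by (intro lebesgue_measurable_imp_measurable_on) auto
  then obtain N g where N: "negligible N" "\<And>n. continuous_on UNIV (g n)" "\<And>x. x \<notin> N \<Longrightarrow> (\<lambda>n. g n x) \<longlonglongrightarrow> f x"
    unfolding measurable_on_def by auto
  have gc: "continuous_on UNIV (\<lambda>x. radial_clamp M (g k x))" for k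
    by (rule continuous_on_compose2[OF radial_clamp_props(4)[OF M] N(2)]) auto
  have gm: "(\<lambda>x. radial_clamp M (g k x)) \<in> borel_measurable lebesgue" for k
    using L1_loc_measurable[OF L1_loc_continuous[OF gc]] .
  have fcm: "(\<lambda>x. radial_clamp M (f x)) \<in> borel_measurable lebesgue"
    by (rule measurable_compose[OF fm cm[OF M]])
  have "(\<lambda>k. \<integral>\<^sup>+x. ennreal (indicat_real (cball 0 R) x * norm (radial_clamp M (f x) - radial_clamp M (g k x))) \<partial>lebesgue) \<longlonglongrightarrow> 0"
  proof (rule nn_integral_dominated_tendsto_0[where w = "\<lambda>x. indicat_real (cball 0 R) x *\<^sub>R (2 * M)"])
    show "(\<lambda>x. indicat_real (cball 0 R) x * norm (radial_clamp M (f x) - radial_clamp M (g k x))) \<in> borel_measurable lebesgue" for k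
      using gm fcm
      by (intro borel_measurable_times borel_measurable_norm[THEN measurable_compose[rotated]] borel_measurable_diff borel_measurable_indicator) auto
    show "integrable lebesgue (\<lambda>x. indicat_real (cball 0 R) (x::'a) *\<^sub>R (2 * M))"
      by (rule L1_loc_integrable_cball[OF L1_loc_const])
    have "AE x in lebesgue. x \<notin> N" using N(1) by (intro AE_not_in) (simp add: negligible_iff_null_sets)
    then show "AE x in lebesgue. (\<lambda>k. indicat_real (cball 0 R) x * norm (radial_clamp M (f x) - radial_clamp M (g k x))) \<longlonglongrightarrow> 0"
    proof (rule AE_mp, intro AE_I2 impI)
      fix x assume "x \<notin> N"
      have "isCont (radial_clamp M) (f x)"
        using radial_clamp_props(4)[where 'b='b, OF M, of UNIV] by (simp add: continuous_on_eq_continuous_at)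
      from isCont_tendsto_compose[OF this N(3)[OF \<open>x \<notin> N\<close>]]
      have "(\<lambda>k. indicat_real (cball 0 R) x * norm (radial_clamp M (f x) - radial_clamp M (g k x))) \<longlonglongrightarrow>
        indicat_real (cball 0 R) x * norm (radial_clamp M (f x) - radial_clamp M (f x))"
        by (intro tendsto_intros)
      then show "(\<lambda>k. indicat_real (cball 0 R) x * norm (radial_clamp M (f x) - radial_clamp M (g k x))) \<longlonglongrightarrow> 0" by simp
    qed
    show "AE x in lebesgue. norm (indicat_real (cball 0 R) x * norm (radial_clamp M (f x) - radial_clamp M (g k x))) \<le> indicat_real (cball 0 R) x *\<^sub>R (2 * M)" for k
    proof (rule AE_I2)
      fix x
      have "norm (radial_clamp M (f x) - radial_clamp M (g k x)) \<le> 2 * M"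
        using norm_triangle_ineq4[of "radial_clamp M (f x)" "radial_clamp M (g k x)"] radial_clamp_props(1)[OF M, of "f x"] radial_clamp_props(1)[OF M, of "g k x"] by linarith
      then show "norm (indicat_real (cball 0 R) x * norm (radial_clamp M (f x) - radial_clamp M (g k x))) \<le> indicat_real (cball 0 R) x *\<^sub>R (2 * M)"
        by (simp add: abs_mult mult_left_mono)
    qed
  qed auto
  from lim[OF this] obtain k where k: "(\<integral>\<^sup>+x. ennreal (indicat_real (cball 0 R) x * norm (radial_clamp M (f x) - radial_clamp M (g k x))) \<partial>lebesgue) < ennreal (e/2)"
    by blast
  have "(\<integral>\<^sup>+x. ennreal (norm (f x - radial_clamp M (g k x))) * indicator (cball 0 R) x \<partial>lebesgue)
    \<le> (\<integral>\<^sup>+x. ennreal (indicat_real (cball 0 R) x * norm (f x - radial_clamp M (f x))) + ennreal (indicat_real (cball 0 R) x * norm (radial_clamp M (f x) - radial_clamp M (g k x))) \<partial>lebesgue)"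
  proof (intro nn_integral_mono)
    fix x
    have "norm (f x - radial_clamp M (g k x)) \<le> norm (f x - radial_clamp M (f x)) + norm (radial_clamp M (f x) - radial_clamp M (g k x))"
      using norm_triangle_ineq[of "f x - radial_clamp M (f x)" "radial_clamp M (f x) - radial_clamp M (g k x)"] by simp
    then show "ennreal (norm (f x - radial_clamp M (g k x))) * indicator (cball 0 R) x
      \<le> ennreal (indicat_real (cball 0 R) x * norm (f x - radial_clamp M (f x))) + ennreal (indicat_real (cball 0 R) x * norm (radial_clamp M (f x) - radial_clamp M (g k x)))"
      by (auto simp: indicator_def simp flip: ennreal_plus)
  qed
  also have "\<dots> = (\<integral>\<^sup>+x. ennreal (indicat_real (cball 0 R) x * norm (f x - radial_clamp M (f x))) \<partial>lebesgue) + (\<integral>\<^sup>+x. ennreal (indicat_real (cball 0 R) x * norm (radial_clamp M (f x) - radial_clamp M (g k x))) \<partial>lebesgue)"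
    using gm fcm fm
    by (intro nn_integral_add measurable_compose[OF _ measurable_ennreal] borel_measurable_times borel_measurable_norm[THEN measurable_compose[rotated]] borel_measurable_diff borel_measurable_indicator) auto
  also have "\<dots> < ennreal (e/2) + ennreal (e/2)"
    using n k by (intro add_strict_mono) (auto simp: M_def)
  also have "\<dots> = ennreal e" using e by (simp flip: ennreal_plus)
  finally show ?thesis using gc by blast
qed

lemma mollify_continuous_close:
  fixes g :: "'a::euclidean_space \<Rightarrow> 'b::euclidean_space"
  assumes g: "continuous_on UNIV g" and e: "e > 0"
  shows "\<exists>r0>0. r0 \<le> 1 \<and> (\<forall>r \<rho> K x. r \<le> r0 \<longrightarrow> mollifier r \<rho> K \<longrightarrow> norm x \<le> R \<longrightarrow> norm (mollify \<rho> g x - g x) \<le> e)"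
proof -
  have "uniformly_continuous_on (cball 0 (R + 1)) g"
    by (intro compact_uniformly_continuous continuous_on_subset[OF g]) auto
  from this[unfolded uniformly_continuous_on_def] e obtain d
    where d: "d > 0" "\<And>x y. x \<in> cball 0 (R + 1) \<Longrightarrow> y \<in> cball 0 (R + 1) \<Longrightarrow> dist y x < d \<Longrightarrow> dist (g y) (g x) < e"
    by blast
  have "norm (mollify \<rho> g x - g x) \<le> e"
    if r: "r \<le> min d 1" and m: "mollifier r \<rho> K" and x: "norm x \<le> R" for r \<rho> K x
  proof -
    note i = mollifier_nn_integral(3,4)[OF m, of x]
    note j = mollify_integrable'[OF m L1_loc_continuous[OF g], of x]
    have i2: "integrable lebesgue (\<lambda>y. \<rho> (x - y) *\<^sub>R g x)" using i(1) by (rule integrable_scaleR_left)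
    have "g x = (LINT y|lebesgue. \<rho> (x - y) *\<^sub>R g x)" using i by simp
    then have "mollify \<rho> g x - g x = (LINT y|lebesgue. \<rho> (x - y) *\<^sub>R g y) - (LINT y|lebesgue. \<rho> (x - y) *\<^sub>R g x)"
      unfolding mollify_def by simp
    also have "\<dots> = (LINT y|lebesgue. \<rho> (x - y) *\<^sub>R g y - \<rho> (x - y) *\<^sub>R g x)"
      by (rule Bochner_Integration.integral_diff[OF j i2, symmetric])
    also have "norm \<dots> \<le> (LINT y|lebesgue. e * \<rho> (x - y))"
    proof (rule Bochner_Integration.integral_norm_bound_integral)
      show "integrable lebesgue (\<lambda>y. \<rho> (x - y) *\<^sub>R g y - \<rho> (x - y) *\<^sub>R g x)"
        by (rule Bochner_Integration.integrable_diff[OF j i2])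
      show "integrable lebesgue (\<lambda>y. e * \<rho> (x - y))" using i by simp
      fix y
      show "norm (\<rho> (x - y) *\<^sub>R g y - \<rho> (x - y) *\<^sub>R g x) \<le> e * \<rho> (x - y)"
      proof (cases "norm (x - y) \<ge> r")
        case True
        then show ?thesis using mollifierD(4)[OF m] by simp
      next
        case False
        then have "norm (y - x) < d" "norm (y - x) < 1" using r by (auto simp: norm_minus_commute)
        moreover have "norm y \<le> norm x + norm (y - x)" using norm_triangle_sub by blast
        ultimately have "norm (g y - g x) \<le> e" using d(2)[of x y] x by (auto simp: dist_norm)
        then show ?thesis using mollifierD(3)[OF m, of "x - y"]
          by (simp add: mult.commute[of e] mult_left_mono flip: scaleR_diff_right)
      qed
    qed
    also have "\<dots> = e" using i by simp
    finally show ?thesis .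
  qed
  then show ?thesis using d(1) by (intro exI[of _ "min d 1"]) auto
qed

text \<open>Split through a continuous \<open>g\<close> near \<open>f\<close>: mollification
  contracts the difference \<open>f - g\<close>, and it moves \<open>g\<close> little, uniformly on
  the ball.\<close>

lemma mollify_close:
  fixes f :: "'a::euclidean_space \<Rightarrow> 'b::euclidean_space"
  assumes f: "L1_loc f" and e: "e > 0" and R: "R \<ge> 0"
  shows "\<exists>r0>0. \<forall>r \<rho> K. r \<le> r0 \<longrightarrow> mollifier r \<rho> K \<longrightarrow>
    (\<integral>\<^sup>+x. ennreal (norm (mollify \<rho> f x - f x)) * indicator (cball 0 R) x \<partial>lebesgue) < ennreal e"
proof -
  \<comment> \<open>Kernels of radius at most 1 look from the ball of radius \<open>R\<close> into
    the one of radius \<open>R + 1\<close>, so \<open>g\<close> has to be close to \<open>f\<close>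
    there.\<close>
  obtain g where g: "continuous_on UNIV g"
    "(\<integral>\<^sup>+x. ennreal (norm (f x - g x)) * indicator (cball 0 (R + 1)) x \<partial>lebesgue) < ennreal (e/3)"
    using L1_loc_approx_continuous[OF f, of "e/3" "R + 1"] e by auto
  define V where "V = measure lebesgue (cball (0::'a) R)"
  have V: "emeasure lebesgue (cball (0::'a) R) = ennreal V" "V \<ge> 0"
    unfolding V_def using emeasure_lborel_cball_finite[of "0::'a" R] by (auto simp: emeasure_eq_ennreal_measure)
  \<comment> \<open>A quarter with \<open>V + 1\<close> keeps \<open>e' * V\<close> strictly below
    \<open>e / 3\<close>, also for \<open>V = 0\<close>.\<close>
  define e' where "e' = e / 4 / (V + 1)"
  have e': "e' > 0" "e' * V < e / 3" using e V(2) by (auto simp: e'_def field_simps add_pos_nonneg add_nonneg_pos)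
  obtain r0 where r0: "r0 > 0" "r0 \<le> 1"
    "\<And>r \<rho> K x. r \<le> r0 \<Longrightarrow> mollifier r \<rho> K \<Longrightarrow> norm x \<le> R \<Longrightarrow> norm (mollify \<rho> g x - g x) \<le> e'"
    using mollify_continuous_close[OF g(1) e'(1), of R] by blast
  note gL = L1_loc_continuous[OF g(1)]
  have dL: "L1_loc (\<lambda>x. f x - g x)"
    using L1_loc_add[OF f L1_loc_continuous[of "\<lambda>x. - g x"]] g(1) by (simp add: continuous_on_minus)
  note ms = L1_loc_measurable[OF f] L1_loc_measurable[OF gL]
  have main: "(\<integral>\<^sup>+x. ennreal (norm (mollify \<rho> f x - f x)) * indicator (cball 0 R) x \<partial>lebesgue) < ennreal e"
    if r: "r \<le> r0" and m: "mollifier r \<rho> K" for r \<rho> and K :: "'a \<Rightarrow> 'a"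
  proof -
    have mm: "mollify \<rho> h \<in> borel_measurable lebesgue" if "L1_loc h" for h :: "'a \<Rightarrow> 'b"
      using L1_loc_measurable[OF L1_loc_continuous[OF mollify_continuous[OF m that]]] .
    have lin: "mollify \<rho> (\<lambda>x. f x - g x) x = mollify \<rho> f x - mollify \<rho> g x" for x
      unfolding mollify_def scaleR_diff_right
      by (rule Bochner_Integration.integral_diff[OF mollify_integrable'[OF m f] mollify_integrable'[OF m gL]])
    have "(\<integral>\<^sup>+x. ennreal (norm (mollify \<rho> f x - f x)) * indicator (cball 0 R) x \<partial>lebesgue)
      \<le> (\<integral>\<^sup>+x. (ennreal (norm (mollify \<rho> (\<lambda>x. f x - g x) x)) * indicator (cball 0 R) x + ennreal e' * indicator (cball 0 R) x)
           + ennreal (norm (f x - g x)) * indicator (cball 0 (R + 1)) x \<partial>lebesgue)"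
    proof (rule nn_integral_mono)
      fix x
      show "ennreal (norm (mollify \<rho> f x - f x)) * indicator (cball 0 R) x \<le> (ennreal (norm (mollify \<rho> (\<lambda>x. f x - g x) x)) * indicator (cball 0 R) x + ennreal e' * indicator (cball 0 R) x)
           + ennreal (norm (f x - g x)) * indicator (cball 0 (R + 1)) x"
      proof (cases "norm x \<le> R")
        case True
        have "norm (mollify \<rho> f x - f x) \<le> norm (mollify \<rho> f x - mollify \<rho> g x) + norm (mollify \<rho> g x - g x) + norm (f x - g x)"
          using norm_triangle_ineq4[of "(mollify \<rho> f x - mollify \<rho> g x) + (mollify \<rho> g x - g x)" "f x - g x"]
            norm_triangle_ineq[of "mollify \<rho> f x - mollify \<rho> g x" "mollify \<rho> g x - g x"] by simp
        also have "\<dots> \<le> norm (mollify \<rho> (\<lambda>x. f x - g x) x) + e' + norm (f x - g x)"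
          using r0(3)[OF r m True] by (simp add: lin)
        finally show ?thesis using True e'(1) by (simp flip: ennreal_plus)
      qed simp
    qed
    also have "\<dots> = (\<integral>\<^sup>+x. ennreal (norm (mollify \<rho> (\<lambda>x. f x - g x) x)) * indicator (cball 0 R) x \<partial>lebesgue)
        + (\<integral>\<^sup>+x. ennreal e' * indicator (cball (0::'a) R) x \<partial>lebesgue)
        + (\<integral>\<^sup>+x. ennreal (norm (f x - g x)) * indicator (cball 0 (R + 1)) x \<partial>lebesgue)"
      using ms mm[OF dL]
      by (subst nn_integral_add nn_integral_add;
          (intro borel_measurable_add borel_measurable_times_ennreal measurable_compose[OF _ measurable_ennreal] borel_measurable_const
             borel_measurable_norm[THEN measurable_compose[rotated]] borel_measurable_diff borel_measurable_indicator refl arg_cong2[where f = plus] nn_integral_add)?; simp?)+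
    also have "\<dots> < ennreal (e/3) + ennreal (e/3) + ennreal (e/3)"
    proof (intro add_strict_mono)
      have "(\<integral>\<^sup>+x. ennreal (norm (mollify \<rho> (\<lambda>x. f x - g x) x)) * indicator (cball 0 R) x \<partial>lebesgue)
        \<le> (\<integral>\<^sup>+x. ennreal (norm (f x - g x)) * indicator (cball 0 (R + r)) x \<partial>lebesgue)"
        by (rule mollify_contraction[OF m dL])
      also have "\<dots> \<le> (\<integral>\<^sup>+x. ennreal (norm (f x - g x)) * indicator (cball 0 (R + 1)) x \<partial>lebesgue)"
        using r r0 by (intro nn_integral_mono mult_left_mono) (auto simp: indicator_def)
      also note g(2)
      finally show "(\<integral>\<^sup>+x. ennreal (norm (mollify \<rho> (\<lambda>x. f x - g x) x)) * indicator (cball 0 R) x \<partial>lebesgue) < ennreal (e/3)" .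
      have "(\<integral>\<^sup>+x. ennreal e' * indicator (cball (0::'a) R) x \<partial>lebesgue) = ennreal e' * ennreal V"
        by (subst nn_integral_cmult_indicator) (use V in auto)
      also have "\<dots> = ennreal (e' * V)" using e' V by (simp add: ennreal_mult)
      also have "\<dots> < ennreal (e/3)" using e' V e by (intro ennreal_lessI) auto
      finally show "(\<integral>\<^sup>+x. ennreal e' * indicator (cball (0::'a) R) x \<partial>lebesgue) < ennreal (e/3)" .
    qed (rule g)
    also have "\<dots> = ennreal e" using e by (simp flip: ennreal_plus)
    finally show ?thesis .
  qed
  then show ?thesis using r0(1) by blast
qed

section \<open>Weak gradients\<close>

text \<open>The radii are hidden so that the notion passes to subsequences, which is how convergence
  almost everywhere is obtained.\<close>

definition mollifier_seq :: "(nat \<Rightarrow> 'a::euclidean_space \<Rightarrow> real) \<Rightarrow> (nat \<Rightarrow> 'a \<Rightarrow> 'a) \<Rightarrow> bool" where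
  "mollifier_seq \<rho> K \<longleftrightarrow> (\<exists>r. r \<longlonglongrightarrow> 0 \<and> (\<forall>n. mollifier (r n) (\<rho> n) (K n)))"

lemma mollifier_seq_exists: "\<exists>(\<rho>::nat \<Rightarrow> 'a::euclidean_space \<Rightarrow> real) K. mollifier_seq \<rho> K"
proof -
  have "\<forall>n. \<exists>(\<rho>::'a \<Rightarrow> real) K. mollifier (inverse (real (Suc n))) \<rho> K"
    by (intro allI mollifier_exists) simp
  then obtain \<rho> :: "nat \<Rightarrow> 'a \<Rightarrow> real" and K where "\<And>n. mollifier (inverse (real (Suc n))) (\<rho> n) (K n)"
    by metis
  then show ?thesis unfolding mollifier_seq_def using LIMSEQ_inverse_real_of_nat by blast
qed

lemma mollifier_seq_subseq:
  assumes "mollifier_seq \<rho> K" "strict_mono \<phi>"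
  shows "mollifier_seq (\<lambda>n. \<rho> (\<phi> n)) (\<lambda>n. K (\<phi> n))"
proof -
  obtain r where "r \<longlonglongrightarrow> 0" "\<And>n. mollifier (r n) (\<rho> n) (K n)"
    using assms(1) unfolding mollifier_seq_def by blast
  then show ?thesis unfolding mollifier_seq_def
    using LIMSEQ_subseq_LIMSEQ[OF _ assms(2), of r 0] by (intro exI[of _ "r \<circ> \<phi>"]) auto
qed

lemma mollifier_seqD:
  assumes "mollifier_seq \<rho> K" shows "\<exists>r. mollifier r (\<rho> n) (K n)"
  using assms unfolding mollifier_seq_def by blast

lemma mollify_seq_L1_loc:
  assumes "mollifier_seq \<rho> K" "L1_loc f" shows "L1_loc (mollify (\<rho> n) f)"
  using mollifier_seqD[OF assms(1), of n] mollify_continuous[OF _ assms(2)] L1_loc_continuous by blast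

lemma L1_loc_diff:
  fixes f g :: "'a::euclidean_space \<Rightarrow> 'b::euclidean_space"
  assumes "L1_loc f" "L1_loc g" shows "L1_loc (\<lambda>x. f x - g x)"
proof -
  have "L1_loc (\<lambda>x. - g x)"
    by (rule L1_loc_bound[OF assms(2), where B = 1])
       (use L1_loc_measurable[OF assms(2)] in auto)
  from L1_loc_add[OF assms(1) this] show ?thesis by simp
qed

lemma mollify_seq_L1:
  fixes f :: "'a::euclidean_space \<Rightarrow> 'b::euclidean_space"
  assumes s: "mollifier_seq \<rho> K" and f: "L1_loc f"
  shows "(\<lambda>n. LINT x|lebesgue. norm (indicat_real (cball 0 R) x *\<^sub>R (mollify (\<rho> n) f x - f x))) \<longlonglongrightarrow> 0"
proof -
  obtain r where r: "r \<longlonglongrightarrow> 0" "\<And>n. mollifier (r n) (\<rho> n) (K n)" using s unfolding mollifier_seq_def by blast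
  have i: "integrable lebesgue (\<lambda>x. norm (indicat_real (cball 0 R) x *\<^sub>R (mollify (\<rho> n) f x - f x)))" for n R
    by (intro integrable_norm L1_loc_integrable_cball L1_loc_diff f mollify_seq_L1_loc[OF s])
  show ?thesis
  proof (rule LIMSEQ_I)
    fix e :: real assume e: "e > 0"
    obtain r0 where r0: "r0 > 0" "\<And>r \<rho> K. r \<le> r0 \<Longrightarrow> mollifier r \<rho> K \<Longrightarrow>
      (\<integral>\<^sup>+x. ennreal (norm (mollify \<rho> f x - f x)) * indicator (cball 0 \<bar>R\<bar>) x \<partial>lebesgue) < ennreal e"
      using mollify_close[OF f e, of "\<bar>R\<bar>"] by auto
    obtain N where N: "\<And>n. n \<ge> N \<Longrightarrow> r n \<le> r0"
      using order_tendstoD(2)[OF r(1) r0(1)] unfolding eventually_sequentially by (meson less_imp_le)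
    have "norm ((LINT x|lebesgue. norm (indicat_real (cball 0 R) x *\<^sub>R (mollify (\<rho> n) f x - f x))) - 0) < e" if "n \<ge> N" for n
    proof -
      have "ennreal (LINT x|lebesgue. norm (indicat_real (cball 0 R) x *\<^sub>R (mollify (\<rho> n) f x - f x)))
        = (\<integral>\<^sup>+x. ennreal (norm (indicat_real (cball 0 R) x *\<^sub>R (mollify (\<rho> n) f x - f x))) \<partial>lebesgue)"
        by (rule nn_integral_eq_integral[OF i, symmetric]) auto
      also have "\<dots> \<le> (\<integral>\<^sup>+x. ennreal (norm (mollify (\<rho> n) f x - f x)) * indicator (cball 0 \<bar>R\<bar>) x \<partial>lebesgue)"
        by (intro nn_integral_mono) (auto simp: indicator_def)
      also have "\<dots> < ennreal e" by (rule r0(2)[OF N[OF that] r(2)])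
      finally show ?thesis
        using integral_nonneg_AE[of "\<lambda>x. norm (indicat_real (cball 0 R) x *\<^sub>R (mollify (\<rho> n) f x - f x))" lebesgue]
        by (simp add: ennreal_less_iff)
    qed
    then show "\<exists>N. \<forall>n\<ge>N. norm ((LINT x|lebesgue. norm (indicat_real (cball 0 R) x *\<^sub>R (mollify (\<rho> n) f x - f x))) - 0) < e"
      by blast
  qed
qed

text \<open>Restricted to a ball because the L1 convergence from which it is extracted is only
  local.\<close>

definition ae_conv :: "real \<Rightarrow> (nat \<Rightarrow> 'a::euclidean_space \<Rightarrow> real) \<Rightarrow> ('a \<Rightarrow> 'b::euclidean_space) \<Rightarrow> bool" where
  "ae_conv R \<rho> f \<longleftrightarrow> (AE x in lebesgue. norm x \<le> R \<longrightarrow> (\<lambda>n. mollify (\<rho> n) f x) \<longlonglongrightarrow> f x)"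

lemma ae_conv_subseq:
  assumes "ae_conv R \<rho> f" "strict_mono \<phi>" shows "ae_conv R (\<lambda>n. \<rho> (\<phi> n)) f"
  using assms(1) unfolding ae_conv_def
  by (rule AE_mp, intro AE_I2) (use LIMSEQ_subseq_LIMSEQ[OF _ assms(2)] in \<open>auto simp: o_def\<close>)

lemma mollify_ae_subseq:
  fixes f :: "'a::euclidean_space \<Rightarrow> 'b::euclidean_space"
  assumes s: "mollifier_seq \<rho> K" and f: "L1_loc f"
  shows "\<exists>\<phi>. strict_mono \<phi> \<and> ae_conv R (\<lambda>n. \<rho> (\<phi> n)) f"
proof -
  have i: "integrable lebesgue (\<lambda>x. indicat_real (cball 0 R) x *\<^sub>R (mollify (\<rho> n) f x - f x))" for n
    by (intro L1_loc_integrable_cball L1_loc_diff f mollify_seq_L1_loc[OF s])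
  obtain \<phi> where \<phi>: "strict_mono \<phi>"
    "AE x in lebesgue. (\<lambda>n. indicat_real (cball 0 R) x *\<^sub>R (mollify (\<rho> (\<phi> n)) f x - f x)) \<longlonglongrightarrow> 0"
    using tendsto_L1_AE_subseq[OF i mollify_seq_L1[OF s f]] by auto
  have "ae_conv R (\<lambda>n. \<rho> (\<phi> n)) f"
    unfolding ae_conv_def by (rule AE_mp[OF \<phi>(2)], intro AE_I2) (auto simp: LIM_zero_iff)
  with \<phi>(1) show ?thesis by blast
qed

text \<open>A subsequence chosen for \<open>f\<close> is refined for \<open>g\<close>, so one
  sequence of kernels serves both functions.\<close>

lemma mollifier_seq_ae:
  fixes f :: "'a::euclidean_space \<Rightarrow> 'b::euclidean_space" and g :: "'a::euclidean_space \<Rightarrow> 'c::euclidean_space"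
  assumes "L1_loc f" "L1_loc g"
  shows "\<exists>\<rho> K. mollifier_seq \<rho> K \<and> ae_conv R \<rho> f \<and> ae_conv R \<rho> g"
proof -
  obtain \<rho> :: "nat \<Rightarrow> 'a \<Rightarrow> real" and K where s: "mollifier_seq \<rho> K" using mollifier_seq_exists by blast
  obtain \<phi> where 1: "strict_mono \<phi>" "ae_conv R (\<lambda>n. \<rho> (\<phi> n)) f" using mollify_ae_subseq[OF s assms(1)] by blast
  note s1 = mollifier_seq_subseq[OF s 1(1)]
  obtain \<psi> where 2: "strict_mono \<psi>" "ae_conv R (\<lambda>n. \<rho> (\<phi> (\<psi> n))) g" using mollify_ae_subseq[OF s1 assms(2)] by blast
  show ?thesis
    using mollifier_seq_subseq[OF s1 2(1)] ae_conv_subseq[OF 1(2) 2(1)] 2(2) by blast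
qed

lemma mollify_bounded:
  fixes f :: "'a::euclidean_space \<Rightarrow> real"
  assumes m: "mollifier r \<rho> K" and f: "L1_loc f" and B: "\<And>x. \<bar>f x\<bar> \<le> B"
  shows "\<bar>mollify \<rho> f x\<bar> \<le> B"
proof -
  have "norm (mollify \<rho> f x) \<le> (LINT y|lebesgue. B * \<rho> (x - y))"
    unfolding mollify_def
  proof (rule Bochner_Integration.integral_norm_bound_integral[OF mollify_integrable'[OF m f]])
    show "integrable lebesgue (\<lambda>y. B * \<rho> (x - y))" using mollifier_nn_integral(3)[OF m] by simp
    show "norm (\<rho> (x - y) *\<^sub>R f y) \<le> B * \<rho> (x - y)" for y
      using B[of y] mollifierD(3)[OF m, of "x - y"] by (simp add: abs_mult mult.commute[of B] mult_left_mono)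
  qed
  then show ?thesis using mollifier_nn_integral(4)[OF m] by simp
qed

text \<open>Uniformly bounded coefficients that converge almost everywhere pair well with L1
  convergence: replacing the mollification by \<open>g\<close> costs at most \<open>B\<close> times
  the L1 error, after which \<open>g\<close> gives a fixed majorant. This is the limit passage in
  all product and chain rules below.\<close>

lemma tendsto_LINT_mollify:
  fixes g :: "'a::euclidean_space \<Rightarrow> real"
  assumes s: "mollifier_seq \<rho> K" and g: "L1_loc g"
    and cm: "\<And>n. c n \<in> borel_measurable lebesgue"
    and B: "\<And>n x. \<bar>c n x\<bar> \<le> B" and R: "\<And>n x. norm x > R \<Longrightarrow> c n x = 0"
    and lim: "AE x in lebesgue. (\<lambda>n. c n x) \<longlonglongrightarrow> c' x" and c'm: "c' \<in> borel_measurable lebesgue"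
  shows "(\<lambda>n. LINT x|lebesgue. c n x * mollify (\<rho> n) g x) \<longlonglongrightarrow> (LINT x|lebesgue. c' x * g x)"
    "integrable lebesgue (\<lambda>x. c n x * mollify (\<rho> n) g x)"
proof -
  note gm = L1_loc_measurable[OF g]
  have i: "integrable lebesgue (\<lambda>x. c n x * h x)" if "L1_loc h" for n and h :: "'a \<Rightarrow> real"
    using cm B R L1_loc_measurable[OF that]
    by (intro integrable_L1_loc_bound[OF that, where B = B and R = R]) (auto simp: abs_mult intro: mult_right_mono)
  show "integrable lebesgue (\<lambda>x. c n x * mollify (\<rho> n) g x)" for n
    by (rule i[OF mollify_seq_L1_loc[OF s g]])
  have 1: "(\<lambda>n. LINT x|lebesgue. c n x * g x) \<longlonglongrightarrow> (LINT x|lebesgue. c' x * g x)"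
  proof (rule integral_dominated_convergence[where w = "\<lambda>x. B * norm (indicat_real (cball 0 R) x *\<^sub>R g x)"])
    show "integrable lebesgue (\<lambda>x. B * norm (indicat_real (cball 0 R) x *\<^sub>R g x))"
      by (intro integrable_mult_right integrable_norm L1_loc_integrable_cball g)
    show "AE x in lebesgue. (\<lambda>n. c n x * g x) \<longlonglongrightarrow> c' x * g x"
      using lim by (rule AE_mp, intro AE_I2 impI tendsto_mult_right)
    show "AE x in lebesgue. norm (c n x * g x) \<le> B * norm (indicat_real (cball 0 R) x *\<^sub>R g x)" for n
      by (rule AE_I2) (use B R in \<open>auto simp: abs_mult indicator_def not_le intro: mult_right_mono\<close>)
  qed (use cm c'm gm in auto)
  have 2: "(\<lambda>n. LINT x|lebesgue. c n x * mollify (\<rho> n) g x - c n x * g x) \<longlonglongrightarrow> 0"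
  proof (rule Lim_null_comparison)
    show "(\<lambda>n. B * (LINT x|lebesgue. norm (indicat_real (cball 0 R) x *\<^sub>R (mollify (\<rho> n) g x - g x)))) \<longlonglongrightarrow> 0"
      using tendsto_mult_left[OF mollify_seq_L1[OF s g, of R], of B] by simp
    show "\<forall>\<^sub>F n in sequentially. norm (LINT x|lebesgue. c n x * mollify (\<rho> n) g x - c n x * g x)
      \<le> B * (LINT x|lebesgue. norm (indicat_real (cball 0 R) x *\<^sub>R (mollify (\<rho> n) g x - g x)))"
    proof (intro always_eventually allI)
      fix n
      have "norm (LINT x|lebesgue. c n x * mollify (\<rho> n) g x - c n x * g x)
        \<le> (LINT x|lebesgue. B * norm (indicat_real (cball 0 R) x *\<^sub>R (mollify (\<rho> n) g x - g x)))"
      proof (rule Bochner_Integration.integral_norm_bound_integral)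
        show "integrable lebesgue (\<lambda>x. c n x * mollify (\<rho> n) g x - c n x * g x)"
          by (intro Bochner_Integration.integrable_diff i g mollify_seq_L1_loc[OF s])
        show "integrable lebesgue (\<lambda>x. B * norm (indicat_real (cball 0 R) x *\<^sub>R (mollify (\<rho> n) g x - g x)))"
          by (intro integrable_mult_right integrable_norm L1_loc_integrable_cball L1_loc_diff g mollify_seq_L1_loc[OF s])
        show "norm (c n x * mollify (\<rho> n) g x - c n x * g x) \<le> B * norm (indicat_real (cball 0 R) x *\<^sub>R (mollify (\<rho> n) g x - g x))" for x
          using B[of n x] R[of x n]
          by (cases "norm x \<le> R") (auto simp: abs_mult intro: mult_right_mono simp flip: right_diff_distrib)
      qed
      then show "norm (LINT x|lebesgue. c n x * mollify (\<rho> n) g x - c n x * g x)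
      \<le> B * (LINT x|lebesgue. norm (indicat_real (cball 0 R) x *\<^sub>R (mollify (\<rho> n) g x - g x)))" by simp
    qed
  qed
  have "(LINT x|lebesgue. c n x * mollify (\<rho> n) g x - c n x * g x) + (LINT x|lebesgue. c n x * g x)
      = (LINT x|lebesgue. c n x * mollify (\<rho> n) g x)" for n
    by (subst Bochner_Integration.integral_diff[OF i i]) (auto intro: g mollify_seq_L1_loc[OF s])
  with tendsto_add[OF 2 1] show "(\<lambda>n. LINT x|lebesgue. c n x * mollify (\<rho> n) g x) \<longlonglongrightarrow> (LINT x|lebesgue. c' x * g x)"
    by simp
qed

section \<open>Integration by parts and calculus for weak gradients\<close>

lemma L1_loc_inner:
  assumes "L1_loc F" shows "L1_loc (\<lambda>x. F x \<bullet> b)"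
  by (rule L1_loc_bound[OF assms, where B = "norm b"])
     (use L1_loc_measurable[OF assms] in \<open>auto simp: mult.commute[of "norm b"] Cauchy_Schwarz_ineq2\<close>)

lemma C1_gradient_vanish:
  assumes "C1_gradient f F" "\<And>x. norm x \<ge> R \<Longrightarrow> f x = 0" "norm x > R"
  shows "F x = 0"
  by (rule C1_gradient_zero[OF assms(1), of "{x. norm x > R}" 0])
     (use assms in \<open>auto intro!: open_Collect_less continuous_intros\<close>)

lemma C1_gradient_parts:
  assumes "C1_gradient f F" "C1_gradient \<psi> \<Psi>" "\<And>x. norm x \<ge> R \<Longrightarrow> \<psi> x = 0"
  shows "(LINT x|lebesgue. f x * (\<Psi> x \<bullet> b)) + (LINT x|lebesgue. \<psi> x * (F x \<bullet> b)) = 0"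
proof -
  have z: "\<Psi> x = 0" if "norm x > R" for x by (rule C1_gradient_vanish[OF assms(2,3) that])
  note c = C1_gradient_continuous[OF assms(1)] C1_gradient_continuous[OF assms(2)]
  have 1: "integrable lebesgue (\<lambda>x. f x *\<^sub>R (\<Psi> x \<bullet> b))"
    by (rule integrable_mult_compact_support[of _ _ R]) (use c z in \<open>auto intro!: L1_loc_continuous continuous_intros\<close>)
  have 2: "integrable lebesgue (\<lambda>x. (F x \<bullet> b) *\<^sub>R \<psi> x)"
    by (rule integrable_mult_compact_support[of _ _ R]) (use c assms(3) in \<open>auto intro!: L1_loc_continuous continuous_intros\<close>)
  note C = C1_gradient_mult[OF assms(1,2)]
  have "(LINT x|lebesgue. f x *\<^sub>R \<Psi> x + \<psi> x *\<^sub>R F x) \<bullet> b = 0"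
    using C1_gradient_integral_zero(2)[OF C, of R] assms(3) by simp
  then have "(LINT x|lebesgue. (f x *\<^sub>R \<Psi> x + \<psi> x *\<^sub>R F x) \<bullet> b) = 0"
    using integral_inner_left[of b lebesgue "\<lambda>x. f x *\<^sub>R \<Psi> x + \<psi> x *\<^sub>R F x"] C1_gradient_integral_zero(1)[OF C, of R] assms(3) by simp
  then show ?thesis
    using Bochner_Integration.integral_add[OF 1 2] by (simp add: inner_add_left mult.commute)
qed

text \<open>Extends the defining identity from smooth to once continuously differentiable test
  functions. Here \<open>f\<close> is mollified rather than the test function, so the classical
  formula applies for every \<open>n\<close>.\<close>

lemma weak_gradient_parts:
  fixes f :: "'a::euclidean_space \<Rightarrow> real"
  assumes w: "has_weak_gradient f F" and C: "C1_gradient \<psi> \<Psi>" and z: "\<And>x. norm x \<ge> R \<Longrightarrow> \<psi> x = 0"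
  shows "(LINT x|lebesgue. f x * (\<Psi> x \<bullet> b)) = - (LINT x|lebesgue. \<psi> x * (F x \<bullet> b))"
proof -
  have L: "L1_loc f" "L1_loc F" using w by (auto simp: has_weak_gradient_def)
  obtain \<rho> :: "nat \<Rightarrow> 'a \<Rightarrow> real" and K where s: "mollifier_seq \<rho> K" using mollifier_seq_exists by blast
  have Cz: "\<Psi> x = 0" if "norm x > R" for x by (rule C1_gradient_vanish[OF C z that])
  note c = C1_gradient_continuous[OF C]
  have z': "\<psi> x = 0" "\<Psi> x \<bullet> b = 0" if "norm x > R" for x using z[of x] Cz[OF that] that by auto
  obtain B1 where B1: "\<And>x. norm (\<psi> x) \<le> B1" using bounded_of_compact_support[OF c(1) z'(1)] by blast
  have "continuous_on UNIV (\<lambda>x. \<Psi> x \<bullet> b)" by (intro continuous_intros c)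
  then obtain B2 where B2: "\<And>x. norm (\<Psi> x \<bullet> b) \<le> B2" using bounded_of_compact_support[where F = "\<lambda>x. \<Psi> x \<bullet> b" and R = R] z'(2) by blast
  note m = C1_gradient_measurable[OF C]
  have 1: "(\<lambda>n. LINT x|lebesgue. (\<Psi> x \<bullet> b) * mollify (\<rho> n) f x) \<longlonglongrightarrow> (LINT x|lebesgue. (\<Psi> x \<bullet> b) * f x)"
    by (rule tendsto_LINT_mollify[OF s L(1), where R = R and B = B2]) (use m B2 Cz in auto)
  have 2: "(\<lambda>n. LINT x|lebesgue. \<psi> x * mollify (\<rho> n) (\<lambda>x. F x \<bullet> b) x) \<longlonglongrightarrow> (LINT x|lebesgue. \<psi> x * (F x \<bullet> b))"
    by (rule tendsto_LINT_mollify[OF s L1_loc_inner[OF L(2)], where R = R and B = B1]) (use m B1 z in auto)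
  have "(LINT x|lebesgue. (\<Psi> x \<bullet> b) * mollify (\<rho> n) f x) + (LINT x|lebesgue. \<psi> x * mollify (\<rho> n) (\<lambda>x. F x \<bullet> b) x) = 0" for n
  proof -
    obtain r where r: "mollifier r (\<rho> n) (K n)" using mollifier_seqD[OF s] by blast
    show ?thesis
      using C1_gradient_parts[OF mollify_has_gradient[OF r w] C z, where b = b] mollify_inner[OF r L(2)]
      by (simp add: mult.commute)
  qed
  with tendsto_add[OF 1 2] have "(LINT x|lebesgue. (\<Psi> x \<bullet> b) * f x) + (LINT x|lebesgue. \<psi> x * (F x \<bullet> b)) = 0"
    by (simp add: LIMSEQ_const_iff)
  then show ?thesis by (simp add: mult.commute)
qed

lemma has_weak_gradientI:
  assumes "L1_loc f" "L1_loc F"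
    and "\<And>\<eta> H R b. test_function \<eta> \<Longrightarrow> C1_gradient \<eta> H \<Longrightarrow> R > 0 \<Longrightarrow> (\<And>x. norm x \<ge> R \<Longrightarrow> \<eta> x = 0) \<Longrightarrow> b \<in> Basis \<Longrightarrow>
      (LINT x|lebesgue. f x * (H x \<bullet> b)) + (LINT x|lebesgue. \<eta> x * (F x \<bullet> b)) = 0"
  shows "has_weak_gradient f F"
  unfolding has_weak_gradient_def
proof (intro conjI allI impI ballI assms(1,2))
  fix \<eta> :: "'a \<Rightarrow> real" and b :: 'a assume t: "test_function \<eta>" and b: "b \<in> Basis"
  obtain R where R: "R > 0" "\<And>x. norm x \<ge> R \<Longrightarrow> \<eta> x = 0" using test_function_support[OF t] by blast
  obtain H where C: "C1_gradient \<eta> H" using test_function_C1[OF t] by blast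
  from assms(3)[OF t C R b] show "(LINT x|lebesgue. f x * partial_deriv b \<eta> x) = - (LINT x|lebesgue. F x \<bullet> b * \<eta> x)"
    by (simp add: C1_gradient_partial_deriv[OF C] mult.commute eq_neg_iff_add_eq_0)
qed

lemma C1_has_weak_gradient:
  assumes "C1_gradient f F" shows "has_weak_gradient f F"
proof (rule has_weak_gradientI)
  show "L1_loc f" "L1_loc F" using C1_gradient_continuous[OF assms] by (auto intro: L1_loc_continuous)
qed (rule C1_gradient_parts[OF assms])

lemma L1_loc_mult_bounded:
  fixes F :: "'a::euclidean_space \<Rightarrow> 'b::euclidean_space"
  assumes "L1_loc F" "c \<in> borel_measurable lebesgue" "\<And>x. \<bar>c x\<bar> \<le> B"
  shows "L1_loc (\<lambda>x. c x *\<^sub>R F x)"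
  by (rule L1_loc_bound[OF assms(1), where B = B])
     (use assms L1_loc_measurable[OF assms(1)] in \<open>auto intro: mult_right_mono\<close>)

lemma L1_loc_real_bounded:
  assumes "c \<in> borel_measurable lebesgue" "\<And>x. \<bar>c x\<bar> \<le> B"
  shows "L1_loc (c :: 'a::euclidean_space \<Rightarrow> real)"
  using L1_loc_mult_bounded[OF L1_loc_const[of "1::real"] assms] by simp

lemma integrable_cball_const: "integrable lebesgue (\<lambda>x::'a::euclidean_space. c * indicat_real (cball 0 R) x)"
  using L1_loc_integrable_cball[OF L1_loc_const[of c], of R] by (simp add: mult.commute)

lemma test_bounds:
  fixes \<eta> :: "'a::euclidean_space \<Rightarrow> real"
  assumes "C1_gradient \<eta> H" "\<And>x. norm x \<ge> R \<Longrightarrow> \<eta> x = 0"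
  obtains B where "B > 0" "\<And>x. \<bar>\<eta> x\<bar> \<le> B" "\<And>x. \<bar>H x \<bullet> b\<bar> \<le> B" "\<And>x. norm x > R \<Longrightarrow> H x = 0"
proof -
  have z: "H x = 0" if "norm x > R" for x by (rule C1_gradient_vanish[OF assms that])
  obtain B1 where B1: "B1 > 0" "\<And>x. norm (\<eta> x) \<le> B1"
    using bounded_of_compact_support[OF C1_gradient_continuous(1)[OF assms(1)], of R] assms(2) less_imp_le by blast
  obtain B2 where B2: "B2 > 0" "\<And>x. norm (H x) \<le> B2"
    using bounded_of_compact_support[OF C1_gradient_continuous(2)[OF assms(1)], of R] z by blast
  have b1: "\<bar>\<eta> x\<bar> \<le> B1 + B2 * norm b" for x
  proof -
    have "B2 * norm b \<ge> 0" using B2 by simp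
    then show ?thesis using B1(2)[of x] by simp
  qed
  have b2: "\<bar>H x \<bullet> b\<bar> \<le> B1 + B2 * norm b" for x
  proof -
    have "\<bar>H x \<bullet> b\<bar> \<le> B2 * norm b"
      by (rule order_trans[OF Cauchy_Schwarz_ineq2 mult_right_mono[OF B2(2)]]) simp
    then show ?thesis using B1(1) by simp
  qed
  have "B1 + B2 * norm b > 0" using B1 B2 by (simp add: add_pos_nonneg)
  from this b1 b2 z show ?thesis by (rule that)
qed

text \<open>The rule is classical for mollifications of \<open>f\<close>. In the limit the bounded
  \<open>\<beta>'\<close> composed with them converges almost everywhere and multiplies gradients
  that converge in L1.\<close>

lemma weak_gradient_chain:
  assumes w: "has_weak_gradient f F" and d: "\<And>t. (\<beta> has_real_derivative \<beta>' t) (at t)"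
    and c: "continuous_on UNIV \<beta>'" and B0: "\<And>t. \<bar>\<beta> t\<bar> \<le> B0" and B1: "\<And>t. \<bar>\<beta>' t\<bar> \<le> B1"
  shows "has_weak_gradient (\<lambda>x. \<beta> (f x)) (\<lambda>x. \<beta>' (f x) *\<^sub>R F x)"
proof -
  have L: "L1_loc f" "L1_loc F" using w by (auto simp: has_weak_gradient_def)
  note ms = L1_loc_measurable[OF L(1)] L1_loc_measurable[OF L(2)]
  have cb: "continuous_on UNIV \<beta>" using d by (intro DERIV_atLeastAtMost_imp_continuous_on continuous_at_imp_continuous_on) (auto intro: DERIV_isCont)
  have mb: "\<beta> \<in> borel_measurable borel" "\<beta>' \<in> borel_measurable borel"
    using c cb by (auto intro: borel_measurable_continuous_onI)
  have m2: "(\<lambda>x. \<beta> (f x)) \<in> borel_measurable lebesgue" "(\<lambda>x. \<beta>' (f x)) \<in> borel_measurable lebesgue"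
    using measurable_compose[OF ms(1)] mb by auto
  show ?thesis
  proof (rule has_weak_gradientI)
    show "L1_loc (\<lambda>x. \<beta> (f x))" by (rule L1_loc_real_bounded[OF m2(1) B0])
    show "L1_loc (\<lambda>x. \<beta>' (f x) *\<^sub>R F x)" by (rule L1_loc_mult_bounded[OF L(2) m2(2) B1])
    fix \<eta> :: "'a \<Rightarrow> real" and H R b
    assume C: "C1_gradient \<eta> H" and z: "\<And>x. norm x \<ge> R \<Longrightarrow> \<eta> x = 0"
    obtain B where B: "B > 0" "\<And>x. \<bar>\<eta> x\<bar> \<le> B" "\<And>x. \<bar>H x \<bullet> b\<bar> \<le> B" "\<And>x. norm x > R \<Longrightarrow> H x = 0"
      using test_bounds[OF C z] by blast
    note mC = C1_gradient_measurable[OF C]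
    obtain \<rho> :: "nat \<Rightarrow> 'a \<Rightarrow> real" and K where s: "mollifier_seq \<rho> K" and ae: "ae_conv R \<rho> f"
      using mollifier_seq_ae[OF L(1) L(1)] by blast
    define fn where "fn n = mollify (\<rho> n) f" for n
    have G: "C1_gradient (fn n) (mollify (\<rho> n) F)" for n
      using mollifier_seqD[OF s, of n] mollify_has_gradient[OF _ w] unfolding fn_def by blast
    have mf: "fn n \<in> borel_measurable lebesgue" for n using C1_gradient_measurable[OF G] by blast
    have m3: "(\<lambda>x. \<beta> (fn n x)) \<in> borel_measurable lebesgue" "(\<lambda>x. \<beta>' (fn n x)) \<in> borel_measurable lebesgue" for n
      using measurable_compose[OF mf] mb by auto
    have eq: "(LINT x|lebesgue. \<beta> (fn n x) * (H x \<bullet> b)) + (LINT x|lebesgue. (\<eta> x * \<beta>' (fn n x)) * mollify (\<rho> n) (\<lambda>x. F x \<bullet> b) x) = 0" for n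
    proof -
      obtain r where r: "mollifier r (\<rho> n) (K n)" using mollifier_seqD[OF s] by blast
      show ?thesis
        using C1_gradient_parts[OF C1_gradient_compose[OF G[of n] d c] C z, where b = b] mollify_inner[OF r L(2)]
        by (simp add: mult.assoc)
    qed
    have l1: "(\<lambda>n. LINT x|lebesgue. \<beta> (fn n x) * (H x \<bullet> b)) \<longlonglongrightarrow> (LINT x|lebesgue. \<beta> (f x) * (H x \<bullet> b))"
    proof (rule integral_dominated_convergence[where w = "\<lambda>x. (B0 * B) * indicat_real (cball 0 R) x"])
      show "AE x in lebesgue. (\<lambda>n. \<beta> (fn n x) * (H x \<bullet> b)) \<longlonglongrightarrow> \<beta> (f x) * (H x \<bullet> b)"
        using ae unfolding ae_conv_def
      proof (rule AE_mp, intro AE_I2 impI)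
        fix x assume x: "norm x \<le> R \<longrightarrow> (\<lambda>n. mollify (\<rho> n) f x) \<longlonglongrightarrow> f x"
        show "(\<lambda>n. \<beta> (fn n x) * (H x \<bullet> b)) \<longlonglongrightarrow> \<beta> (f x) * (H x \<bullet> b)"
        proof (cases "norm x \<le> R")
          case True
          have "(\<lambda>n. \<beta> (fn n x)) \<longlonglongrightarrow> \<beta> (f x)"
            by (rule isCont_tendsto_compose[OF DERIV_isCont[OF d]]) (use x True fn_def in simp)
          then show ?thesis by (rule tendsto_mult_right)
        qed (use B in simp)
      qed
      show "AE x in lebesgue. norm (\<beta> (fn n x) * (H x \<bullet> b)) \<le> (B0 * B) * indicat_real (cball 0 R) x" for n
      proof (rule AE_I2)
        fix x
        have "B0 \<ge> 0" using B0[of 0] by linarith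
        then show "norm (\<beta> (fn n x) * (H x \<bullet> b)) \<le> (B0 * B) * indicat_real (cball 0 R) x"
          using B(3)[of x] B0[of "fn n x"] B(4)[of x]
          by (cases "norm x \<le> R") (auto simp: abs_mult intro: mult_mono)
      qed
      show "integrable lebesgue (\<lambda>x::'a. (B0 * B) * indicat_real (cball 0 R) x)" by (rule integrable_cball_const)
    qed (use m2 m3 mC in auto)
    have l2: "(\<lambda>n. LINT x|lebesgue. (\<eta> x * \<beta>' (fn n x)) * mollify (\<rho> n) (\<lambda>x. F x \<bullet> b) x) \<longlonglongrightarrow> (LINT x|lebesgue. (\<eta> x * \<beta>' (f x)) * (F x \<bullet> b))"
    proof (rule tendsto_LINT_mollify(1)[OF s L1_loc_inner[OF L(2)], where B = "B * B1" and R = R])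
      show "AE x in lebesgue. (\<lambda>n. \<eta> x * \<beta>' (fn n x)) \<longlonglongrightarrow> \<eta> x * \<beta>' (f x)"
        using ae unfolding ae_conv_def
      proof (rule AE_mp, intro AE_I2 impI)
        fix x assume x: "norm x \<le> R \<longrightarrow> (\<lambda>n. mollify (\<rho> n) f x) \<longlonglongrightarrow> f x"
        show "(\<lambda>n. \<eta> x * \<beta>' (fn n x)) \<longlonglongrightarrow> \<eta> x * \<beta>' (f x)"
        proof (cases "norm x \<le> R")
          case True
          have "isCont \<beta>' (f x)" using c by (simp add: continuous_on_eq_continuous_at)
          then have "(\<lambda>n. \<beta>' (fn n x)) \<longlonglongrightarrow> \<beta>' (f x)"
            by (rule isCont_tendsto_compose) (use x True fn_def in simp)
          then show ?thesis by (rule tendsto_mult_left)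
        qed (use z in simp)
      qed
      show "\<bar>\<eta> x * \<beta>' (fn n x)\<bar> \<le> B * B1" for n x
        using B(1,2) B1 by (auto simp: abs_mult intro: mult_mono)
    qed (use m2 m3 mC z in auto)
    show "(LINT x|lebesgue. \<beta> (f x) * (H x \<bullet> b)) + (LINT x|lebesgue. \<eta> x * ((\<beta>' (f x) *\<^sub>R F x) \<bullet> b)) = 0"
      using tendsto_add[OF l1 l2] unfolding eq by (simp add: LIMSEQ_const_iff mult.assoc)
  qed
qed

text \<open>Mollification preserves the bounds on both factors, and this is what lets them multiply
  gradients that are only locally integrable.\<close>

lemma weak_gradient_mult:
  assumes f: "has_weak_gradient f F" and g: "has_weak_gradient g G"
    and fb: "\<And>x. \<bar>f x\<bar> \<le> Bf" and gb: "\<And>x. \<bar>g x\<bar> \<le> Bg"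
  shows "has_weak_gradient (\<lambda>x. f x * g x) (\<lambda>x. f x *\<^sub>R G x + g x *\<^sub>R F x)"
proof -
  have L: "L1_loc f" "L1_loc F" "L1_loc g" "L1_loc G" using f g by (auto simp: has_weak_gradient_def)
  note ms = L[THEN L1_loc_measurable]
  have Bp: "Bf \<ge> 0" "Bg \<ge> 0" using fb[of 0] gb[of 0] by linarith+
  show ?thesis
  proof (rule has_weak_gradientI)
    show "L1_loc (\<lambda>x. f x * g x)" using L1_loc_mult_bounded[OF L(3) ms(1) fb] by simp
    show "L1_loc (\<lambda>x. f x *\<^sub>R G x + g x *\<^sub>R F x)"
      by (rule L1_loc_add[OF L1_loc_mult_bounded[OF L(4) ms(1) fb] L1_loc_mult_bounded[OF L(2) ms(3) gb]])
    fix \<eta> :: "'a \<Rightarrow> real" and H R b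
    assume C: "C1_gradient \<eta> H" and z: "\<And>x. norm x \<ge> R \<Longrightarrow> \<eta> x = 0"
    obtain B where B: "B > 0" "\<And>x. \<bar>\<eta> x\<bar> \<le> B" "\<And>x. \<bar>H x \<bullet> b\<bar> \<le> B" "\<And>x. norm x > R \<Longrightarrow> H x = 0"
      using test_bounds[OF C z] by blast
    note mC = C1_gradient_measurable[OF C]
    obtain \<rho> :: "nat \<Rightarrow> 'a \<Rightarrow> real" and K where s: "mollifier_seq \<rho> K" and ae: "ae_conv R \<rho> f" "ae_conv R \<rho> g"
      using mollifier_seq_ae[OF L(1,3)] by blast
    define fn where "fn n = mollify (\<rho> n) f" for n
    define gn where "gn n = mollify (\<rho> n) g" for n
    have GF: "C1_gradient (fn n) (mollify (\<rho> n) F)" and GG: "C1_gradient (gn n) (mollify (\<rho> n) G)" for n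
      using mollifier_seqD[OF s, of n] mollify_has_gradient[OF _ f] mollify_has_gradient[OF _ g] unfolding fn_def gn_def by blast+
    have m: "fn n \<in> borel_measurable lebesgue" "gn n \<in> borel_measurable lebesgue" for n
      using C1_gradient_measurable[OF GF] C1_gradient_measurable[OF GG] by blast+
    have bb: "\<bar>fn n x\<bar> \<le> Bf" "\<bar>gn n x\<bar> \<le> Bg" for n x
      using mollifier_seqD[OF s, of n] mollify_bounded[OF _ L(1) fb] mollify_bounded[OF _ L(3) gb] unfolding fn_def gn_def by blast+
    have conv: "AE x in lebesgue. norm x \<le> R \<longrightarrow> (\<lambda>n. fn n x) \<longlonglongrightarrow> f x \<and> (\<lambda>n. gn n x) \<longlonglongrightarrow> g x"
      using ae unfolding ae_conv_def fn_def gn_def by eventually_elim auto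
    have eq: "(LINT x|lebesgue. fn n x * gn n x * (H x \<bullet> b)) + ((LINT x|lebesgue. (\<eta> x * fn n x) * mollify (\<rho> n) (\<lambda>x. G x \<bullet> b) x)
       + (LINT x|lebesgue. (\<eta> x * gn n x) * mollify (\<rho> n) (\<lambda>x. F x \<bullet> b) x)) = 0" for n
    proof -
      obtain r where r: "mollifier r (\<rho> n) (K n)" using mollifier_seqD[OF s] by blast
      have i: "integrable lebesgue (\<lambda>x. (\<eta> x * u x) * mollify (\<rho> n) (\<lambda>x. W x \<bullet> b) x)"
        if "C1_gradient u U" "L1_loc W" for u U W
      proof -
        have "integrable lebesgue (\<lambda>x. mollify (\<rho> n) (\<lambda>x. W x \<bullet> b) x *\<^sub>R (\<eta> x * u x))"
          by (rule integrable_mult_compact_support[OF mollify_seq_L1_loc[OF s L1_loc_inner[OF that(2)]], where R = R])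
             (use z C1_gradient_continuous[OF C] C1_gradient_continuous[OF that(1)] in \<open>auto intro: continuous_intros\<close>)
        then show ?thesis by (simp add: mult.commute)
      qed
      show ?thesis
        using C1_gradient_parts[OF C1_gradient_mult[OF GF[of n] GG[of n]] C z, where b = b]
          Bochner_Integration.integral_add[OF i[OF GF L(4)] i[OF GG L(2)]]
        by (simp add: inner_add_left distrib_left mult.assoc mollify_inner[OF r L(2)] mollify_inner[OF r L(4)])
    qed
    have l1: "(\<lambda>n. LINT x|lebesgue. fn n x * gn n x * (H x \<bullet> b)) \<longlonglongrightarrow> (LINT x|lebesgue. f x * g x * (H x \<bullet> b))"
    proof (rule integral_dominated_convergence[where w = "\<lambda>x. (Bf * Bg * B) * indicat_real (cball 0 R) x"])
      show "AE x in lebesgue. (\<lambda>n. fn n x * gn n x * (H x \<bullet> b)) \<longlonglongrightarrow> f x * g x * (H x \<bullet> b)"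
        using conv
      proof (rule AE_mp, intro AE_I2 impI)
        fix x assume x: "norm x \<le> R \<longrightarrow> (\<lambda>n. fn n x) \<longlonglongrightarrow> f x \<and> (\<lambda>n. gn n x) \<longlonglongrightarrow> g x"
        show "(\<lambda>n. fn n x * gn n x * (H x \<bullet> b)) \<longlonglongrightarrow> f x * g x * (H x \<bullet> b)"
          using x B(4)[of x] by (cases "norm x \<le> R") (auto intro!: tendsto_intros)
      qed
      show "AE x in lebesgue. norm (fn n x * gn n x * (H x \<bullet> b)) \<le> (Bf * Bg * B) * indicat_real (cball 0 R) x" for n
      proof (rule AE_I2)
        fix x
        show "norm (fn n x * gn n x * (H x \<bullet> b)) \<le> (Bf * Bg * B) * indicat_real (cball 0 R) x"
          using B(3)[of x] bb[of n x] B(4)[of x] Bp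
          by (cases "norm x \<le> R") (auto simp: abs_mult intro!: mult_mono)
      qed
      show "integrable lebesgue (\<lambda>x::'a. (Bf * Bg * B) * indicat_real (cball 0 R) x)" by (rule integrable_cball_const)
    qed (use ms m mC in auto)
    have l2: "(\<lambda>n. LINT x|lebesgue. (\<eta> x * fn n x) * mollify (\<rho> n) (\<lambda>x. G x \<bullet> b) x) \<longlonglongrightarrow> (LINT x|lebesgue. (\<eta> x * f x) * (G x \<bullet> b))"
    proof (rule tendsto_LINT_mollify(1)[OF s L1_loc_inner[OF L(4)], where B = "B * Bf" and R = R])
      show "AE x in lebesgue. (\<lambda>n. \<eta> x * fn n x) \<longlonglongrightarrow> \<eta> x * f x"
        using conv
      proof (rule AE_mp, intro AE_I2 impI)
        fix x assume x: "norm x \<le> R \<longrightarrow> (\<lambda>n. fn n x) \<longlonglongrightarrow> f x \<and> (\<lambda>n. gn n x) \<longlonglongrightarrow> g x"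
        show "(\<lambda>n. \<eta> x * fn n x) \<longlonglongrightarrow> \<eta> x * f x"
          using x z[of x] by (cases "norm x \<le> R") (auto intro!: tendsto_intros)
      qed
      show "\<bar>\<eta> x * fn n x\<bar> \<le> B * Bf" for n x
        using B(1,2) bb by (auto simp: abs_mult intro: mult_mono)
    qed (use m ms mC z in auto)
    have l3: "(\<lambda>n. LINT x|lebesgue. (\<eta> x * gn n x) * mollify (\<rho> n) (\<lambda>x. F x \<bullet> b) x) \<longlonglongrightarrow> (LINT x|lebesgue. (\<eta> x * g x) * (F x \<bullet> b))"
    proof (rule tendsto_LINT_mollify(1)[OF s L1_loc_inner[OF L(2)], where B = "B * Bg" and R = R])
      show "AE x in lebesgue. (\<lambda>n. \<eta> x * gn n x) \<longlonglongrightarrow> \<eta> x * g x"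
        using conv
      proof (rule AE_mp, intro AE_I2 impI)
        fix x assume x: "norm x \<le> R \<longrightarrow> (\<lambda>n. fn n x) \<longlonglongrightarrow> f x \<and> (\<lambda>n. gn n x) \<longlonglongrightarrow> g x"
        show "(\<lambda>n. \<eta> x * gn n x) \<longlonglongrightarrow> \<eta> x * g x"
          using x z[of x] by (cases "norm x \<le> R") (auto intro!: tendsto_intros)
      qed
      show "\<bar>\<eta> x * gn n x\<bar> \<le> B * Bg" for n x
        using B(1,2) bb by (auto simp: abs_mult intro: mult_mono)
    qed (use m ms mC z in auto)
    have lim: "(LINT x|lebesgue. f x * g x * (H x \<bullet> b)) + ((LINT x|lebesgue. (\<eta> x * f x) * (G x \<bullet> b)) + (LINT x|lebesgue. (\<eta> x * g x) * (F x \<bullet> b))) = 0"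
      using tendsto_add[OF l1 tendsto_add[OF l2 l3]] unfolding eq by (simp add: LIMSEQ_const_iff)
    have j: "integrable lebesgue (\<lambda>x. (\<eta> x * u x) * (W x \<bullet> b))"
      if "u \<in> borel_measurable lebesgue" "\<And>x. \<bar>u x\<bar> \<le> Bu" "L1_loc W" for u Bu W
      by (rule integrable_L1_loc_bound[OF L1_loc_inner[OF that(3), of b], where B = "B * Bu" and R = R])
         (use that B z mC L1_loc_measurable[OF that(3)] in \<open>auto simp: abs_mult intro!: mult_mono mult_right_mono\<close>)
    show "(LINT x|lebesgue. f x * g x * (H x \<bullet> b)) + (LINT x|lebesgue. \<eta> x * ((f x *\<^sub>R G x + g x *\<^sub>R F x) \<bullet> b)) = 0"
      using lim Bochner_Integration.integral_add[OF j[OF ms(1) fb L(4)] j[OF ms(3) gb L(2)]]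
      by (simp add: inner_add_left distrib_left mult.assoc)
  qed
qed

text \<open>Dominated convergence in the weak identity. It removes boundedness restrictions: capped
  functions obey the rules above, and their limits inherit them.\<close>

lemma weak_gradient_limit:
  fixes f :: "'a::euclidean_space \<Rightarrow> real"
  assumes w: "\<And>n. has_weak_gradient (fn n) (Fn n)"
    and lim: "\<And>x. (\<lambda>n. fn n x) \<longlonglongrightarrow> f x" "\<And>x. (\<lambda>n. Fn n x) \<longlonglongrightarrow> F x"
    and dom: "\<And>n x. \<bar>fn n x\<bar> \<le> u x" "\<And>n x. norm (Fn n x) \<le> v x" and L: "L1_loc u" "L1_loc v"
  shows "has_weak_gradient f F"
proof -
  have m: "fn n \<in> borel_measurable lebesgue" "Fn n \<in> borel_measurable lebesgue" for n
    using w[of n] L1_loc_measurable unfolding has_weak_gradient_def by blast+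
  have mf: "f \<in> borel_measurable lebesgue" by (rule borel_measurable_LIMSEQ_metric[OF m(1) lim(1)])
  have mF: "F \<in> borel_measurable lebesgue" by (rule borel_measurable_LIMSEQ_metric[OF m(2) lim(2)])
  have bd: "\<bar>f x\<bar> \<le> u x" "norm (F x) \<le> v x" for x
    using LIMSEQ_le_const2[OF tendsto_rabs[OF lim(1)[of x]]] LIMSEQ_le_const2[OF tendsto_norm[OF lim(2)[of x]]] dom by blast+
  have uv: "u x \<ge> 0" "v x \<ge> 0" for x using bd[of x] abs_ge_zero[of "f x"] norm_ge_zero[of "F x"] by linarith+
  show ?thesis
  proof (rule has_weak_gradientI)
    show "L1_loc f" by (rule L1_loc_bound[OF L(1) mf, where B = 1]) (use bd uv in auto)
    show "L1_loc F" by (rule L1_loc_bound[OF L(2) mF, where B = 1]) (use bd uv in auto)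
    fix \<eta> :: "'a \<Rightarrow> real" and H R b
    assume C: "C1_gradient \<eta> H" and z: "\<And>x. norm x \<ge> R \<Longrightarrow> \<eta> x = 0"
    obtain B where B: "B > 0" "\<And>x. \<bar>\<eta> x\<bar> \<le> B" "\<And>x. \<bar>H x \<bullet> b\<bar> \<le> B" "\<And>x. norm x > R \<Longrightarrow> H x = 0"
      using test_bounds[OF C z] by blast
    note mC = C1_gradient_measurable[OF C]
    have l1: "(\<lambda>n. LINT x|lebesgue. fn n x * (H x \<bullet> b)) \<longlonglongrightarrow> (LINT x|lebesgue. f x * (H x \<bullet> b))"
    proof (rule integral_dominated_convergence[where w = "\<lambda>x. B * (indicat_real (cball 0 R) x *\<^sub>R u x)"])
      show "integrable lebesgue (\<lambda>x. B * (indicat_real (cball 0 R) x *\<^sub>R u x))"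
        by (intro integrable_mult_right L1_loc_integrable_cball L)
      show "AE x in lebesgue. norm (fn n x * (H x \<bullet> b)) \<le> B * (indicat_real (cball 0 R) x *\<^sub>R u x)" for n
      proof (rule AE_I2)
        fix x
        have "\<bar>fn n x\<bar> * \<bar>H x \<bullet> b\<bar> \<le> u x * B" by (intro mult_mono dom B uv) auto
        then show "norm (fn n x * (H x \<bullet> b)) \<le> B * (indicat_real (cball 0 R) x *\<^sub>R u x)"
          using B(4)[of x] by (cases "norm x \<le> R") (auto simp: abs_mult mult.commute)
      qed
      show "AE x in lebesgue. (\<lambda>n. fn n x * (H x \<bullet> b)) \<longlonglongrightarrow> f x * (H x \<bullet> b)"
        by (intro AE_I2 tendsto_mult_right lim)
    qed (use m mf mC in auto)
    have l2: "(\<lambda>n. LINT x|lebesgue. \<eta> x * (Fn n x \<bullet> b)) \<longlonglongrightarrow> (LINT x|lebesgue. \<eta> x * (F x \<bullet> b))"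
    proof (rule integral_dominated_convergence[where w = "\<lambda>x. (B * norm b) * (indicat_real (cball 0 R) x *\<^sub>R v x)"])
      show "integrable lebesgue (\<lambda>x. (B * norm b) * (indicat_real (cball 0 R) x *\<^sub>R v x))"
        by (intro integrable_mult_right L1_loc_integrable_cball L)
      show "AE x in lebesgue. norm (\<eta> x * (Fn n x \<bullet> b)) \<le> (B * norm b) * (indicat_real (cball 0 R) x *\<^sub>R v x)" for n
      proof (rule AE_I2)
        fix x
        have "\<bar>Fn n x \<bullet> b\<bar> \<le> v x * norm b"
          by (rule order_trans[OF Cauchy_Schwarz_ineq2 mult_right_mono[OF dom(2)]]) simp
        then have "\<bar>\<eta> x\<bar> * \<bar>Fn n x \<bullet> b\<bar> \<le> B * (v x * norm b)" using B uv by (intro mult_mono) auto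
        then show "norm (\<eta> x * (Fn n x \<bullet> b)) \<le> (B * norm b) * (indicat_real (cball 0 R) x *\<^sub>R v x)"
          using z[of x] by (cases "norm x \<le> R") (auto simp: abs_mult mult_ac)
      qed
      show "AE x in lebesgue. (\<lambda>n. \<eta> x * (Fn n x \<bullet> b)) \<longlonglongrightarrow> \<eta> x * (F x \<bullet> b)"
        by (intro AE_I2 tendsto_intros lim)
    qed (use m mF mC in auto)
    have "(LINT x|lebesgue. fn n x * (H x \<bullet> b)) + (LINT x|lebesgue. \<eta> x * (Fn n x \<bullet> b)) = 0" for n
      using weak_gradient_parts[OF w C z, where b = b] by simp
    then show "(LINT x|lebesgue. f x * (H x \<bullet> b)) + (LINT x|lebesgue. \<eta> x * (F x \<bullet> b)) = 0"
      using tendsto_add[OF l1 l2] by (simp add: LIMSEQ_const_iff)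
  qed
qed

text \<open>Both candidates have the same mollifications, since these depend on \<open>f\<close>
  alone, and along a common subsequence the mollifications converge to each of them almost
  everywhere.\<close>

lemma weak_gradient_unique:
  fixes f :: "'a::euclidean_space \<Rightarrow> real"
  assumes F: "has_weak_gradient f F" and F': "has_weak_gradient f F'"
  shows "AE x in lebesgue. F x = F' x"
proof -
  have L: "L1_loc F" "L1_loc F'" using F F' by (auto simp: has_weak_gradient_def)
  have "AE x in lebesgue. norm x \<le> real R \<longrightarrow> F x = F' x" for R :: nat
  proof -
    obtain \<rho> :: "nat \<Rightarrow> 'a \<Rightarrow> real" and K where s: "mollifier_seq \<rho> K" and ae: "ae_conv (real R) \<rho> F" "ae_conv (real R) \<rho> F'"
      using mollifier_seq_ae[OF L] by blast
    have eq: "mollify (\<rho> n) F x = mollify (\<rho> n) F' x" for n x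
    proof -
      obtain r where r: "mollifier r (\<rho> n) (K n)" using mollifier_seqD[OF s] by blast
      show ?thesis using mollify_weak_gradient[OF r F, of x] mollify_weak_gradient[OF r F', of x] by simp
    qed
    from ae show ?thesis unfolding ae_conv_def eq
      by eventually_elim (auto intro: LIMSEQ_unique)
  qed
  then have "AE x in lebesgue. \<forall>R::nat. norm x \<le> real R \<longrightarrow> F x = F' x"
    unfolding AE_all_countable by blast
  then show ?thesis by eventually_elim (use real_arch_simple in blast)
qed

section \<open>Cutoff functions with uniformly bounded gradients\<close>

lemma smooth_cutoff:
  "\<exists>L. \<forall>R. \<exists>(\<kappa>::'a::euclidean_space \<Rightarrow> real) K. C1_gradient \<kappa> K \<and> (\<forall>x. 0 \<le> \<kappa> x \<and> \<kappa> x \<le> 1) \<and>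
    (\<forall>x. norm x \<le> R \<longrightarrow> \<kappa> x = 1 \<and> K x = 0) \<and> (\<forall>x. norm x \<ge> R + 3 \<longrightarrow> \<kappa> x = 0 \<and> K x = 0) \<and> (\<forall>x. norm (K x) \<le> L)"
proof -
  obtain \<rho> :: "'a \<Rightarrow> real" and K where m: "mollifier 1 \<rho> K" using mollifier_exists[of 1] by auto
  have iK: "integrable lborel K"
  proof -
    obtain B where B: "\<And>x. norm (K x) \<le> B" using bounded_of_compact_support[OF mollifierD(8,9)[OF m]] by blast
    have "integrable lborel (\<lambda>x. B * indicat_real (cball (0::'a) 1) x)"
      using emeasure_lborel_cball_finite[of "0::'a" 1] by (intro integrable_mult_right integrable_real_indicator) simp_all
    then show ?thesis
    proof (rule Bochner_Integration.integrable_bound)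
      show "AE x in lborel. norm (K x) \<le> norm (B * indicat_real (cball 0 1) x)"
        by (rule AE_I2) (use mollifierD(9)[OF m] B in \<open>auto simp: indicator_def not_le intro: order_trans[OF _ abs_ge_self]\<close>)
    qed (use C1_gradient_measurable[OF mollifierD(2)[OF m]] in simp)
  qed
  \<comment> \<open>A kernel of fixed radius 1 serves all \<open>R\<close>; the gradient of a
    mollified indicator is at most the L1 norm of the kernel's gradient, independently of
    \<open>R\<close>.\<close>
  define L where "L = (LINT y|lborel. norm (K y))"
  have L0: "L \<ge> 0" unfolding L_def by (rule integral_nonneg_AE) simp
  have "\<exists>(\<kappa>::'a \<Rightarrow> real) K. C1_gradient \<kappa> K \<and> (\<forall>x. 0 \<le> \<kappa> x \<and> \<kappa> x \<le> 1) \<and>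
    (\<forall>x. norm x \<le> R \<longrightarrow> \<kappa> x = 1 \<and> K x = 0) \<and> (\<forall>x. norm x \<ge> R + 3 \<longrightarrow> \<kappa> x = 0 \<and> K x = 0) \<and> (\<forall>x. norm (K x) \<le> L)" for R
  proof -
    \<comment> \<open>With kernel radius 1 the mollification is 1 below \<open>R + 0.5\<close> and 0
      beyond \<open>R + 2.5\<close>. The margins provide open sets on which it is constant, so that
      its gradient vanishes too.\<close>
    define f :: "'a \<Rightarrow> real" where "f = indicat_real (cball 0 (R + 1.5))"
    have fm: "f \<in> borel_measurable lebesgue" unfolding f_def by (intro borel_measurable_indicator) auto
    have fL: "L1_loc f" by (rule L1_loc_real_bounded[OF fm, of 1]) (auto simp: f_def indicator_def)
    define K' where "K' x = (LINT y|lebesgue. f y *\<^sub>R K (x - y))" for x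
    have C: "C1_gradient (mollify \<rho> f) K'"
      unfolding K'_def using mollify_C1[OF fL mollifierD(2,4)[OF m]] by simp
    have one: "mollify \<rho> f x = 1" if "norm x < R + 0.5" for x
    proof -
      have eq: "\<rho> (x - y) *\<^sub>R f y = \<rho> (x - y)" for y
      proof (cases "norm (x - y) \<ge> 1")
        case False
        then have "norm y \<le> R + 1.5" using that norm_triangle_ineq2[of y x] by (simp add: norm_minus_commute)
        then show ?thesis by (simp add: f_def)
      qed (use mollifierD(4)[OF m] in simp)
      show ?thesis unfolding mollify_def eq by (rule mollifier_nn_integral(4)[OF m])
    qed
    have zero: "mollify \<rho> f x = 0" if "norm x > R + 2.5" for x
    proof -
      have eq: "\<rho> (x - y) *\<^sub>R f y = 0" for y
      proof (cases "norm (x - y) \<ge> 1")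
        case False
        then have "norm y > R + 1.5" using that norm_triangle_ineq2[of x y] by simp
        then show ?thesis by (simp add: f_def)
      qed (use mollifierD(4)[OF m] in simp)
      show ?thesis unfolding mollify_def eq by simp
    qed
    have K1: "K' x = 0" if "norm x < R + 0.5" for x
      by (rule C1_gradient_zero[OF C, of "{x. norm x < R + 0.5}" 1])
         (use that one in \<open>auto intro!: open_Collect_less continuous_intros\<close>)
    have K0: "K' x = 0" if "norm x > R + 2.5" for x
      by (rule C1_gradient_zero[OF C, of "{x. norm x > R + 2.5}" 0])
         (use that zero in \<open>auto intro!: open_Collect_less continuous_intros\<close>)
    have b: "0 \<le> mollify \<rho> f x \<and> mollify \<rho> f x \<le> 1" for x
    proof
      show "0 \<le> mollify \<rho> f x" unfolding mollify_def
        by (rule integral_nonneg_AE) (use mollifierD(3)[OF m] in \<open>auto simp: f_def indicator_def\<close>)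
      show "mollify \<rho> f x \<le> 1"
        using mollify_bounded[OF m fL, of 1 x] by (auto simp: f_def indicator_def abs_le_iff)
    qed
    have KL: "norm (K' x) \<le> L" for x
    proof -
      have mK: "(\<lambda>y. ennreal (norm (K y))) \<in> borel_measurable borel"
        using C1_gradient_measurable(2)[OF mollifierD(2)[OF m]] by measurable
      have "ennreal (norm (K' x)) \<le> (\<integral>\<^sup>+y. ennreal (norm (f y *\<^sub>R K (x - y))) \<partial>lebesgue)"
        unfolding K'_def
        by (intro integral_norm_bound_ennreal mollify_grad_integrable[OF fL mollifierD(8,9)[OF m]])
      also have "\<dots> \<le> (\<integral>\<^sup>+y. ennreal (norm (K (x - y))) \<partial>lebesgue)"
        by (intro nn_integral_mono) (auto simp: f_def indicator_def)
      also have "\<dots> = (\<integral>\<^sup>+y. ennreal (norm (K y)) \<partial>lborel)"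
        unfolding nn_integral_completion using nn_integral_reflect[OF mK, of x] .
      also have "\<dots> = ennreal L" unfolding L_def
        by (rule nn_integral_eq_integral) (use iK in auto)
      finally show ?thesis using L0 by (simp add: ennreal_le_iff)
    qed
    show ?thesis
      by (rule exI[of _ "mollify \<rho> f"], rule exI[of _ K']) (use C b one zero K0 K1 KL in auto)
  qed
  then show ?thesis by blast
qed

text \<open>Shifts the support condition from the test function to \<open>f\<close>, by means of a
  cutoff that is 1 wherever \<open>f\<close> or \<open>F\<close> is nonzero.\<close>

lemma weak_gradient_parts_compact:
  fixes f :: "'a::euclidean_space \<Rightarrow> real"
  assumes w: "has_weak_gradient f F" and C: "C1_gradient \<psi> \<Psi>" and z: "\<And>x. norm x > R \<Longrightarrow> f x = 0 \<and> F x = 0"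
  shows "(LINT x|lebesgue. f x * (\<Psi> x \<bullet> b)) = - (LINT x|lebesgue. \<psi> x * (F x \<bullet> b))"
proof -
  obtain \<kappa> :: "'a \<Rightarrow> real" and K where k: "C1_gradient \<kappa> K"
    "\<And>x. norm x \<le> R \<Longrightarrow> \<kappa> x = 1 \<and> K x = 0" "\<And>x. norm x \<ge> R + 3 \<Longrightarrow> \<kappa> x = 0"
    using smooth_cutoff by metis
  have "(LINT x|lebesgue. f x * ((\<kappa> x *\<^sub>R \<Psi> x + \<psi> x *\<^sub>R K x) \<bullet> b)) = - (LINT x|lebesgue. \<kappa> x * \<psi> x * (F x \<bullet> b))"
    by (rule weak_gradient_parts[OF w C1_gradient_mult[OF k(1) C], where R = "R + 3"]) (use k(3) in simp)
  moreover have "f x * ((\<kappa> x *\<^sub>R \<Psi> x + \<psi> x *\<^sub>R K x) \<bullet> b) = f x * (\<Psi> x \<bullet> b)" for x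
    using z[of x] k(2)[of x] by (cases "norm x \<le> R") auto
  moreover have "\<kappa> x * \<psi> x * (F x \<bullet> b) = \<psi> x * (F x \<bullet> b)" for x
    using z[of x] k(2)[of x] by (cases "norm x \<le> R") auto
  ultimately show ?thesis by simp
qed

text \<open>Majorants may vary with \<open>n\<close> provided they converge in L1. Clamping
  \<open>u n\<close> between \<open>- w'\<close> and \<open>w'\<close> yields a fixed majorant, and
  what the clamp removes is at most \<open>\<bar>w n x - w' x\<bar>\<close>. It is needed because
  the majorants below are mollifications.\<close>

lemma generalized_dominated_convergence:
  fixes u :: "nat \<Rightarrow> 'a \<Rightarrow> real"
  assumes um: "\<And>n. u n \<in> borel_measurable M" and u'm: "u' \<in> borel_measurable M"
    and wi: "\<And>n. integrable M (w n)" and w'i: "integrable M w'"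
    and lim: "AE x in M. (\<lambda>n. u n x) \<longlonglongrightarrow> u' x"
    and dom: "\<And>n. AE x in M. \<bar>u n x\<bar> \<le> w n x" and dom': "AE x in M. \<bar>u' x\<bar> \<le> w' x"
    and L1: "(\<lambda>n. LINT x|M. \<bar>w n x - w' x\<bar>) \<longlonglongrightarrow> 0"
  shows "(\<lambda>n. LINT x|M. u n x) \<longlonglongrightarrow> (LINT x|M. u' x)"
proof -
  define v where "v n x = max (- w' x) (min (w' x) (u n x))" for n x
  have vm: "v n \<in> borel_measurable M" for n
    unfolding v_def using um w'i[THEN borel_measurable_integrable] by measurable
  have vw: "AE x in M. \<bar>v n x\<bar> \<le> w' x" for n
    using dom' by eventually_elim (auto simp: v_def)
  have vi: "integrable M (v n)" for n
    by (rule Bochner_Integration.integrable_bound[OF w'i vm], use vw[of n] in eventually_elim) auto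
  have ui: "integrable M (u n)" for n
    by (rule Bochner_Integration.integrable_bound[OF wi[of n] um], use dom[of n] in eventually_elim) auto
  have 1: "(\<lambda>n. LINT x|M. v n x) \<longlonglongrightarrow> (LINT x|M. u' x)"
  proof (rule integral_dominated_convergence[OF u'm vm w'i])
    show "AE x in M. (\<lambda>n. v n x) \<longlonglongrightarrow> u' x"
      using lim dom'
    proof eventually_elim
      case (elim x)
      have "(\<lambda>n. max (- w' x) (min (w' x) (u n x))) \<longlonglongrightarrow> max (- w' x) (min (w' x) (u' x))"
        by (intro tendsto_max tendsto_min tendsto_const elim)
      moreover have "max (- w' x) (min (w' x) (u' x)) = u' x" using elim(2) by auto
      ultimately show ?case by (simp add: v_def)
    qed
    show "AE x in M. norm (v n x) \<le> w' x" for n using vw by simp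
  qed
  have 2: "(\<lambda>n. LINT x|M. u n x - v n x) \<longlonglongrightarrow> 0"
  proof (rule Lim_null_comparison[OF always_eventually L1], rule allI)
    fix n
    have "norm (LINT x|M. u n x - v n x) \<le> (LINT x|M. norm (u n x - v n x))" by (rule integral_norm_bound)
    also have "\<dots> \<le> (LINT x|M. \<bar>w n x - w' x\<bar>)"
    proof (rule integral_mono_AE)
      show "AE x in M. norm (u n x - v n x) \<le> \<bar>w n x - w' x\<bar>"
        using dom[of n] dom' by eventually_elim (auto simp: v_def max_def min_def)
    qed (use ui vi wi w'i in auto)
    finally show "norm (LINT x|M. u n x - v n x) \<le> (LINT x|M. \<bar>w n x - w' x\<bar>)" .
  qed
  show ?thesis using tendsto_add[OF 2 1] ui vi by simp
qed

text \<open>Recovers a Cauchy-Schwarz bound from its linear version with a free parameter, the form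
  that survives integration against a kernel. Both \<open>b\<close> and \<open>c\<close> may vanish,
  hence the perturbation by \<open>e\<close>.\<close>

lemma square_bound_of_parametric:
  fixes a b c :: real
  assumes "a \<ge> 0" "b \<ge> 0" "c \<ge> 0" and *: "\<And>t. t > 0 \<Longrightarrow> a \<le> t * b + c / t"
  shows "a\<^sup>2 \<le> 4 * b * c"
proof -
  have "(a / 2)\<^sup>2 \<le> (b + e) * (c + e)" if e: "e > 0" for e
  proof -
    \<comment> \<open>The minimiser of the perturbed right-hand side, for which the two summands are
      equal.\<close>
    define t where "t = sqrt ((c + e) / (b + e))"
    have p: "b + e > 0" "c + e > 0" using assms e by linarith+
    then have t: "t > 0" by (simp add: t_def)
    have sq: "sqrt (q / p) * p = sqrt (p * q)" "q / sqrt (q / p) = sqrt (p * q)" if "p > 0" "q > 0" for p q :: real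
    proof -
      have "sqrt (q / p) * p = sqrt q * (p / sqrt p)" "q / sqrt (q / p) = sqrt p * (q / sqrt q)"
        by (simp_all add: real_sqrt_divide)
      then show "sqrt (q / p) * p = sqrt (p * q)" "q / sqrt (q / p) = sqrt (p * q)"
        using that by (simp_all add: real_div_sqrt real_sqrt_mult)
    qed
    have "a \<le> t * b + c / t" by (rule *[OF t])
    also have "\<dots> \<le> t * (b + e) + (c + e) / t" using t e by (intro add_mono mult_left_mono divide_right_mono) auto
    also have "t * (b + e) = sqrt ((b + e) * (c + e))"
      unfolding t_def by (rule sq(1)[OF p])
    also have "(c + e) / t = sqrt ((b + e) * (c + e))"
      unfolding t_def by (rule sq(2)[OF p])
    finally have "a / 2 \<le> sqrt ((b + e) * (c + e))" by simp
    then have "(a / 2)\<^sup>2 \<le> (sqrt ((b + e) * (c + e)))\<^sup>2" using assms(1) by (intro power_mono) auto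
    then show ?thesis using p by simp
  qed
  then have "\<forall>\<^sub>F e in at_right 0. (a / 2)\<^sup>2 \<le> (b + e) * (c + e)" by (auto simp: eventually_at_filter)
  moreover have "((\<lambda>e. (b + e) * (c + e)) \<longlongrightarrow> (b + 0) * (c + 0)) (at_right 0)" by (intro tendsto_intros)
  ultimately have "(a / 2)\<^sup>2 \<le> (b + 0) * (c + 0)"
    by (intro tendsto_lowerbound[where F = "at_right (0::real)"]) auto
  then show ?thesis by (simp add: power_divide field_simps)
qed

section \<open>Damping and gating functions\<close>

lemma integrable_mult_continuous_compact:
  fixes e c :: "'a::euclidean_space \<Rightarrow> real"
  assumes "L1_loc e" "\<And>x. norm x > R \<Longrightarrow> e x = 0" "continuous_on UNIV c"
  shows "integrable lebesgue (\<lambda>x. e x * c x)"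
proof -
  obtain \<kappa> :: "'a \<Rightarrow> real" and K where k: "C1_gradient \<kappa> K"
    "\<And>x. norm x \<le> R \<Longrightarrow> \<kappa> x = 1" "\<And>x. norm x \<ge> R + 3 \<Longrightarrow> \<kappa> x = 0"
    using smooth_cutoff by metis
  have "integrable lebesgue (\<lambda>x. e x *\<^sub>R (\<kappa> x * c x))"
    by (rule integrable_mult_compact_support[OF assms(1), where R = "R + 3"])
       (use assms(3) k(3) C1_gradient_continuous(1)[OF k(1)] in \<open>auto intro!: continuous_intros\<close>)
  also have "(\<lambda>x. e x *\<^sub>R (\<kappa> x * c x)) = (\<lambda>x. e x * c x)"
  proof
    fix x show "e x *\<^sub>R (\<kappa> x * c x) = e x * c x"
      using assms(2)[of x] k(2)[of x] by (cases "norm x \<le> R") auto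
  qed
  finally show ?thesis .
qed

text \<open>\<open>damp\<close> suppresses large values of its argument, \<open>gate\<close> is
  small near 0 and close to 1 elsewhere, \<open>sqcap\<close> is a bounded substitute for the
  square; the primed functions are their derivatives. As \<epsilon> tends to 0 they tend to 1, to 1
  off 0, and to the square.\<close>

definition damp :: "real \<Rightarrow> real \<Rightarrow> real" where "damp \<epsilon> t = 1 / (1 + \<epsilon> * t\<^sup>2)"
definition damp' :: "real \<Rightarrow> real \<Rightarrow> real" where "damp' \<epsilon> t = - 2 * \<epsilon> * t / (1 + \<epsilon> * t\<^sup>2)\<^sup>2"
definition gate :: "real \<Rightarrow> real \<Rightarrow> real" where "gate \<epsilon> t = t\<^sup>2 / (t\<^sup>2 + \<epsilon>)"
definition gate' :: "real \<Rightarrow> real \<Rightarrow> real" where "gate' \<epsilon> t = 2 * \<epsilon> * t / (t\<^sup>2 + \<epsilon>)\<^sup>2"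
definition sqcap :: "real \<Rightarrow> real \<Rightarrow> real" where "sqcap \<epsilon> t = t\<^sup>2 / (1 + \<epsilon> * t\<^sup>2)"
definition sqcap' :: "real \<Rightarrow> real \<Rightarrow> real" where "sqcap' \<epsilon> t = 2 * t / (1 + \<epsilon> * t\<^sup>2)\<^sup>2"

lemma two_abs_le: "2 * \<bar>t\<bar> \<le> 1 + t\<^sup>2" for t :: real
  using zero_le_power2[of "\<bar>t\<bar> - 1"] by (simp add: power2_diff)

lemma two_abs_le_eps: "2 * \<bar>t\<bar> \<le> (1 + 1/\<epsilon>) * (1 + \<epsilon> * t\<^sup>2)" "2 * \<bar>t\<bar> \<le> (1 + 1/\<epsilon>) * (t\<^sup>2 + \<epsilon>)" if "\<epsilon> > 0" for t :: real
proof -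
  have "(1 + 1/\<epsilon>) * (1 + \<epsilon> * t\<^sup>2) = (1 + t\<^sup>2) + (\<epsilon> * t\<^sup>2 + 1/\<epsilon>)" "(1 + 1/\<epsilon>) * (t\<^sup>2 + \<epsilon>) = (1 + t\<^sup>2) + (\<epsilon> + t\<^sup>2/\<epsilon>)"
    using that by (simp_all add: field_simps)
  moreover have "\<epsilon> * t\<^sup>2 + 1/\<epsilon> \<ge> 0" "\<epsilon> + t\<^sup>2/\<epsilon> \<ge> 0" using that by simp_all
  ultimately show "2 * \<bar>t\<bar> \<le> (1 + 1/\<epsilon>) * (1 + \<epsilon> * t\<^sup>2)" "2 * \<bar>t\<bar> \<le> (1 + 1/\<epsilon>) * (t\<^sup>2 + \<epsilon>)"
    using two_abs_le[of t] by linarith+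
qed

lemma damp_den: "1 + \<epsilon> * t\<^sup>2 \<ge> 1" "1 + \<epsilon> * t\<^sup>2 > 0" "1 + \<epsilon> * t\<^sup>2 \<noteq> 0" if "\<epsilon> > 0" for t :: real
proof -
  show "1 + \<epsilon> * t\<^sup>2 \<ge> 1" using that by simp
  then show "1 + \<epsilon> * t\<^sup>2 > 0" "1 + \<epsilon> * t\<^sup>2 \<noteq> 0" by linarith+
qed

lemma gate_den: "t\<^sup>2 + \<epsilon> > 0" "t\<^sup>2 + \<epsilon> \<noteq> 0" if "\<epsilon> > 0" for t :: real
proof -
  show "t\<^sup>2 + \<epsilon> > 0" using that by (simp add: add_nonneg_pos)
  then show "t\<^sup>2 + \<epsilon> \<noteq> 0" by linarith
qed

lemma damp_deriv: "\<epsilon> > 0 \<Longrightarrow> (damp \<epsilon> has_real_derivative damp' \<epsilon> t) (at t)"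
  unfolding damp_def[abs_def] damp'_def using damp_den[of \<epsilon> t]
  by (auto intro!: derivative_eq_intros simp: power2_eq_square)

lemma gate_deriv: "\<epsilon> > 0 \<Longrightarrow> (gate \<epsilon> has_real_derivative gate' \<epsilon> t) (at t)"
  unfolding gate_def[abs_def] gate'_def using gate_den[of \<epsilon> t]
  by (auto intro!: derivative_eq_intros simp: power2_eq_square algebra_simps)

lemma sqcap_deriv: "\<epsilon> > 0 \<Longrightarrow> (sqcap \<epsilon> has_real_derivative sqcap' \<epsilon> t) (at t)"
  unfolding sqcap_def[abs_def] sqcap'_def using damp_den[of \<epsilon> t]
  by (auto intro!: derivative_eq_intros simp: power2_eq_square algebra_simps)

lemma deriv_continuous:
  assumes "\<epsilon> > 0"
  shows "continuous_on UNIV (damp \<epsilon>)" "continuous_on UNIV (damp' \<epsilon>)" "continuous_on UNIV (gate' \<epsilon>)" "continuous_on UNIV (sqcap' \<epsilon>)"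
  unfolding damp_def[abs_def] damp'_def[abs_def] gate'_def[abs_def] sqcap'_def[abs_def]
  using damp_den[OF assms] gate_den[OF assms] by (auto intro!: continuous_intros)

text \<open>The first two bounds degenerate with \<epsilon> and serve to apply the chain rule; the
  last two are uniform and supply the majorants as \<epsilon> tends to 0.\<close>

lemma sqcap_bounds:
  assumes "\<epsilon> > 0"
  shows "\<bar>sqcap \<epsilon> t\<bar> \<le> 1 / \<epsilon>" "\<bar>sqcap' \<epsilon> t\<bar> \<le> 1 + 1/\<epsilon>" "\<bar>sqcap \<epsilon> t\<bar> \<le> t\<^sup>2" "\<bar>sqcap' \<epsilon> t\<bar> \<le> 2 * \<bar>t\<bar>"
proof -
  note d = damp_den[OF assms, of t]
  show "\<bar>sqcap \<epsilon> t\<bar> \<le> 1 / \<epsilon>" using d assms by (simp add: sqcap_def abs_mult field_simps)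
  have t2: "t\<^sup>2 * 1 \<le> t\<^sup>2 * (1 + \<epsilon> * t\<^sup>2)" using d by (intro mult_left_mono) auto
  then show "\<bar>sqcap \<epsilon> t\<bar> \<le> t\<^sup>2" using d by (simp add: sqcap_def divide_le_eq)
  have sq: "1 + \<epsilon> * t\<^sup>2 \<le> (1 + \<epsilon> * t\<^sup>2)\<^sup>2" using d by (simp add: power2_eq_square)
  have "(1 + 1/\<epsilon>) * (1 + \<epsilon> * t\<^sup>2) \<le> (1 + 1/\<epsilon>) * (1 + \<epsilon> * t\<^sup>2)\<^sup>2" using sq assms by (intro mult_left_mono) auto
  then show "\<bar>sqcap' \<epsilon> t\<bar> \<le> 1 + 1/\<epsilon>"
    using two_abs_le_eps(1)[OF assms, of t] d by (simp add: sqcap'_def abs_mult divide_le_eq)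
  have "2 * \<bar>t\<bar> * 1 \<le> 2 * \<bar>t\<bar> * (1 + \<epsilon> * t\<^sup>2)\<^sup>2" using sq d by (intro mult_left_mono) auto
  then show "\<bar>sqcap' \<epsilon> t\<bar> \<le> 2 * \<bar>t\<bar>" using d by (simp add: sqcap'_def abs_mult divide_le_eq)
qed

text \<open>The third bound lends a factor \<open>s\<close> to \<open>gate \<epsilon> (s x)\<close>,
  so that a gradient square integrable against \<open>s\<^sup>2\<close> becomes square integrable.
  The fourth, uniform in \<epsilon>, dominates the term in which the gate is differentiated.\<close>

lemma gate_bounds:
  assumes "\<epsilon> > 0"
  shows "\<bar>gate \<epsilon> t\<bar> \<le> 1" "\<bar>gate' \<epsilon> t\<bar> \<le> 1 + 1/\<epsilon>" "\<bar>gate \<epsilon> t\<bar> \<le> (1 + 1/\<epsilon>) * \<bar>t\<bar>" "\<bar>gate' \<epsilon> t * t\<bar> \<le> 2"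
proof -
  note d = gate_den[OF assms, of t]
  show "\<bar>gate \<epsilon> t\<bar> \<le> 1" using d assms by (simp add: gate_def)
  have b: "2 * \<bar>t\<bar> / (t\<^sup>2 + \<epsilon>) \<le> 1 + 1/\<epsilon>" using two_abs_le_eps(2)[OF assms, of t] d by (simp add: divide_le_eq)
  have e: "0 \<le> \<epsilon> / (t\<^sup>2 + \<epsilon>)" "\<epsilon> / (t\<^sup>2 + \<epsilon>) \<le> 1" using d assms by simp_all
  have "\<bar>gate' \<epsilon> t\<bar> = (2 * \<bar>t\<bar> / (t\<^sup>2 + \<epsilon>)) * (\<epsilon> / (t\<^sup>2 + \<epsilon>))"
    using d assms by (simp add: gate'_def abs_mult power2_eq_square)
  also have "\<dots> \<le> (1 + 1/\<epsilon>) * 1" using b e assms by (intro mult_mono) auto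
  finally show "\<bar>gate' \<epsilon> t\<bar> \<le> 1 + 1/\<epsilon>" by simp
  have "\<bar>gate \<epsilon> t\<bar> = (2 * \<bar>t\<bar> / (t\<^sup>2 + \<epsilon>)) * (\<bar>t\<bar> / 2)"
    using d assms by (simp add: gate_def abs_of_nonneg) (simp add: power2_eq_square field_simps)
  also have "\<dots> \<le> (1 + 1/\<epsilon>) * \<bar>t\<bar>" using b assms by (intro mult_mono) auto
  finally show "\<bar>gate \<epsilon> t\<bar> \<le> (1 + 1/\<epsilon>) * \<bar>t\<bar>" .
  have "\<bar>gate' \<epsilon> t * t\<bar> = 2 * (t\<^sup>2 / (t\<^sup>2 + \<epsilon>)) * (\<epsilon> / (t\<^sup>2 + \<epsilon>))"
    using d assms by (simp add: gate'_def abs_mult power2_eq_square)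
  also have "\<dots> \<le> 2 * 1 * 1" using e d assms by (intro mult_mono) auto
  finally show "\<bar>gate' \<epsilon> t * t\<bar> \<le> 2" by simp
qed

text \<open>Read with \<open>t\<close> the mollified density and the squared length of its gradient
  at most \<open>4 * t * y\<close>: the second bound controls \<open>damp'\<close> times that square
  by \<open>8 * y\<close> uniformly in \<epsilon>, the third controls \<open>damp\<close> times the
  gradient by a multiple of the root of \<open>y\<close> at fixed \<epsilon>.\<close>

lemma damp_bounds:
  assumes "\<epsilon> > 0"
  shows "\<bar>damp \<epsilon> t\<bar> \<le> 1" "\<bar>damp' \<epsilon> t * t\<bar> \<le> 2" "t \<ge> 0 \<Longrightarrow> (damp \<epsilon> t)\<^sup>2 * t \<le> 1 + 1/\<epsilon>"
proof -
  note d = damp_den[OF assms, of t]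
  show d1: "\<bar>damp \<epsilon> t\<bar> \<le> 1" using d by (simp add: damp_def)
  have "\<bar>damp' \<epsilon> t * t\<bar> = 2 * (\<epsilon> * t\<^sup>2 / (1 + \<epsilon> * t\<^sup>2)) * (1 / (1 + \<epsilon> * t\<^sup>2))"
    using d assms by (simp add: damp'_def abs_mult power2_eq_square)
  also have "\<dots> \<le> 2 * 1 * 1" using d assms by (intro mult_mono) auto
  finally show "\<bar>damp' \<epsilon> t * t\<bar> \<le> 2" by simp
  assume t: "t \<ge> 0"
  have "(damp \<epsilon> t)\<^sup>2 * t = damp \<epsilon> t * (t / (1 + \<epsilon> * t\<^sup>2))" by (simp add: damp_def power2_eq_square)
  also have "\<dots> \<le> 1 * (1 + 1/\<epsilon>)"
  proof (rule mult_mono)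
    show "damp \<epsilon> t \<le> 1" using d1 by linarith
    show "t / (1 + \<epsilon> * t\<^sup>2) \<le> 1 + 1/\<epsilon>" using two_abs_le_eps(1)[OF assms, of t] t d by (simp add: divide_le_eq)
    show "0 \<le> t / (1 + \<epsilon> * t\<^sup>2)" using t d by simp
  qed simp
  finally show "(damp \<epsilon> t)\<^sup>2 * t \<le> 1 + 1/\<epsilon>" by simp
qed

lemma small_tendsto:
  assumes e: "e \<longlonglongrightarrow> 0" "\<And>n. e n > 0"
  shows "(\<lambda>n. damp (e n) t) \<longlonglongrightarrow> 1" "(\<lambda>n. damp' (e n) t) \<longlonglongrightarrow> 0"
    "t \<noteq> 0 \<Longrightarrow> (\<lambda>n. gate (e n) t) \<longlonglongrightarrow> 1" "(\<lambda>n. gate' (e n) t * t) \<longlonglongrightarrow> 0"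
    "(\<lambda>n. sqcap (e n) t) \<longlonglongrightarrow> t\<^sup>2" "(\<lambda>n. sqcap' (e n) t) \<longlonglongrightarrow> 2 * t"
proof -
  show "(\<lambda>n. damp (e n) t) \<longlonglongrightarrow> 1" "(\<lambda>n. damp' (e n) t) \<longlonglongrightarrow> 0"
    "(\<lambda>n. sqcap (e n) t) \<longlonglongrightarrow> t\<^sup>2" "(\<lambda>n. sqcap' (e n) t) \<longlonglongrightarrow> 2 * t"
    unfolding damp_def damp'_def sqcap_def sqcap'_def
    by (rule tendsto_eq_rhs, (rule tendsto_intros e)+, use e in simp_all)+
  show "(\<lambda>n. gate (e n) t) \<longlonglongrightarrow> 1" if t: "t \<noteq> 0"
  proof -
    have "(\<lambda>n. t\<^sup>2 / (t\<^sup>2 + e n)) \<longlonglongrightarrow> t\<^sup>2 / (t\<^sup>2 + 0)"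
      by (intro tendsto_divide tendsto_add tendsto_const e) (use t in simp)
    then show ?thesis using t by (simp add: gate_def)
  qed
  show "(\<lambda>n. gate' (e n) t * t) \<longlonglongrightarrow> 0"
  proof (cases "t = 0")
    case False
    have "(\<lambda>n. 2 * e n * t / (t\<^sup>2 + e n)\<^sup>2 * t) \<longlonglongrightarrow> 2 * 0 * t / (t\<^sup>2 + 0)\<^sup>2 * t"
      by (intro tendsto_divide tendsto_add tendsto_mult tendsto_power tendsto_const e) (use False in simp)
    then show ?thesis by (simp add: gate'_def)
  qed simp
qed

section \<open>Densities with square root in the local Sobolev space\<close>

text \<open>Here \<open>s\<close> is the square root of the density and \<open>G\<close> its
  gradient, whereas \<open>h\<close> is the Laplacian of the density itself. Fixing these
  representatives keeps arbitrary choices out of the estimates.\<close>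

locale sqrt_density =
  fixes s :: "'a::euclidean_space \<Rightarrow> real" and G :: "'a \<Rightarrow> 'a" and h :: "'a \<Rightarrow> real"
  assumes s_nonneg: "\<And>x. s x \<ge> 0" and s_L2: "L2_loc s" and s_grad: "has_weak_gradient s G"
    and G_L2: "L2_loc G" and lap: "has_weak_laplacian (\<lambda>x. (s x)\<^sup>2) h"
begin

definition W :: "'a \<Rightarrow> 'a" where "W x = (2 * s x) *\<^sub>R G x"

lemma meas: "s \<in> borel_measurable lebesgue" "G \<in> borel_measurable lebesgue" "h \<in> borel_measurable lebesgue"
  "W \<in> borel_measurable lebesgue"
proof -
  show s: "s \<in> borel_measurable lebesgue" using s_L2 by (simp add: L2_loc_def)
  show G: "G \<in> borel_measurable lebesgue" using G_L2 by (simp add: L2_loc_def)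
  show "h \<in> borel_measurable lebesgue" using lap L1_loc_measurable unfolding has_weak_laplacian_def by blast
  show "W \<in> borel_measurable lebesgue" unfolding W_def[abs_def]
    by (intro borel_measurable_scaleR borel_measurable_times borel_measurable_const s G)
qed

lemma s2_L1: "L1_loc (\<lambda>x. (s x)\<^sup>2)" and G2_L1: "L1_loc (\<lambda>x. (norm (G x))\<^sup>2)" and h_L1: "L1_loc h"
  using s_L2 G_L2 lap unfolding L2_loc_def has_weak_laplacian_def by auto

lemma two_sG_le: "2 * s x * norm (G x) \<le> (s x)\<^sup>2 + (norm (G x))\<^sup>2"
  using zero_le_power2[of "s x - norm (G x)"] by (simp add: power2_diff)

lemma norm_W: "norm (W x) = 2 * s x * norm (G x)" "(norm (W x))\<^sup>2 = 4 * (s x)\<^sup>2 * (norm (G x))\<^sup>2"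
  using s_nonneg[of x] by (simp_all add: W_def abs_mult power_mult_distrib)

lemma sG_L1: "L1_loc (\<lambda>x. (s x)\<^sup>2 + (norm (G x))\<^sup>2)" by (rule L1_loc_add[OF s2_L1 G2_L1])

lemma W_L1: "L1_loc W"
  by (rule L1_loc_bound[OF sG_L1 meas(4), where B = 1]) (use two_sG_le norm_W in \<open>auto simp: add_nonneg_nonneg\<close>)

text \<open>The square has an unbounded derivative and falls outside the chain rule, so it is
  approximated by \<open>sqcap\<close>, under the majorant
  \<open>(s x)\<^sup>2 + (norm (G x))\<^sup>2\<close>.\<close>

lemma mu_grad: "has_weak_gradient (\<lambda>x. (s x)\<^sup>2) W"
proof (rule weak_gradient_limit[where u = "\<lambda>x. (s x)\<^sup>2" and v = "\<lambda>x. (s x)\<^sup>2 + (norm (G x))\<^sup>2"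
      and fn = "\<lambda>n x. sqcap (inverse (real (Suc n))) (s x)" and Fn = "\<lambda>n x. sqcap' (inverse (real (Suc n))) (s x) *\<^sub>R G x"])
  have e: "inverse (real (Suc n)) > 0" for n by simp
  show "has_weak_gradient (\<lambda>x. sqcap (inverse (real (Suc n))) (s x)) (\<lambda>x. sqcap' (inverse (real (Suc n))) (s x) *\<^sub>R G x)" for n
    by (rule weak_gradient_chain[OF s_grad sqcap_deriv[OF e] deriv_continuous(4)[OF e] sqcap_bounds(1)[OF e] sqcap_bounds(2)[OF e]])
  note t = small_tendsto[OF LIMSEQ_inverse_real_of_nat e]
  show "(\<lambda>n. sqcap (inverse (real (Suc n))) (s x)) \<longlonglongrightarrow> (s x)\<^sup>2" for x by (rule t)
  show "(\<lambda>n. sqcap' (inverse (real (Suc n))) (s x) *\<^sub>R G x) \<longlonglongrightarrow> W x" for x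
    unfolding W_def by (intro tendsto_scaleR tendsto_const t)
  show "\<bar>sqcap (inverse (real (Suc n))) (s x)\<bar> \<le> (s x)\<^sup>2" for n x by (rule sqcap_bounds(3)[OF e])
  show "norm (sqcap' (inverse (real (Suc n))) (s x) *\<^sub>R G x) \<le> (s x)\<^sup>2 + (norm (G x))\<^sup>2" for n x
  proof -
    have "norm (sqcap' (inverse (real (Suc n))) (s x) *\<^sub>R G x) \<le> 2 * \<bar>s x\<bar> * norm (G x)"
      unfolding norm_scaleR by (rule mult_right_mono[OF sqcap_bounds(4)[OF e]]) simp
    also have "\<dots> \<le> (s x)\<^sup>2 + (norm (G x))\<^sup>2" using two_sG_le[of x] s_nonneg[of x] by simp
    finally show ?thesis .
  qed
qed (rule s2_L1 sG_L1)+

text \<open>Cauchy--Schwarz for the convolution: this bounds \<open>|\<nabla>\<mu>|\<^sup>2/\<mu>\<close> uniformly under mollification.\<close>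

lemma mollify_W_bound:
  assumes m: "mollifier r \<rho> K"
  shows "(norm (mollify \<rho> W x))\<^sup>2 \<le> 4 * mollify \<rho> (\<lambda>x. (s x)\<^sup>2) x * mollify \<rho> (\<lambda>x. (norm (G x))\<^sup>2) x"
    "0 \<le> mollify \<rho> (\<lambda>x. (s x)\<^sup>2) x" "0 \<le> mollify \<rho> (\<lambda>x. (norm (G x))\<^sup>2) x"
proof -
  note i = mollify_integrable'[OF m s2_L1, of x] mollify_integrable'[OF m G2_L1, of x] mollify_integrable'[OF m W_L1, of x]
  show p: "0 \<le> mollify \<rho> (\<lambda>x. (s x)\<^sup>2) x" "0 \<le> mollify \<rho> (\<lambda>x. (norm (G x))\<^sup>2) x"
    unfolding mollify_def using mollifierD(3)[OF m] by (auto intro!: integral_nonneg_AE)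
  show "(norm (mollify \<rho> W x))\<^sup>2 \<le> 4 * mollify \<rho> (\<lambda>x. (s x)\<^sup>2) x * mollify \<rho> (\<lambda>x. (norm (G x))\<^sup>2) x"
  proof (rule square_bound_of_parametric[OF _ p])
    fix t :: real assume t: "t > 0"
    have "norm (mollify \<rho> W x) \<le> (LINT y|lebesgue. t * (\<rho> (x - y) *\<^sub>R (s y)\<^sup>2) + (\<rho> (x - y) *\<^sub>R (norm (G y))\<^sup>2) / t)"
      unfolding mollify_def
    proof (rule Bochner_Integration.integral_norm_bound_integral[OF i(3)])
      show "integrable lebesgue (\<lambda>y. t * (\<rho> (x - y) *\<^sub>R (s y)\<^sup>2) + (\<rho> (x - y) *\<^sub>R (norm (G y))\<^sup>2) / t)"
        using i by (intro Bochner_Integration.integrable_add integrable_mult_right integrable_divide) auto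
      fix y
      \<comment> \<open>The weighted arithmetic-geometric inequality; it is integrated against the
        kernel before \<open>t\<close> is optimised.\<close>
      have "2 * s y * norm (G y) \<le> t * (s y)\<^sup>2 + (norm (G y))\<^sup>2 / t"
      proof -
        have "0 \<le> (t * s y - norm (G y))\<^sup>2 / t" using t by simp
        also have "\<dots> = t * (s y)\<^sup>2 + (norm (G y))\<^sup>2 / t - 2 * s y * norm (G y)"
          using t by (simp add: power2_diff field_simps power2_eq_square)
        finally show ?thesis by simp
      qed
      then have "\<rho> (x - y) * norm (W y) \<le> \<rho> (x - y) * (t * (s y)\<^sup>2 + (norm (G y))\<^sup>2 / t)"
        unfolding norm_W using mollifierD(3)[OF m] by (intro mult_left_mono) auto
      then show "norm (\<rho> (x - y) *\<^sub>R W y) \<le> t * (\<rho> (x - y) *\<^sub>R (s y)\<^sup>2) + (\<rho> (x - y) *\<^sub>R (norm (G y))\<^sup>2) / t"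
        using mollifierD(3)[OF m, of "x - y"] by (simp add: algebra_simps)
    qed
    also have "\<dots> = t * mollify \<rho> (\<lambda>x. (s x)\<^sup>2) x + mollify \<rho> (\<lambda>x. (norm (G x))\<^sup>2) x / t"
      unfolding mollify_def using i by simp
    finally show "norm (mollify \<rho> W x) \<le> t * mollify \<rho> (\<lambda>x. (s x)\<^sup>2) x + mollify \<rho> (\<lambda>x. (norm (G x))\<^sup>2) x / t" .
  qed simp
qed

text \<open>The damped gradient of the mollified density is a C1 field, and its divergence is the
  mollified Laplacian times \<open>damp\<close> plus the squared gradient times
  \<open>damp'\<close>. The identity pairs this divergence with the weakly differentiable, compactly
  supported \<open>v\<close>.\<close>

lemma damped_parts_mollified:
  assumes s: "mollifier r \<rho> K" and v: "has_weak_gradient v E"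
    and z: "\<And>x. norm x > R \<Longrightarrow> v x = 0 \<and> E x = 0" and e: "\<epsilon> > 0"
  defines "m \<equiv> mollify \<rho> (\<lambda>x. (s x)\<^sup>2)"
  shows "(LINT x|lebesgue. v x * damp \<epsilon> (m x) * mollify \<rho> h x) + (LINT x|lebesgue. v x * damp' \<epsilon> (m x) * (norm (mollify \<rho> W x))\<^sup>2)
    + (LINT x|lebesgue. damp \<epsilon> (m x) * (E x \<bullet> mollify \<rho> W x)) = 0"
proof -
  obtain D where D: "\<And>b. C1_gradient (\<lambda>x. mollify \<rho> W x \<bullet> b) (D b)" "\<And>x. (\<Sum>b\<in>Basis. D b x \<bullet> b) = mollify \<rho> h x"
    using mollify_weak_laplacian[OF s mu_grad lap] by blast
  have Cm: "C1_gradient m (mollify \<rho> W)" unfolding m_def by (rule mollify_has_gradient[OF s mu_grad])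
  have Cd: "C1_gradient (\<lambda>x. damp \<epsilon> (m x)) (\<lambda>x. damp' \<epsilon> (m x) *\<^sub>R mollify \<rho> W x)"
    by (rule C1_gradient_compose[OF Cm damp_deriv[OF e] deriv_continuous(2)[OF e]])
  note Cp = C1_gradient_mult[OF Cd D(1)]
  have vL: "L1_loc v" "L1_loc E" using v by (auto simp: has_weak_gradient_def)
  have cW: "continuous_on UNIV (mollify \<rho> W)" "continuous_on UNIV (D b)" for b
    using C1_gradient_continuous(2)[OF Cm] C1_gradient_continuous(2)[OF D(1)] by auto
  have cd: "continuous_on UNIV (\<lambda>x. damp \<epsilon> (m x))" "continuous_on UNIV (\<lambda>x. damp' \<epsilon> (m x))"
    using C1_gradient_continuous(1)[OF Cm] deriv_continuous(1,2)[OF e] by (auto intro: continuous_on_compose2)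
  have i1: "integrable lebesgue (\<lambda>x. v x * (damp \<epsilon> (m x) * (D b x \<bullet> b)))" for b
    by (rule integrable_mult_continuous_compact[OF vL(1), of R]) (use z cd cW in \<open>auto intro!: continuous_intros\<close>)
  have i2: "integrable lebesgue (\<lambda>x. v x * (damp' \<epsilon> (m x) * (mollify \<rho> W x \<bullet> b)\<^sup>2))" for b
    by (rule integrable_mult_continuous_compact[OF vL(1), of R]) (use z cd cW in \<open>auto intro!: continuous_intros\<close>)
  have i3: "integrable lebesgue (\<lambda>x. (E x \<bullet> b) * (damp \<epsilon> (m x) * (mollify \<rho> W x \<bullet> b)))" for b
    by (rule integrable_mult_continuous_compact[OF L1_loc_inner[OF vL(2)], of R]) (use z cd cW in \<open>auto intro!: continuous_intros\<close>)
  have "(LINT x|lebesgue. v x * (damp \<epsilon> (m x) * (D b x \<bullet> b))) + (LINT x|lebesgue. v x * (damp' \<epsilon> (m x) * (mollify \<rho> W x \<bullet> b)\<^sup>2))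
     + (LINT x|lebesgue. (E x \<bullet> b) * (damp \<epsilon> (m x) * (mollify \<rho> W x \<bullet> b))) = 0" for b
  proof -
    have "(LINT x|lebesgue. v x * ((damp \<epsilon> (m x) *\<^sub>R D b x + (mollify \<rho> W x \<bullet> b) *\<^sub>R damp' \<epsilon> (m x) *\<^sub>R mollify \<rho> W x) \<bullet> b))
      = - (LINT x|lebesgue. damp \<epsilon> (m x) * (mollify \<rho> W x \<bullet> b) * (E x \<bullet> b))"
      by (rule weak_gradient_parts_compact[OF v Cp z])
    moreover have "v x * ((damp \<epsilon> (m x) *\<^sub>R D b x + (mollify \<rho> W x \<bullet> b) *\<^sub>R damp' \<epsilon> (m x) *\<^sub>R mollify \<rho> W x) \<bullet> b)
      = v x * (damp \<epsilon> (m x) * (D b x \<bullet> b)) + v x * (damp' \<epsilon> (m x) * (mollify \<rho> W x \<bullet> b)\<^sup>2)" for x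
      by (simp add: inner_add_left distrib_left power2_eq_square)
    ultimately show ?thesis
      using Bochner_Integration.integral_add[OF i1[of b] i2[of b]] by (simp add: mult_ac)
  qed
  then have "0 = (\<Sum>b\<in>Basis. (LINT x|lebesgue. v x * (damp \<epsilon> (m x) * (D b x \<bullet> b))) + (LINT x|lebesgue. v x * (damp' \<epsilon> (m x) * (mollify \<rho> W x \<bullet> b)\<^sup>2))
     + (LINT x|lebesgue. (E x \<bullet> b) * (damp \<epsilon> (m x) * (mollify \<rho> W x \<bullet> b))))" by simp
  also have "\<dots> = (LINT x|lebesgue. (\<Sum>b\<in>Basis. v x * (damp \<epsilon> (m x) * (D b x \<bullet> b)))) + (LINT x|lebesgue. (\<Sum>b\<in>Basis. v x * (damp' \<epsilon> (m x) * (mollify \<rho> W x \<bullet> b)\<^sup>2)))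
     + (LINT x|lebesgue. (\<Sum>b\<in>Basis. (E x \<bullet> b) * (damp \<epsilon> (m x) * (mollify \<rho> W x \<bullet> b))))"
    unfolding sum.distrib Bochner_Integration.integral_sum[OF i1] Bochner_Integration.integral_sum[OF i2] Bochner_Integration.integral_sum[OF i3] ..
  also have "(\<lambda>x. \<Sum>b\<in>Basis. v x * (damp \<epsilon> (m x) * (D b x \<bullet> b))) = (\<lambda>x. v x * damp \<epsilon> (m x) * mollify \<rho> h x)"
    by (simp add: D(2)[symmetric] sum_distrib_left mult.assoc)
  also have "(\<lambda>x. \<Sum>b\<in>Basis. v x * (damp' \<epsilon> (m x) * (mollify \<rho> W x \<bullet> b)\<^sup>2)) = (\<lambda>x. v x * damp' \<epsilon> (m x) * (norm (mollify \<rho> W x))\<^sup>2)"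
    unfolding power2_norm_eq_inner by (subst euclidean_inner) (simp add: sum_distrib_left mult.assoc power2_eq_square)
  also have "(\<lambda>x. \<Sum>b\<in>Basis. (E x \<bullet> b) * (damp \<epsilon> (m x) * (mollify \<rho> W x \<bullet> b))) = (\<lambda>x. damp \<epsilon> (m x) * (E x \<bullet> mollify \<rho> W x))"
    by (subst (2) euclidean_inner) (simp add: sum_distrib_left mult_ac)
  finally show ?thesis by simp
qed

end

section \<open>Removing the mollification, then the gate and the damping\<close>

context sqrt_density
begin

text \<open>At fixed damping the mollified gradients have no fixed majorant. They are bounded
  through the mollification of \<open>(norm (G x))\<^sup>2\<close>, which converges in L1, so
  majorants varying with \<open>n\<close> are used for the last two integrals.\<close>

lemma damped_parts:
  assumes v: "has_weak_gradient v E" and vb: "\<And>x. \<bar>v x\<bar> \<le> B"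
    and z: "\<And>x. norm x > R \<Longrightarrow> v x = 0 \<and> E x = 0" and e: "\<epsilon> > 0"
    and E2: "integrable lebesgue (\<lambda>x. (norm (E x))\<^sup>2)"
  shows "(LINT x|lebesgue. v x * damp \<epsilon> ((s x)\<^sup>2) * h x) + (LINT x|lebesgue. v x * damp' \<epsilon> ((s x)\<^sup>2) * (norm (W x))\<^sup>2)
    + (LINT x|lebesgue. damp \<epsilon> ((s x)\<^sup>2) * (E x \<bullet> W x)) = 0"
proof -
  have vL: "L1_loc v" "L1_loc E" using v by (auto simp: has_weak_gradient_def)
  note ms = meas vL[THEN L1_loc_measurable]
  have B0: "B \<ge> 0" using vb[of 0] by linarith
  obtain \<rho> :: "nat \<Rightarrow> 'a \<Rightarrow> real" and K where sq: "mollifier_seq \<rho> K"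
    and ae: "ae_conv R \<rho> (\<lambda>x. (s x)\<^sup>2)" "ae_conv R \<rho> W"
    using mollifier_seq_ae[OF s2_L1 W_L1] by blast
  define m where "m n = mollify (\<rho> n) (\<lambda>x. (s x)\<^sup>2)" for n
  define g where "g n = mollify (\<rho> n) (\<lambda>x. (norm (G x))\<^sup>2)" for n
  define Wn where "Wn n = mollify (\<rho> n) W" for n
  have bW: "(norm (Wn n x))\<^sup>2 \<le> 4 * m n x * g n x" "0 \<le> m n x" "0 \<le> g n x" for n x
    using mollifier_seqD[OF sq, of n] mollify_W_bound unfolding m_def g_def Wn_def by blast+
  have mL: "L1_loc (m n)" "L1_loc (g n)" "L1_loc (Wn n)" for n
    unfolding m_def g_def Wn_def by (intro mollify_seq_L1_loc[OF sq] s2_L1 G2_L1 W_L1)+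
  note mm = mL[THEN L1_loc_measurable]
  have md: "damp \<epsilon> \<in> borel_measurable borel" "damp' \<epsilon> \<in> borel_measurable borel"
    using deriv_continuous[OF e] by (auto intro: borel_measurable_continuous_onI)
  have md2: "(\<lambda>x. damp \<epsilon> ((s x)\<^sup>2)) \<in> borel_measurable lebesgue" "(\<lambda>x. damp' \<epsilon> ((s x)\<^sup>2)) \<in> borel_measurable lebesgue"
    using measurable_compose[OF L1_loc_measurable[OF s2_L1]] md by auto
  have md3: "(\<lambda>x. damp \<epsilon> (m n x)) \<in> borel_measurable lebesgue" "(\<lambda>x. damp' \<epsilon> (m n x)) \<in> borel_measurable lebesgue" for n
    using measurable_compose[OF mm(1)] md by auto
  have conv: "AE x in lebesgue. norm x \<le> R \<longrightarrow> (\<lambda>n. damp \<epsilon> (m n x)) \<longlonglongrightarrow> damp \<epsilon> ((s x)\<^sup>2) \<and>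
     (\<lambda>n. damp' \<epsilon> (m n x)) \<longlonglongrightarrow> damp' \<epsilon> ((s x)\<^sup>2) \<and> (\<lambda>n. Wn n x) \<longlonglongrightarrow> W x"
    using ae unfolding ae_conv_def
  proof eventually_elim
    case (elim x)
    have c: "isCont (damp \<epsilon>) ((s x)\<^sup>2)" "isCont (damp' \<epsilon>) ((s x)\<^sup>2)"
      using deriv_continuous[OF e] by (auto simp: continuous_on_eq_continuous_at)
    show ?case
      using elim isCont_tendsto_compose[OF c(1), of "\<lambda>n. m n x"] isCont_tendsto_compose[OF c(2), of "\<lambda>n. m n x"]
      unfolding m_def Wn_def by auto
  qed
  have l1: "(\<lambda>n. LINT x|lebesgue. v x * damp \<epsilon> (m n x) * mollify (\<rho> n) h x) \<longlonglongrightarrow> (LINT x|lebesgue. v x * damp \<epsilon> ((s x)\<^sup>2) * h x)"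
  proof (rule tendsto_LINT_mollify(1)[OF sq h_L1, where B = "B * 1" and R = R])
    show "\<bar>v x * damp \<epsilon> (m n x)\<bar> \<le> B * 1" for n x
      unfolding abs_mult using vb[of x] damp_bounds(1)[OF e] B0 by (intro mult_mono) auto
    show "AE x in lebesgue. (\<lambda>n. v x * damp \<epsilon> (m n x)) \<longlonglongrightarrow> v x * damp \<epsilon> ((s x)\<^sup>2)"
      using conv
    proof eventually_elim
      case (elim x) then show ?case using z[of x] by (cases "norm x \<le> R") (auto intro!: tendsto_intros)
    qed
  qed (use z ms md2 md3 in auto)
  have w1: "(\<lambda>n. LINT x|lebesgue. \<bar>indicat_real (cball 0 R) x *\<^sub>R g n x - indicat_real (cball 0 R) x *\<^sub>R (norm (G x))\<^sup>2\<bar>) \<longlonglongrightarrow> 0"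
    using mollify_seq_L1[OF sq G2_L1, of R] by (simp add: g_def flip: right_diff_distrib)
  have gi: "integrable lebesgue (\<lambda>x. indicat_real (cball 0 R) x *\<^sub>R g n x)" "integrable lebesgue (\<lambda>x. indicat_real (cball 0 R) x *\<^sub>R (norm (G x))\<^sup>2)" for n
    by (intro L1_loc_integrable_cball mL G2_L1)+
  \<comment> \<open>The 8 is the 4 of the gradient bound times the bound 2 on
    \<open>damp' \<epsilon> t * t\<close>.\<close>
  have d8: "\<bar>damp' \<epsilon> t * q\<bar> \<le> 8 * y" if "0 \<le> q" "q \<le> 4 * t * y" "0 \<le> t" "0 \<le> y" for t q y
  proof -
    have "\<bar>damp' \<epsilon> t * q\<bar> \<le> \<bar>damp' \<epsilon> t\<bar> * (4 * t * y)" using that by (auto simp: abs_mult intro: mult_left_mono)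
    also have "\<dots> = \<bar>damp' \<epsilon> t * t\<bar> * (4 * y)" using that by (simp add: abs_mult)
    also have "\<dots> \<le> 2 * (4 * y)" using damp_bounds(2)[OF e] that by (intro mult_right_mono) auto
    finally show ?thesis by simp
  qed
  have l2: "(\<lambda>n. LINT x|lebesgue. v x * damp' \<epsilon> (m n x) * (norm (Wn n x))\<^sup>2) \<longlonglongrightarrow> (LINT x|lebesgue. v x * damp' \<epsilon> ((s x)\<^sup>2) * (norm (W x))\<^sup>2)"
  proof (rule generalized_dominated_convergence[where w = "\<lambda>n x. 8 * B * (indicat_real (cball 0 R) x *\<^sub>R g n x)" and w' = "\<lambda>x. 8 * B * (indicat_real (cball 0 R) x *\<^sub>R (norm (G x))\<^sup>2)"])
    show "(\<lambda>x. v x * damp' \<epsilon> (m n x) * (norm (Wn n x))\<^sup>2) \<in> borel_measurable lebesgue" for n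
      using ms md3[of n] mm(3)[of n] by measurable
    show "(\<lambda>x. v x * damp' \<epsilon> ((s x)\<^sup>2) * (norm (W x))\<^sup>2) \<in> borel_measurable lebesgue"
      using ms md2 by measurable
    show "integrable lebesgue (\<lambda>x. 8 * B * (indicat_real (cball 0 R) x *\<^sub>R g n x))" for n by (intro integrable_mult_right gi)
    show "integrable lebesgue (\<lambda>x. 8 * B * (indicat_real (cball 0 R) x *\<^sub>R (norm (G x))\<^sup>2))" by (intro integrable_mult_right gi)
    show "AE x in lebesgue. (\<lambda>n. v x * damp' \<epsilon> (m n x) * (norm (Wn n x))\<^sup>2) \<longlonglongrightarrow> v x * damp' \<epsilon> ((s x)\<^sup>2) * (norm (W x))\<^sup>2"
      using conv
    proof eventually_elim
      case (elim x) then show ?case using z[of x] by (cases "norm x \<le> R") (auto intro!: tendsto_intros)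
    qed
    have bd: "\<bar>v x * damp' \<epsilon> t * q\<bar> \<le> 8 * B * (indicat_real (cball 0 R) x *\<^sub>R y)"
      if "0 \<le> q" "q \<le> 4 * t * y" "0 \<le> t" "0 \<le> y" for x t q y
    proof (cases "norm x \<le> R")
      case True
      have "\<bar>v x\<bar> * \<bar>damp' \<epsilon> t * q\<bar> \<le> B * (8 * y)"
        using vb[of x] d8[OF that] B0 by (intro mult_mono) auto
      then show ?thesis using True by (simp add: abs_mult mult_ac)
    qed (use z[of x] in simp)
    show "AE x in lebesgue. \<bar>v x * damp' \<epsilon> (m n x) * (norm (Wn n x))\<^sup>2\<bar> \<le> 8 * B * (indicat_real (cball 0 R) x *\<^sub>R g n x)" for n
      by (intro AE_I2 bd bW) simp
    show "AE x in lebesgue. \<bar>v x * damp' \<epsilon> ((s x)\<^sup>2) * (norm (W x))\<^sup>2\<bar> \<le> 8 * B * (indicat_real (cball 0 R) x *\<^sub>R (norm (G x))\<^sup>2)"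
      by (intro AE_I2 bd) (simp_all add: norm_W(2))
    have "(\<lambda>n. 8 * B * (LINT x|lebesgue. \<bar>indicat_real (cball 0 R) x *\<^sub>R g n x - indicat_real (cball 0 R) x *\<^sub>R (norm (G x))\<^sup>2\<bar>)) \<longlonglongrightarrow> 8 * B * 0"
      by (intro tendsto_mult_left w1)
    also have "(\<lambda>n. 8 * B * (LINT x|lebesgue. \<bar>indicat_real (cball 0 R) x *\<^sub>R g n x - indicat_real (cball 0 R) x *\<^sub>R (norm (G x))\<^sup>2\<bar>))
      = (\<lambda>n. LINT x|lebesgue. \<bar>8 * B * (indicat_real (cball 0 R) x *\<^sub>R g n x) - 8 * B * (indicat_real (cball 0 R) x *\<^sub>R (norm (G x))\<^sup>2)\<bar>)"
      using B0 by (simp add: abs_mult flip: integral_mult_right_zero right_diff_distrib)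
    finally show "(\<lambda>n. LINT x|lebesgue. \<bar>8 * B * (indicat_real (cball 0 R) x *\<^sub>R g n x) - 8 * B * (indicat_real (cball 0 R) x *\<^sub>R (norm (G x))\<^sup>2)\<bar>) \<longlonglongrightarrow> 0" by simp
  qed
  \<comment> \<open>The bound on \<open>(damp \<epsilon> t)\<^sup>2 * t\<close>. It puts the damped
    gradient under control in L2, so that it can be paired with the square integrable
    \<open>E\<close>.\<close>
  define C where "C = 1 + 1/\<epsilon>"
  have C: "C \<ge> 1" using e by (simp add: C_def)
  have l3: "(\<lambda>n. LINT x|lebesgue. damp \<epsilon> (m n x) * (E x \<bullet> Wn n x)) \<longlonglongrightarrow> (LINT x|lebesgue. damp \<epsilon> ((s x)\<^sup>2) * (E x \<bullet> W x))"
  proof (rule generalized_dominated_convergence[where w = "\<lambda>n x. (norm (E x))\<^sup>2 + 4 * C * (indicat_real (cball 0 R) x *\<^sub>R g n x)" and w' = "\<lambda>x. (norm (E x))\<^sup>2 + 4 * C * (indicat_real (cball 0 R) x *\<^sub>R (norm (G x))\<^sup>2)"])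
    show "(\<lambda>x. damp \<epsilon> (m n x) * (E x \<bullet> Wn n x)) \<in> borel_measurable lebesgue" for n
      using ms md3[of n] mm(3)[of n] by measurable
    show "(\<lambda>x. damp \<epsilon> ((s x)\<^sup>2) * (E x \<bullet> W x)) \<in> borel_measurable lebesgue"
      using ms md2 by measurable
    show "integrable lebesgue (\<lambda>x. (norm (E x))\<^sup>2 + 4 * C * (indicat_real (cball 0 R) x *\<^sub>R g n x))" for n
      by (intro Bochner_Integration.integrable_add E2 integrable_mult_right gi)
    show "integrable lebesgue (\<lambda>x. (norm (E x))\<^sup>2 + 4 * C * (indicat_real (cball 0 R) x *\<^sub>R (norm (G x))\<^sup>2))"
      by (intro Bochner_Integration.integrable_add E2 integrable_mult_right gi)
    show "AE x in lebesgue. (\<lambda>n. damp \<epsilon> (m n x) * (E x \<bullet> Wn n x)) \<longlonglongrightarrow> damp \<epsilon> ((s x)\<^sup>2) * (E x \<bullet> W x)"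
      using conv
    proof eventually_elim
      case (elim x) then show ?case using z[of x] by (cases "norm x \<le> R") (auto intro!: tendsto_intros)
    qed
    have bd: "\<bar>damp \<epsilon> t * (E x \<bullet> q)\<bar> \<le> (norm (E x))\<^sup>2 + 4 * C * (indicat_real (cball 0 R) x *\<^sub>R y)"
      if "(norm q)\<^sup>2 \<le> 4 * t * y" "0 \<le> t" "0 \<le> y" for x t q y
    proof (cases "norm x \<le> R")
      case True
      have "(\<bar>damp \<epsilon> t\<bar> * norm q)\<^sup>2 \<le> (damp \<epsilon> t)\<^sup>2 * (4 * t * y)"
        using that by (simp add: power_mult_distrib mult_left_mono)
      also have "\<dots> = ((damp \<epsilon> t)\<^sup>2 * t) * (4 * y)" by simp
      also have "\<dots> \<le> C * (4 * y)" using damp_bounds(3)[OF e that(2)] that by (intro mult_right_mono) (auto simp: C_def)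
      finally have q: "(\<bar>damp \<epsilon> t\<bar> * norm q)\<^sup>2 \<le> 4 * C * y" by simp
      have "\<bar>damp \<epsilon> t * (E x \<bullet> q)\<bar> \<le> norm (E x) * (\<bar>damp \<epsilon> t\<bar> * norm q)"
        using mult_left_mono[OF Cauchy_Schwarz_ineq2[of "E x" q], of "\<bar>damp \<epsilon> t\<bar>"] by (simp add: abs_mult mult_ac)
      also have "\<dots> \<le> (norm (E x))\<^sup>2 + (\<bar>damp \<epsilon> t\<bar> * norm q)\<^sup>2"
      proof -
        have "0 \<le> norm (E x) * (\<bar>damp \<epsilon> t\<bar> * norm q)" by simp
        then show ?thesis
          using sum_squares_bound[of "norm (E x)" "\<bar>damp \<epsilon> t\<bar> * norm q"] unfolding mult.assoc by linarith
      qed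
      finally show ?thesis using q True by simp
    qed (use z[of x] in simp)
    show "AE x in lebesgue. \<bar>damp \<epsilon> (m n x) * (E x \<bullet> Wn n x)\<bar> \<le> (norm (E x))\<^sup>2 + 4 * C * (indicat_real (cball 0 R) x *\<^sub>R g n x)" for n
      by (intro AE_I2 bd bW)
    show "AE x in lebesgue. \<bar>damp \<epsilon> ((s x)\<^sup>2) * (E x \<bullet> W x)\<bar> \<le> (norm (E x))\<^sup>2 + 4 * C * (indicat_real (cball 0 R) x *\<^sub>R (norm (G x))\<^sup>2)"
      by (intro AE_I2 bd) (simp_all add: norm_W(2))
    have "(\<lambda>n. 4 * C * (LINT x|lebesgue. \<bar>indicat_real (cball 0 R) x *\<^sub>R g n x - indicat_real (cball 0 R) x *\<^sub>R (norm (G x))\<^sup>2\<bar>)) \<longlonglongrightarrow> 4 * C * 0"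
      by (intro tendsto_mult_left w1)
    also have "(\<lambda>n. 4 * C * (LINT x|lebesgue. \<bar>indicat_real (cball 0 R) x *\<^sub>R g n x - indicat_real (cball 0 R) x *\<^sub>R (norm (G x))\<^sup>2\<bar>))
      = (\<lambda>n. LINT x|lebesgue. \<bar>(norm (E x))\<^sup>2 + 4 * C * (indicat_real (cball 0 R) x *\<^sub>R g n x) - ((norm (E x))\<^sup>2 + 4 * C * (indicat_real (cball 0 R) x *\<^sub>R (norm (G x))\<^sup>2))\<bar>)"
      using C by (simp add: abs_mult flip: integral_mult_right_zero right_diff_distrib)
    finally show "(\<lambda>n. LINT x|lebesgue. \<bar>(norm (E x))\<^sup>2 + 4 * C * (indicat_real (cball 0 R) x *\<^sub>R g n x) - ((norm (E x))\<^sup>2 + 4 * C * (indicat_real (cball 0 R) x *\<^sub>R (norm (G x))\<^sup>2))\<bar>) \<longlonglongrightarrow> 0" by simp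
  qed
  have "(LINT x|lebesgue. v x * damp \<epsilon> (m n x) * mollify (\<rho> n) h x) + (LINT x|lebesgue. v x * damp' \<epsilon> (m n x) * (norm (Wn n x))\<^sup>2)
    + (LINT x|lebesgue. damp \<epsilon> (m n x) * (E x \<bullet> Wn n x)) = 0" for n
  proof -
    obtain r where r: "mollifier r (\<rho> n) (K n)" using mollifier_seqD[OF sq] by blast
    show ?thesis using damped_parts_mollified[OF r v z e] unfolding m_def Wn_def .
  qed
  with tendsto_add[OF tendsto_add[OF l1 l2] l3] show ?thesis by (simp add: LIMSEQ_const_iff)
qed

text \<open>The Laplacian of \<open>\<mu>\<close> does not charge the zero set of \<open>\<mu>\<close>: the gate \<open>s\<^sup>2/(s\<^sup>2+\<epsilon>)\<close> makes the
  test function lie in \<open>H\<^sup>1\<close> and tends to the indicator of \<open>{s > 0}\<close>.\<close>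

lemma laplacian_parts:
  assumes \<eta>: "has_weak_gradient \<eta> E" and b: "\<And>x. \<bar>\<eta> x\<bar> \<le> B"
    and z: "\<And>x. norm x > R \<Longrightarrow> \<eta> x = 0 \<and> E x = 0"
    and E2: "integrable lebesgue (\<lambda>x. (s x)\<^sup>2 * (norm (E x))\<^sup>2)"
  shows "(LINT x|lebesgue. E x \<bullet> W x) = - (LINT x|lebesgue. \<eta> x * (indicat_real {x. s x > 0} x * h x))"
proof -
  have vL: "L1_loc \<eta>" "L1_loc E" using \<eta> by (auto simp: has_weak_gradient_def)
  note ms = meas vL[THEN L1_loc_measurable]
  have B0: "B \<ge> 0" using b[of 0] by linarith
  define e where "e n = inverse (real (Suc n))" for n
  have e: "e n > 0" for n by (simp add: e_def)
  have e0: "e \<longlonglongrightarrow> 0" unfolding e_def by (rule LIMSEQ_inverse_real_of_nat)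
  note t = small_tendsto[OF e0 e]
  define v where "v n x = \<eta> x * gate (e n) (s x)" for n x
  define F where "F n x = \<eta> x *\<^sub>R gate' (e n) (s x) *\<^sub>R G x + gate (e n) (s x) *\<^sub>R E x" for n x
  have cg: "continuous_on UNIV (gate (e n))" for n
    by (rule continuous_at_imp_continuous_on) (use gate_deriv[OF e] DERIV_isCont in blast)
  have mg: "gate (e n) \<in> borel_measurable borel" "gate' (e n) \<in> borel_measurable borel"
      "damp (e n) \<in> borel_measurable borel" "damp' (e n) \<in> borel_measurable borel" for n
    using deriv_continuous[OF e] cg by (auto intro: borel_measurable_continuous_onI)
  have mg2: "(\<lambda>x. gate (e n) (s x)) \<in> borel_measurable lebesgue" "(\<lambda>x. gate' (e n) (s x)) \<in> borel_measurable lebesgue"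
      "(\<lambda>x. damp (e n) ((s x)\<^sup>2)) \<in> borel_measurable lebesgue" "(\<lambda>x. damp' (e n) ((s x)\<^sup>2)) \<in> borel_measurable lebesgue" for n
    by (rule measurable_compose[OF ms(1) mg(1)] measurable_compose[OF ms(1) mg(2)]
        measurable_compose[OF L1_loc_measurable[OF s2_L1] mg(3)] measurable_compose[OF L1_loc_measurable[OF s2_L1] mg(4)])+
  have v: "has_weak_gradient (v n) (F n)" for n
    unfolding v_def[abs_def] F_def[abs_def]
    by (rule weak_gradient_mult[OF \<eta> weak_gradient_chain[OF s_grad gate_deriv[OF e] deriv_continuous(3)[OF e] gate_bounds(1)[OF e] gate_bounds(2)[OF e]] b gate_bounds(1)[OF e]])
  have mF: "v n \<in> borel_measurable lebesgue" "F n \<in> borel_measurable lebesgue" for n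
    using v[of n] L1_loc_measurable unfolding has_weak_gradient_def by blast+
  have vz: "v n x = 0 \<and> F n x = 0" if "norm x > R" for n x using z[OF that] by (simp add: v_def F_def)
  have vB: "\<bar>v n x\<bar> \<le> B" for n x
    using mult_mono[OF b[of x] gate_bounds(1)[OF e[of n], of "s x"]] B0 by (simp add: v_def abs_mult)
  have gi: "integrable lebesgue (\<lambda>x. indicat_real (cball 0 R) x *\<^sub>R (norm (G x))\<^sup>2)"
    by (intro L1_loc_integrable_cball G2_L1)
  \<comment> \<open>The gate is at most \<open>C * s x\<close>, so the weighted energy of
    \<open>E\<close> bounds an unweighted one; the bounded derivative of the gate meets
    \<open>G\<close>, which is locally square integrable.\<close>
  have F2: "integrable lebesgue (\<lambda>x. (norm (F n x))\<^sup>2)" for n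
  proof (rule Bochner_Integration.integrable_bound)
    define C where "C = 1 + 1 / e n"
    have C: "C \<ge> 1" using e[of n] by (simp add: C_def)
    show "integrable lebesgue (\<lambda>x. 2 * (B * C)\<^sup>2 * (indicat_real (cball 0 R) x *\<^sub>R (norm (G x))\<^sup>2) + 2 * C\<^sup>2 * ((s x)\<^sup>2 * (norm (E x))\<^sup>2))"
      by (intro Bochner_Integration.integrable_add integrable_mult_right gi E2)
    show "AE x in lebesgue. norm ((norm (F n x))\<^sup>2) \<le> norm (2 * (B * C)\<^sup>2 * (indicat_real (cball 0 R) x *\<^sub>R (norm (G x))\<^sup>2) + 2 * C\<^sup>2 * ((s x)\<^sup>2 * (norm (E x))\<^sup>2))"
    proof (rule AE_I2)
      fix x
      show "norm ((norm (F n x))\<^sup>2) \<le> norm (2 * (B * C)\<^sup>2 * (indicat_real (cball 0 R) x *\<^sub>R (norm (G x))\<^sup>2) + 2 * C\<^sup>2 * ((s x)\<^sup>2 * (norm (E x))\<^sup>2))"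
      proof (cases "norm x \<le> R")
        case True
        have 1: "norm (\<eta> x *\<^sub>R gate' (e n) (s x) *\<^sub>R G x) \<le> B * C * norm (G x)"
          using mult_mono[OF b[of x] gate_bounds(2)[OF e[of n], of "s x"]] B0 C
          by (auto simp: C_def abs_mult mult.assoc[symmetric] intro!: mult_right_mono)
        have 2: "norm (gate (e n) (s x) *\<^sub>R E x) \<le> C * s x * norm (E x)"
          using gate_bounds(3)[OF e[of n], of "s x"] s_nonneg[of x] by (auto simp: C_def intro!: mult_right_mono)
        have "norm (F n x) \<le> B * C * norm (G x) + C * s x * norm (E x)"
          unfolding F_def by (rule order_trans[OF norm_triangle_ineq add_mono[OF 1 2]])
        then have "(norm (F n x))\<^sup>2 \<le> (B * C * norm (G x) + C * s x * norm (E x))\<^sup>2" by (intro power_mono) auto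
        also have "\<dots> \<le> 2 * (B * C * norm (G x))\<^sup>2 + 2 * (C * s x * norm (E x))\<^sup>2"
          using sum_squares_bound[of "B * C * norm (G x)" "C * s x * norm (E x)"] by (simp add: power2_sum)
        finally show ?thesis using True by (simp add: power_mult_distrib mult.assoc)
      qed (use vz[where x = x and n = n] in simp)
    qed
  qed (use mF in simp)
  \<comment> \<open>One parameter \<open>e n\<close> drives both gate and damping; the mollification
    is already gone for each \<open>n\<close>.\<close>
  note id = damped_parts[OF v vB vz e F2]
  have l1: "(\<lambda>n. LINT x|lebesgue. v n x * damp (e n) ((s x)\<^sup>2) * h x) \<longlonglongrightarrow> (LINT x|lebesgue. \<eta> x * (indicat_real {x. s x > 0} x * h x))"
  proof (rule integral_dominated_convergence[where w = "\<lambda>x. B * norm (indicat_real (cball 0 R) x *\<^sub>R h x)"])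
    have "{x \<in> space lebesgue. 0 < s x} \<in> sets lebesgue" by (intro borel_measurable_less borel_measurable_const ms)
    then show "(\<lambda>x. \<eta> x * (indicat_real {x. s x > 0} x * h x)) \<in> borel_measurable lebesgue"
      using ms by (intro borel_measurable_times borel_measurable_indicator) auto
    show "(\<lambda>x. v n x * damp (e n) ((s x)\<^sup>2) * h x) \<in> borel_measurable lebesgue" for n
      using ms mg2[of n] mF(1)[of n] by measurable
    show "integrable lebesgue (\<lambda>x. B * norm (indicat_real (cball 0 R) x *\<^sub>R h x))"
      by (intro integrable_mult_right integrable_norm L1_loc_integrable_cball h_L1)
    show "AE x in lebesgue. (\<lambda>n. v n x * damp (e n) ((s x)\<^sup>2) * h x) \<longlonglongrightarrow> \<eta> x * (indicat_real {x. s x > 0} x * h x)"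
    proof (rule AE_I2)
      fix x
      show "(\<lambda>n. v n x * damp (e n) ((s x)\<^sup>2) * h x) \<longlonglongrightarrow> \<eta> x * (indicat_real {x. s x > 0} x * h x)"
      proof (cases "s x = 0")
        case True then show ?thesis by (simp add: v_def gate_def)
      next
        case False
        then have "(\<lambda>n. \<eta> x * gate (e n) (s x) * damp (e n) ((s x)\<^sup>2) * h x) \<longlonglongrightarrow> \<eta> x * 1 * 1 * h x"
          by (intro tendsto_mult tendsto_const t)
        then show ?thesis using False s_nonneg[of x] by (simp add: v_def)
      qed
    qed
    show "AE x in lebesgue. norm (v n x * damp (e n) ((s x)\<^sup>2) * h x) \<le> B * norm (indicat_real (cball 0 R) x *\<^sub>R h x)" for n
    proof (rule AE_I2)
      fix x
      have "\<bar>v n x\<bar> * \<bar>damp (e n) ((s x)\<^sup>2)\<bar> \<le> B * 1" using vB damp_bounds(1)[OF e] B0 by (intro mult_mono) auto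
      then show "norm (v n x * damp (e n) ((s x)\<^sup>2) * h x) \<le> B * norm (indicat_real (cball 0 R) x *\<^sub>R h x)"
        using vz[where x = x and n = n] by (cases "norm x \<le> R") (auto simp: abs_mult intro: mult_right_mono)
    qed
  qed
  \<comment> \<open>The error caused by differentiating the damping: it vanishes pointwise and stays
    below a multiple of \<open>(norm (G x))\<^sup>2\<close> that does not depend on
    \<open>n\<close>.\<close>
  have l2: "(\<lambda>n. LINT x|lebesgue. v n x * damp' (e n) ((s x)\<^sup>2) * (norm (W x))\<^sup>2) \<longlonglongrightarrow> (integral\<^sup>L lebesgue (\<lambda>x::'a. 0 :: real))"
  proof (rule integral_dominated_convergence[where w = "\<lambda>x. B * 8 * (indicat_real (cball 0 R) x *\<^sub>R (norm (G x))\<^sup>2)"])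
    show "(\<lambda>x. v n x * damp' (e n) ((s x)\<^sup>2) * (norm (W x))\<^sup>2) \<in> borel_measurable lebesgue" for n
      using ms mg2[of n] mF(1)[of n] by measurable
    show "integrable lebesgue (\<lambda>x. B * 8 * (indicat_real (cball 0 R) x *\<^sub>R (norm (G x))\<^sup>2))"
      by (intro integrable_mult_right gi)
    show "AE x in lebesgue. (\<lambda>n. v n x * damp' (e n) ((s x)\<^sup>2) * (norm (W x))\<^sup>2) \<longlonglongrightarrow> 0"
    proof (rule AE_I2)
      fix x
      show "(\<lambda>n. v n x * damp' (e n) ((s x)\<^sup>2) * (norm (W x))\<^sup>2) \<longlonglongrightarrow> 0"
      proof (rule Lim_null_comparison)
        show "\<forall>\<^sub>F n in sequentially. norm (v n x * damp' (e n) ((s x)\<^sup>2) * (norm (W x))\<^sup>2) \<le> B * \<bar>damp' (e n) ((s x)\<^sup>2)\<bar> * (norm (W x))\<^sup>2"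
          using vB by (auto simp: abs_mult intro!: always_eventually mult_right_mono)
        have "(\<lambda>n. B * \<bar>damp' (e n) ((s x)\<^sup>2)\<bar> * (norm (W x))\<^sup>2) \<longlonglongrightarrow> B * \<bar>0\<bar> * (norm (W x))\<^sup>2"
          by (intro tendsto_mult tendsto_const tendsto_rabs t)
        then show "(\<lambda>n. B * \<bar>damp' (e n) ((s x)\<^sup>2)\<bar> * (norm (W x))\<^sup>2) \<longlonglongrightarrow> 0" by simp
      qed
    qed
    show "AE x in lebesgue. norm (v n x * damp' (e n) ((s x)\<^sup>2) * (norm (W x))\<^sup>2) \<le> B * 8 * (indicat_real (cball 0 R) x *\<^sub>R (norm (G x))\<^sup>2)" for n
    proof (rule AE_I2)
      fix x
      have "\<bar>damp' (e n) ((s x)\<^sup>2) * (s x)\<^sup>2\<bar> * (4 * (norm (G x))\<^sup>2) \<le> 2 * (4 * (norm (G x))\<^sup>2)"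
        by (intro mult_right_mono damp_bounds(2)[OF e]) simp
      then have q: "\<bar>damp' (e n) ((s x)\<^sup>2)\<bar> * (norm (W x))\<^sup>2 \<le> 8 * (norm (G x))\<^sup>2"
        by (simp add: norm_W(2) abs_mult mult_ac)
      have "\<bar>v n x\<bar> * (\<bar>damp' (e n) ((s x)\<^sup>2)\<bar> * (norm (W x))\<^sup>2) \<le> B * (8 * (norm (G x))\<^sup>2)"
        by (rule mult_mono[OF vB q]) (use B0 in auto)
      then show "norm (v n x * damp' (e n) ((s x)\<^sup>2) * (norm (W x))\<^sup>2) \<le> B * 8 * (indicat_real (cball 0 R) x *\<^sub>R (norm (G x))\<^sup>2)"
        using vz[where x = x and n = n] by (cases "norm x \<le> R") (auto simp: abs_mult mult.assoc)
    qed
  qed simp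
  have l3: "(\<lambda>n. LINT x|lebesgue. damp (e n) ((s x)\<^sup>2) * (F n x \<bullet> W x)) \<longlonglongrightarrow> (LINT x|lebesgue. E x \<bullet> W x)"
  proof (rule integral_dominated_convergence[where w = "\<lambda>x. (4 * B + 1) * (indicat_real (cball 0 R) x *\<^sub>R (norm (G x))\<^sup>2) + (s x)\<^sup>2 * (norm (E x))\<^sup>2"])
    show "(\<lambda>x. E x \<bullet> W x) \<in> borel_measurable lebesgue" using ms by measurable
    show "(\<lambda>x. damp (e n) ((s x)\<^sup>2) * (F n x \<bullet> W x)) \<in> borel_measurable lebesgue" for n
      using ms mg2[of n] mF(2)[of n] by measurable
    show "integrable lebesgue (\<lambda>x. (4 * B + 1) * (indicat_real (cball 0 R) x *\<^sub>R (norm (G x))\<^sup>2) + (s x)\<^sup>2 * (norm (E x))\<^sup>2)"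
      by (intro Bochner_Integration.integrable_add integrable_mult_right gi E2)
    have eq: "F n x \<bullet> W x = 2 * \<eta> x * (gate' (e n) (s x) * s x) * (norm (G x))\<^sup>2 + gate (e n) (s x) * (E x \<bullet> W x)" for n x
      by (simp add: F_def W_def inner_add_left power2_norm_eq_inner distrib_left mult_ac)
    show "AE x in lebesgue. (\<lambda>n. damp (e n) ((s x)\<^sup>2) * (F n x \<bullet> W x)) \<longlonglongrightarrow> E x \<bullet> W x"
    proof (rule AE_I2)
      fix x
      show "(\<lambda>n. damp (e n) ((s x)\<^sup>2) * (F n x \<bullet> W x)) \<longlonglongrightarrow> E x \<bullet> W x"
      proof (cases "s x = 0")
        \<comment> \<open>At a zero of \<open>s\<close> the gate stays 0 instead of tending to 1,
          but \<open>W\<close> vanishes there as well.\<close>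
        case True then show ?thesis by (simp add: W_def)
      next
        case False
        then have "(\<lambda>n. damp (e n) ((s x)\<^sup>2) * (F n x \<bullet> W x)) \<longlonglongrightarrow> 1 * (2 * \<eta> x * 0 * (norm (G x))\<^sup>2 + 1 * (E x \<bullet> W x))"
          unfolding eq by (intro tendsto_mult tendsto_add tendsto_const t)
        then show ?thesis by simp
      qed
    qed
    show "AE x in lebesgue. norm (damp (e n) ((s x)\<^sup>2) * (F n x \<bullet> W x)) \<le> (4 * B + 1) * (indicat_real (cball 0 R) x *\<^sub>R (norm (G x))\<^sup>2) + (s x)\<^sup>2 * (norm (E x))\<^sup>2" for n
    proof (rule AE_I2)
      fix x
      show "norm (damp (e n) ((s x)\<^sup>2) * (F n x \<bullet> W x)) \<le> (4 * B + 1) * (indicat_real (cball 0 R) x *\<^sub>R (norm (G x))\<^sup>2) + (s x)\<^sup>2 * (norm (E x))\<^sup>2"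
      proof (cases "norm x \<le> R")
        case True
        have "\<bar>2 * \<eta> x * (gate' (e n) (s x) * s x) * (norm (G x))\<^sup>2\<bar> = 2 * (\<bar>\<eta> x\<bar> * \<bar>gate' (e n) (s x) * s x\<bar>) * (norm (G x))\<^sup>2"
          by (simp add: abs_mult)
        also have "\<dots> \<le> 2 * (B * 2) * (norm (G x))\<^sup>2"
          using b gate_bounds(4)[OF e] B0 by (intro mult_right_mono mult_left_mono mult_mono) auto
        finally have 1: "\<bar>2 * \<eta> x * (gate' (e n) (s x) * s x) * (norm (G x))\<^sup>2\<bar> \<le> 4 * B * (norm (G x))\<^sup>2" by simp
        have "\<bar>E x \<bullet> W x\<bar> \<le> norm (E x) * norm (W x)" by (rule Cauchy_Schwarz_ineq2)
        also have "\<dots> = 2 * (s x * norm (E x)) * norm (G x)" by (simp add: norm_W)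
        also have "\<dots> \<le> (s x * norm (E x))\<^sup>2 + (norm (G x))\<^sup>2" by (rule sum_squares_bound)
        finally have 2: "\<bar>E x \<bullet> W x\<bar> \<le> (s x)\<^sup>2 * (norm (E x))\<^sup>2 + (norm (G x))\<^sup>2" by (simp add: power_mult_distrib)
        have 3: "\<bar>gate (e n) (s x) * (E x \<bullet> W x)\<bar> \<le> 1 * ((s x)\<^sup>2 * (norm (E x))\<^sup>2 + (norm (G x))\<^sup>2)"
          unfolding abs_mult by (intro mult_mono gate_bounds(1)[OF e] 2) auto
        have "\<bar>F n x \<bullet> W x\<bar> \<le> 4 * B * (norm (G x))\<^sup>2 + 1 * ((s x)\<^sup>2 * (norm (E x))\<^sup>2 + (norm (G x))\<^sup>2)"
          unfolding eq by (rule order_trans[OF abs_triangle_ineq add_mono[OF 1 3]])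
        then have "\<bar>damp (e n) ((s x)\<^sup>2)\<bar> * \<bar>F n x \<bullet> W x\<bar> \<le> 1 * (4 * B * (norm (G x))\<^sup>2 + 1 * ((s x)\<^sup>2 * (norm (E x))\<^sup>2 + (norm (G x))\<^sup>2))"
          by (intro mult_mono damp_bounds(1)[OF e]) auto
        then show ?thesis using True by (simp add: abs_mult algebra_simps)
      qed (use vz[where x = x and n = n] in simp)
    qed
  qed
  from tendsto_add[OF tendsto_add[OF l1 l2] l3] id
  have "(LINT x|lebesgue. \<eta> x * (indicat_real {x. s x > 0} x * h x)) + (integral\<^sup>L lebesgue (\<lambda>x::'a. 0 :: real)) + (LINT x|lebesgue. E x \<bullet> W x) = 0"
    by (simp add: LIMSEQ_const_iff)
  then show ?thesis by simp
qed

end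

text \<open>Radial functions are written in terms of the squared norm, which is smooth at the
  origin.\<close>

lemma C1_gradient_radial:
  assumes a: "\<And>t. t \<ge> 0 \<Longrightarrow> (a has_real_derivative a' t) (at t)" and a': "continuous_on {0..} a'"
  shows "C1_gradient (\<lambda>x::'a::euclidean_space. a ((norm x)\<^sup>2)) (\<lambda>x. a' ((norm x)\<^sup>2) *\<^sub>R 2 *\<^sub>R x)"
  unfolding C1_gradient_def
proof (intro conjI allI)
  fix x :: 'a
  have "((\<lambda>x::'a. (norm x)\<^sup>2) has_derivative (\<lambda>h. (2 *\<^sub>R x) \<bullet> h)) (at x)"
    using C1_gradient_norm_sq unfolding C1_gradient_def by blast
  from DERIV_compose_FDERIV[OF a this]
  show "((\<lambda>x. a ((norm x)\<^sup>2)) has_derivative (\<lambda>h. (a' ((norm x)\<^sup>2) *\<^sub>R 2 *\<^sub>R x) \<bullet> h)) (at x)"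
    by (auto intro: has_derivative_eq_rhs simp: fun_eq_iff)
next
  show "continuous_on UNIV (\<lambda>x::'a. a' ((norm x)\<^sup>2) *\<^sub>R 2 *\<^sub>R x)"
    by (intro continuous_intros continuous_on_compose2[OF a']) auto
qed

section \<open>The integral inequality produced by a radial field\<close>

context sqrt_density
begin

text \<open>The potential is tied to \<open>G\<close> and \<open>h\<close> only where
  \<open>s\<close> is positive, so both enter the inequality with this factor.\<close>

definition Pos :: "'a \<Rightarrow> real" where "Pos = indicat_real {x. s x > 0}"

lemma Pos_simps: "s x * Pos x = s x" "Pos x * Pos x = Pos x" "0 \<le> Pos x" "Pos x \<le> 1"
  using s_nonneg[of x] by (auto simp: Pos_def indicator_def)

lemma Pos_meas: "Pos \<in> borel_measurable lebesgue"
proof -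
  have "{x \<in> space lebesgue. 0 < s x} \<in> sets lebesgue" by (intro borel_measurable_less borel_measurable_const meas)
  then show ?thesis unfolding Pos_def by (intro borel_measurable_indicator) simp
qed

text \<open>The product rule covers bounded factors, so the density is capped by
  \<open>sqcap\<close>. The majorant of the gradients uses the weighted energy of \<open>E\<close>,
  by way of the estimate of \<open>norm (E x)\<close> by
  \<open>1 + (norm (E x))\<^sup>2\<close>.\<close>

lemma mult_mu_gradient:
  assumes \<eta>: "has_weak_gradient \<eta> E" and b: "\<And>x. \<bar>\<eta> x\<bar> \<le> B"
    and E2: "integrable lebesgue (\<lambda>x. (s x)\<^sup>2 * (norm (E x))\<^sup>2)"
  shows "has_weak_gradient (\<lambda>x. \<eta> x * (s x)\<^sup>2) (\<lambda>x. \<eta> x *\<^sub>R W x + (s x)\<^sup>2 *\<^sub>R E x)"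
proof (rule weak_gradient_limit[where fn = "\<lambda>n x. \<eta> x * sqcap (inverse (real (Suc n))) (s x)"
      and Fn = "\<lambda>n x. \<eta> x *\<^sub>R sqcap' (inverse (real (Suc n))) (s x) *\<^sub>R G x + sqcap (inverse (real (Suc n))) (s x) *\<^sub>R E x"
      and u = "\<lambda>x. B *\<^sub>R (s x)\<^sup>2" and v = "\<lambda>x. B *\<^sub>R ((s x)\<^sup>2 + (norm (G x))\<^sup>2) + ((s x)\<^sup>2 + (s x)\<^sup>2 * (norm (E x))\<^sup>2)"])
  have e: "inverse (real (Suc n)) > 0" for n by simp
  have B0: "B \<ge> 0" using b[of 0] by linarith
  show "has_weak_gradient (\<lambda>x. \<eta> x * sqcap (inverse (real (Suc n))) (s x))
    (\<lambda>x. \<eta> x *\<^sub>R sqcap' (inverse (real (Suc n))) (s x) *\<^sub>R G x + sqcap (inverse (real (Suc n))) (s x) *\<^sub>R E x)" for n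
    by (rule weak_gradient_mult[OF \<eta> weak_gradient_chain[OF s_grad sqcap_deriv[OF e] deriv_continuous(4)[OF e] sqcap_bounds(1)[OF e] sqcap_bounds(2)[OF e]] b sqcap_bounds(1)[OF e]])
  note t = small_tendsto[OF LIMSEQ_inverse_real_of_nat e]
  show "(\<lambda>n. \<eta> x * sqcap (inverse (real (Suc n))) (s x)) \<longlonglongrightarrow> \<eta> x * (s x)\<^sup>2" for x
    by (intro tendsto_mult tendsto_const t)
  show "(\<lambda>n. \<eta> x *\<^sub>R sqcap' (inverse (real (Suc n))) (s x) *\<^sub>R G x + sqcap (inverse (real (Suc n))) (s x) *\<^sub>R E x)
    \<longlonglongrightarrow> \<eta> x *\<^sub>R W x + (s x)\<^sup>2 *\<^sub>R E x" for x
    unfolding W_def by (intro tendsto_scaleR tendsto_add tendsto_const t)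
  show "\<bar>\<eta> x * sqcap (inverse (real (Suc n))) (s x)\<bar> \<le> B *\<^sub>R (s x)\<^sup>2" for n x
    using mult_mono[OF b[of x] sqcap_bounds(3)[OF e[of n], of "s x"]] B0 by (simp add: abs_mult)
  show "norm (\<eta> x *\<^sub>R sqcap' (inverse (real (Suc n))) (s x) *\<^sub>R G x + sqcap (inverse (real (Suc n))) (s x) *\<^sub>R E x)
    \<le> B *\<^sub>R ((s x)\<^sup>2 + (norm (G x))\<^sup>2) + ((s x)\<^sup>2 + (s x)\<^sup>2 * (norm (E x))\<^sup>2)" for n x
  proof (rule order_trans[OF norm_triangle_ineq add_mono])
    have "\<bar>sqcap' (inverse (real (Suc n))) (s x)\<bar> * norm (G x) \<le> 2 * \<bar>s x\<bar> * norm (G x)"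
      by (rule mult_right_mono[OF sqcap_bounds(4)[OF e]]) simp
    also have "\<dots> \<le> (s x)\<^sup>2 + (norm (G x))\<^sup>2" using two_sG_le[of x] s_nonneg[of x] by simp
    finally have "\<bar>\<eta> x\<bar> * (\<bar>sqcap' (inverse (real (Suc n))) (s x)\<bar> * norm (G x)) \<le> B * ((s x)\<^sup>2 + (norm (G x))\<^sup>2)"
      using b[of x] B0 by (intro mult_mono) auto
    then show "norm (\<eta> x *\<^sub>R sqcap' (inverse (real (Suc n))) (s x) *\<^sub>R G x) \<le> B *\<^sub>R ((s x)\<^sup>2 + (norm (G x))\<^sup>2)" by (simp add: abs_mult mult.assoc)
    have "\<bar>sqcap (inverse (real (Suc n))) (s x)\<bar> * norm (E x) \<le> (s x)\<^sup>2 * norm (E x)"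
      by (rule mult_right_mono[OF sqcap_bounds(3)[OF e]]) simp
    also have "\<dots> \<le> (s x)\<^sup>2 * (1 + (norm (E x))\<^sup>2)"
      using two_abs_le[of "norm (E x)"] norm_ge_zero[of "E x"] by (intro mult_left_mono) (simp_all del: norm_ge_zero)
    finally show "norm (sqcap (inverse (real (Suc n))) (s x) *\<^sub>R E x) \<le> (s x)\<^sup>2 + (s x)\<^sup>2 * (norm (E x))\<^sup>2"
      by (simp add: distrib_left)
  qed
  show "L1_loc (\<lambda>x. B *\<^sub>R (s x)\<^sup>2)" by (rule L1_loc_mult_bounded[OF s2_L1, of _ "\<bar>B\<bar>"]) auto
  have "L1_loc (\<lambda>x. (s x)\<^sup>2 * (norm (E x))\<^sup>2)"
  proof (rule L1_locI)
    show "(\<lambda>x. (s x)\<^sup>2 * (norm (E x))\<^sup>2) \<in> borel_measurable lebesgue" using E2 by (rule borel_measurable_integrable)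
    show "integrable lebesgue (\<lambda>x. indicat_real (cball 0 R) x *\<^sub>R ((s x)\<^sup>2 * (norm (E x))\<^sup>2))" for R
      by (rule integrable_mult_indicator[OF _ E2]) simp
  qed
  then show "L1_loc (\<lambda>x. B *\<^sub>R ((s x)\<^sup>2 + (norm (G x))\<^sup>2) + ((s x)\<^sup>2 + (s x)\<^sup>2 * (norm (E x))\<^sup>2))"
    by (intro L1_loc_add s2_L1 G2_L1 L1_loc_mult_bounded[of _ _ "\<bar>B\<bar>"]) auto
qed

text \<open>The inequality is the integral of \<open>\<bar>s F + f G + s f \<Gamma>\<bar>\<^sup>2 \<ge> 0\<close> over \<open>{s > 0}\<close> for the radial
  field \<open>\<Gamma> x = a(\<bar>x\<bar>\<^sup>2) x\<close>; the mixed terms are integrated by parts.\<close>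

lemma radial_field_inequality:
  assumes f: "has_weak_gradient f F" and b: "\<And>x. \<bar>f x\<bar> \<le> B"
    and z: "\<And>x. norm x > R \<Longrightarrow> f x = 0 \<and> F x = 0"
    and F2: "integrable lebesgue (\<lambda>x. (s x)\<^sup>2 * (norm (F x))\<^sup>2)"
    and a: "\<And>t. t \<ge> 0 \<Longrightarrow> (a has_real_derivative a' t) (at t)" and a': "continuous_on {0..} a'"
  shows "integrable lebesgue (\<lambda>x. (f x)\<^sup>2 * (Pos x * (h x / 2 - (norm (G x))\<^sup>2)))" (is ?I1)
    "integrable lebesgue (\<lambda>x. (f x)\<^sup>2 * (s x)\<^sup>2 * (real DIM('a) * a ((norm x)\<^sup>2) + 2 * (norm x)\<^sup>2 * a' ((norm x)\<^sup>2) - (norm x)\<^sup>2 * (a ((norm x)\<^sup>2))\<^sup>2))" (is ?I2)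
    "(LINT x|lebesgue. (f x)\<^sup>2 * (Pos x * (h x / 2 - (norm (G x))\<^sup>2)))
     + (LINT x|lebesgue. (f x)\<^sup>2 * (s x)\<^sup>2 * (real DIM('a) * a ((norm x)\<^sup>2) + 2 * (norm x)\<^sup>2 * a' ((norm x)\<^sup>2) - (norm x)\<^sup>2 * (a ((norm x)\<^sup>2))\<^sup>2))
     \<le> (LINT x|lebesgue. (s x)\<^sup>2 * (norm (F x))\<^sup>2)" (is ?I3)
proof -
  define \<eta> where "\<eta> x = (f x)\<^sup>2" for x
  define E where "E x = (2 * f x) *\<^sub>R F x" for x
  have B0: "B \<ge> 0" using b[of 0] by linarith
  have fL: "L1_loc f" "L1_loc F" using f by (auto simp: has_weak_gradient_def)
  note ms = meas Pos_meas fL[THEN L1_loc_measurable]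
  have \<eta>: "has_weak_gradient \<eta> E"
  proof -
    have "(\<lambda>x. f x * f x) = \<eta>" by (simp add: fun_eq_iff \<eta>_def power2_eq_square)
    moreover have "(\<lambda>x. f x *\<^sub>R F x + f x *\<^sub>R F x) = E"
      unfolding E_def[abs_def] mult_2 scaleR_add_left ..
    ultimately show ?thesis using weak_gradient_mult[OF f f b b] by metis
  qed
  have \<eta>b: "\<bar>\<eta> x\<bar> \<le> B\<^sup>2" for x
    unfolding \<eta>_def using power_mono[OF b, of x 2] by simp
  have \<eta>z: "\<eta> x = 0 \<and> E x = 0" if "norm x > R" for x using z[OF that] by (simp add: \<eta>_def E_def)
  have \<eta>m: "\<eta> \<in> borel_measurable lebesgue" "E \<in> borel_measurable lebesgue"
    using \<eta> L1_loc_measurable unfolding has_weak_gradient_def by blast+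
  have E2: "integrable lebesgue (\<lambda>x. (s x)\<^sup>2 * (norm (E x))\<^sup>2)"
  proof (rule Bochner_Integration.integrable_bound)
    show "integrable lebesgue (\<lambda>x. 4 * B\<^sup>2 * ((s x)\<^sup>2 * (norm (F x))\<^sup>2))" by (intro integrable_mult_right F2)
    show "(\<lambda>x. (s x)\<^sup>2 * (norm (E x))\<^sup>2) \<in> borel_measurable lebesgue" using ms \<eta>m by measurable
    show "AE x in lebesgue. norm ((s x)\<^sup>2 * (norm (E x))\<^sup>2) \<le> norm (4 * B\<^sup>2 * ((s x)\<^sup>2 * (norm (F x))\<^sup>2))"
    proof (rule AE_I2)
      fix x
      have "(f x)\<^sup>2 * ((s x)\<^sup>2 * (norm (F x))\<^sup>2) \<le> B\<^sup>2 * ((s x)\<^sup>2 * (norm (F x))\<^sup>2)"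
        using \<eta>b[of x] by (intro mult_right_mono) (auto simp: \<eta>_def)
      then show "norm ((s x)\<^sup>2 * (norm (E x))\<^sup>2) \<le> norm (4 * B\<^sup>2 * ((s x)\<^sup>2 * (norm (F x))\<^sup>2))"
        by (simp add: E_def power_mult_distrib mult_ac)
    qed
  qed
  have A: "(LINT x|lebesgue. E x \<bullet> W x) = - (LINT x|lebesgue. \<eta> x * (Pos x * h x))"
    unfolding Pos_def by (rule laplacian_parts[OF \<eta> \<eta>b \<eta>z E2])
  define v where "v x = \<eta> x * (s x)\<^sup>2" for x
  define V where "V x = \<eta> x *\<^sub>R W x + (s x)\<^sup>2 *\<^sub>R E x" for x
  have v: "has_weak_gradient v V" unfolding v_def[abs_def] V_def[abs_def] by (rule mult_mu_gradient[OF \<eta> \<eta>b E2])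
  then have vL: "L1_loc v" "L1_loc V" by (auto simp: has_weak_gradient_def)
  have vz: "v x = 0 \<and> V x = 0" if "norm x > R" for x using \<eta>z[OF that] by (simp add: v_def V_def)
  define c where "c x = a ((norm x)\<^sup>2)" for x :: 'a
  define c' where "c' x = a' ((norm x)\<^sup>2)" for x :: 'a
  have Cc: "C1_gradient c (\<lambda>x. c' x *\<^sub>R 2 *\<^sub>R x)"
    unfolding c_def[abs_def] c'_def[abs_def] by (rule C1_gradient_radial[OF a a'])
  have Cx: "C1_gradient (\<lambda>x. x \<bullet> b) (\<lambda>x. b)" for b :: 'a
    unfolding C1_gradient_def by (auto intro!: derivative_eq_intros simp: inner_commute)
  note C = C1_gradient_mult[OF Cc Cx]
  have cc: "continuous_on UNIV c" "continuous_on UNIV c'"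
    using C1_gradient_continuous(1)[OF Cc] unfolding c'_def[abs_def]
    by (auto intro!: continuous_on_compose2[OF a'] continuous_intros)
  have i1: "integrable lebesgue (\<lambda>x. v x * (c x * (b \<bullet> b) + 2 * c' x * (x \<bullet> b)\<^sup>2))" for b
    by (rule integrable_mult_continuous_compact[OF vL(1), of R]) (use vz cc in \<open>auto intro!: continuous_intros\<close>)
  have i2: "integrable lebesgue (\<lambda>x. (V x \<bullet> b) * (c x * (x \<bullet> b)))" for b
    by (rule integrable_mult_continuous_compact[OF L1_loc_inner[OF vL(2)], of R]) (use vz cc in \<open>auto intro!: continuous_intros\<close>)
  have parts: "(LINT x|lebesgue. v x * (c x * (b \<bullet> b) + 2 * c' x * (x \<bullet> b)\<^sup>2)) + (LINT x|lebesgue. (V x \<bullet> b) * (c x * (x \<bullet> b))) = 0" for b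
  proof -
    have "(LINT x|lebesgue. v x * ((c x *\<^sub>R b + (x \<bullet> b) *\<^sub>R c' x *\<^sub>R 2 *\<^sub>R x) \<bullet> b)) = - (LINT x|lebesgue. c x * (x \<bullet> b) * (V x \<bullet> b))"
      by (rule weak_gradient_parts_compact[OF v C vz])
    moreover have "(c x *\<^sub>R b + (x \<bullet> b) *\<^sub>R c' x *\<^sub>R 2 *\<^sub>R x) \<bullet> b = c x * (b \<bullet> b) + 2 * c' x * (x \<bullet> b)\<^sup>2" for x
      by (simp add: inner_add_left power2_eq_square)
    ultimately show ?thesis by (simp add: mult_ac)
  qed
  \<comment> \<open>The divergence of the field \<open>c x *\<^sub>R x\<close>.\<close>
  define d where "d x = real DIM('a) * c x + 2 * (norm x)\<^sup>2 * c' x" for x :: 'a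
  have iV: "integrable lebesgue (\<lambda>x. c x * (V x \<bullet> x))"
  proof -
    have "integrable lebesgue (\<lambda>x. \<Sum>b\<in>Basis. (V x \<bullet> b) * (c x * (x \<bullet> b)))" by (rule Bochner_Integration.integrable_sum[OF i2])
    also have "(\<lambda>x. \<Sum>b\<in>Basis. (V x \<bullet> b) * (c x * (x \<bullet> b))) = (\<lambda>x. c x * (V x \<bullet> x))"
      by (subst (3) euclidean_inner) (simp add: sum_distrib_left mult_ac)
    finally show ?thesis .
  qed
  have iD: "integrable lebesgue (\<lambda>x. v x * d x)"
    by (rule integrable_mult_continuous_compact[OF vL(1), of R]) (use vz cc in \<open>auto simp: d_def[abs_def] intro!: continuous_intros\<close>)
  have Bpart: "(LINT x|lebesgue. v x * d x) + (LINT x|lebesgue. c x * (V x \<bullet> x)) = 0"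
  proof -
    have "0 = (\<Sum>b\<in>Basis. (LINT x|lebesgue. v x * (c x * (b \<bullet> b) + 2 * c' x * (x \<bullet> b)\<^sup>2)) + (LINT x|lebesgue. (V x \<bullet> b) * (c x * (x \<bullet> b))))"
      unfolding parts by simp
    also have "\<dots> = (LINT x|lebesgue. (\<Sum>b\<in>Basis. v x * (c x * (b \<bullet> b) + 2 * c' x * (x \<bullet> b)\<^sup>2))) + (LINT x|lebesgue. (\<Sum>b\<in>Basis. (V x \<bullet> b) * (c x * (x \<bullet> b))))"
      unfolding sum.distrib Bochner_Integration.integral_sum[OF i1] Bochner_Integration.integral_sum[OF i2] ..
    also have "(\<lambda>x. \<Sum>b\<in>Basis. v x * (c x * (b \<bullet> b) + 2 * c' x * (x \<bullet> b)\<^sup>2)) = (\<lambda>x. v x * d x)"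
    proof
      fix x :: 'a
      have "(norm x)\<^sup>2 = (\<Sum>b\<in>Basis. (x \<bullet> b)\<^sup>2)"
        unfolding power2_norm_eq_inner by (subst euclidean_inner) (simp add: power2_eq_square)
      then show "(\<Sum>b\<in>Basis. v x * (c x * (b \<bullet> b) + 2 * c' x * (x \<bullet> b)\<^sup>2)) = v x * d x"
        by (simp add: d_def sum.distrib sum_distrib_left distrib_left inner_Basis mult_ac)
    qed
    also have "(\<lambda>x. \<Sum>b\<in>Basis. (V x \<bullet> b) * (c x * (x \<bullet> b))) = (\<lambda>x. c x * (V x \<bullet> x))"
      by (subst (3) euclidean_inner) (simp add: sum_distrib_left mult_ac)
    finally show ?thesis by simp
  qed
  have iN: "integrable lebesgue (\<lambda>x. v x * ((norm x)\<^sup>2 * (c x)\<^sup>2))"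
    by (rule integrable_mult_continuous_compact[OF vL(1), of R]) (use vz cc in \<open>auto intro!: continuous_intros\<close>)
  have iG: "integrable lebesgue (\<lambda>x. \<eta> x * (Pos x * (norm (G x))\<^sup>2))"
    by (rule integrable_L1_loc_bound[OF G2_L1, where B = "B\<^sup>2" and R = R])
       (use \<eta>b \<eta>z \<eta>m ms Pos_simps in \<open>auto simp: abs_mult intro!: mult_mono mult_left_le_one_le\<close>)
  have ih: "integrable lebesgue (\<lambda>x. \<eta> x * (Pos x * h x))"
    by (rule integrable_L1_loc_bound[OF h_L1, where B = "B\<^sup>2" and R = R])
       (use \<eta>b \<eta>z \<eta>m ms Pos_simps in \<open>auto simp: abs_mult intro!: mult_mono mult_left_le_one_le\<close>)
  have iEW: "integrable lebesgue (\<lambda>x. E x \<bullet> W x)"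
  proof (rule Bochner_Integration.integrable_bound)
    show "integrable lebesgue (\<lambda>x. (s x)\<^sup>2 * (norm (E x))\<^sup>2 + indicat_real (cball 0 R) x *\<^sub>R (norm (G x))\<^sup>2)"
      by (intro Bochner_Integration.integrable_add E2 L1_loc_integrable_cball G2_L1)
    show "(\<lambda>x. E x \<bullet> W x) \<in> borel_measurable lebesgue" using \<eta>m ms by measurable
    show "AE x in lebesgue. norm (E x \<bullet> W x) \<le> norm ((s x)\<^sup>2 * (norm (E x))\<^sup>2 + indicat_real (cball 0 R) x *\<^sub>R (norm (G x))\<^sup>2)"
    proof (rule AE_I2)
      fix x
      have "\<bar>E x \<bullet> W x\<bar> \<le> norm (E x) * norm (W x)" by (rule Cauchy_Schwarz_ineq2)
      also have "\<dots> = 2 * (s x * norm (E x)) * norm (G x)" by (simp add: norm_W)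
      also have "\<dots> \<le> (s x * norm (E x))\<^sup>2 + (norm (G x))\<^sup>2" by (rule sum_squares_bound)
      finally show "norm (E x \<bullet> W x) \<le> norm ((s x)\<^sup>2 * (norm (E x))\<^sup>2 + indicat_real (cball 0 R) x *\<^sub>R (norm (G x))\<^sup>2)"
        using \<eta>z[of x] by (cases "norm x \<le> R") (auto simp: power_mult_distrib)
    qed
  qed
  \<comment> \<open>The mixed terms are complete gradients in disguise: the one of \<open>F\<close>
    with \<open>G\<close> is half the product of the gradients of \<open>\<eta>\<close> and of the
    density, and the two containing the field combine to the gradient of
    \<open>\<eta> x * (s x)\<^sup>2\<close> against the field.\<close>
  have sq: "(norm (s x *\<^sub>R F x + (Pos x * f x) *\<^sub>R G x + (s x * f x * c x) *\<^sub>R x))\<^sup>2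
    = (s x)\<^sup>2 * (norm (F x))\<^sup>2 + \<eta> x * (Pos x * (norm (G x))\<^sup>2) + v x * ((norm x)\<^sup>2 * (c x)\<^sup>2) + (1/2) * (E x \<bullet> W x) + c x * (V x \<bullet> x)" for x
  proof (cases "s x = 0")
    case True
    then have "Pos x = 0" by (simp add: Pos_def)
    then show ?thesis using True by (simp add: v_def V_def W_def)
  next
    case False
    then have "Pos x = 1" using s_nonneg[of x] by (simp add: Pos_def)
    then show ?thesis
      unfolding power2_norm_eq_inner v_def V_def W_def E_def \<eta>_def
      by (simp add: inner_add_left inner_add_right inner_commute power2_eq_square algebra_simps)
  qed
  have "0 \<le> (LINT x|lebesgue. (norm (s x *\<^sub>R F x + (Pos x * f x) *\<^sub>R G x + (s x * f x * c x) *\<^sub>R x))\<^sup>2)"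
    by (rule integral_nonneg_AE) simp
  also have "\<dots> = (LINT x|lebesgue. (s x)\<^sup>2 * (norm (F x))\<^sup>2) + (LINT x|lebesgue. \<eta> x * (Pos x * (norm (G x))\<^sup>2)) + (LINT x|lebesgue. v x * ((norm x)\<^sup>2 * (c x)\<^sup>2))
     + (1/2) * (LINT x|lebesgue. E x \<bullet> W x) + (LINT x|lebesgue. c x * (V x \<bullet> x))"
    unfolding sq using F2 iG iN iEW iV by simp
  also have "\<dots> = (LINT x|lebesgue. (s x)\<^sup>2 * (norm (F x))\<^sup>2) + (LINT x|lebesgue. \<eta> x * (Pos x * (norm (G x))\<^sup>2)) + (LINT x|lebesgue. v x * ((norm x)\<^sup>2 * (c x)\<^sup>2))
     - (1/2) * (LINT x|lebesgue. \<eta> x * (Pos x * h x)) - (LINT x|lebesgue. v x * d x)"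
    using Bpart A by simp
  finally have fin: "0 \<le> \<dots>" .
  have e1: "(\<lambda>x. (f x)\<^sup>2 * (Pos x * (h x / 2 - (norm (G x))\<^sup>2))) = (\<lambda>x. (1/2) * (\<eta> x * (Pos x * h x)) - \<eta> x * (Pos x * (norm (G x))\<^sup>2))"
    by (simp add: fun_eq_iff \<eta>_def algebra_simps)
  have e2: "(\<lambda>x. (f x)\<^sup>2 * (s x)\<^sup>2 * (real DIM('a) * a ((norm x)\<^sup>2) + 2 * (norm x)\<^sup>2 * a' ((norm x)\<^sup>2) - (norm x)\<^sup>2 * (a ((norm x)\<^sup>2))\<^sup>2))
     = (\<lambda>x. v x * d x - v x * ((norm x)\<^sup>2 * (c x)\<^sup>2))"
    by (simp add: fun_eq_iff \<eta>_def v_def d_def c_def c'_def algebra_simps)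
  show ?I1 unfolding e1 by (intro Bochner_Integration.integrable_diff integrable_mult_right iG ih)
  show ?I2 unfolding e2 by (intro Bochner_Integration.integrable_diff iD iN)
  show ?I3 unfolding e1 e2 using fin iG ih iD iN by simp
qed

end

section \<open>The radial field\<close>

text \<open>In the variable \<tau> = |x|^2 this is minus twice the logarithmic derivative of the
  ground state, that is, the factor of \<open>x\<close> in the field.\<close>

definition hardy_a :: "real \<Rightarrow> real \<Rightarrow> real" where "hardy_a m \<tau> = (m - 1 / ln \<tau>) / \<tau>"
definition hardy_a' :: "real \<Rightarrow> real \<Rightarrow> real" where "hardy_a' m \<tau> = ((1 / ln \<tau>)\<^sup>2 - m + 1 / ln \<tau>) / \<tau>\<^sup>2"

lemma hardy_a_deriv:
  assumes "0 < \<tau>" "\<tau> < 1" shows "(hardy_a m has_real_derivative hardy_a' m \<tau>) (at \<tau>)"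
proof -
  have "ln \<tau> < 0" using assms by simp
  then show ?thesis
    unfolding hardy_a_def[abs_def] hardy_a'_def using assms
    by (auto intro!: derivative_eq_intros simp: field_simps power2_eq_square)
qed

lemma DERIV_glue:
  fixes f g :: "real \<Rightarrow> real"
  assumes "(f has_real_derivative D) (at T)" "(g has_real_derivative D) (at T)" "f T = g T"
  shows "((\<lambda>t. if t \<le> T then f t else g t) has_real_derivative D) (at T)"
proof -
  have 1: "(\<lambda>h. ((if T + h \<le> T then f (T + h) else g (T + h)) - (if T \<le> T then f T else g T)) / h)
    = (\<lambda>h. if h \<le> 0 then (f (T + h) - f T) / h else (g (T + h) - g T) / h)"
    using assms(3) by (auto simp: fun_eq_iff)
  show ?thesis unfolding DERIV_def 1
  proof (rule filterlim_If)
    show "((\<lambda>h. (f (T + h) - f T) / h) \<longlongrightarrow> D) (inf (at 0) (principal {x. x \<le> 0}))"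
      using assms(1) unfolding DERIV_def by (rule filterlim_mono) auto
    show "((\<lambda>h. (g (T + h) - g T) / h) \<longlongrightarrow> D) (inf (at 0) (principal {x. \<not> x \<le> 0}))"
      using assms(2) unfolding DERIV_def by (rule filterlim_mono) auto
  qed
qed

text \<open>Near the origin the field is \<open>- \<nabla>w/w\<close> for \<open>w(x) = \<tau>\<^bsup>-m/2\<^esup> \<bar>ln \<tau>\<bar>\<^bsup>1/2\<^esup>\<close> with
  \<open>\<tau> = \<bar>x\<bar>\<^sup>2 + \<epsilon>\<close>, \<open>m = (N - 2)/2\<close>; past \<open>T\<close> it is continued by an exponential with matching value and slope.\<close>

lemma regularized_field:
  fixes m T :: real
  assumes m: "m > 0" and T: "0 < T" "T \<le> exp (-2)"
  shows "\<exists>C\<ge>0. \<forall>\<epsilon>. 0 < \<epsilon> \<longrightarrow> (\<exists>a a'. (\<forall>t\<ge>0. (a has_real_derivative a' t) (at t)) \<and> continuous_on {0..} a' \<and>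
    (\<forall>t\<ge>0. (t + \<epsilon> \<le> T \<longrightarrow> (m\<^sup>2 + (1 / ln (t + \<epsilon>))\<^sup>2) / (t + \<epsilon>) \<le> (2 * m + 2) * a t + 2 * t * a' t - t * (a t)\<^sup>2) \<and>
      (T < t + \<epsilon> \<longrightarrow> - C \<le> (2 * m + 2) * a t + 2 * t * a' t - t * (a t)\<^sup>2)))"
proof -
  have lnT: "ln \<tau> \<le> -2" if "0 < \<tau>" "\<tau> \<le> T" for \<tau>
  proof -
    have "ln \<tau> \<le> ln (exp (-2))" using that T by (subst ln_le_cancel_iff) auto
    then show ?thesis by simp
  qed
  have e2: "exp (-2) < (1::real)" by simp
  then have T1: "T < 1" using T by linarith
  define \<beta> where "\<beta> \<tau> = - 1 / ln \<tau>" for \<tau> :: real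
  \<comment> \<open>This is where \<open>exp (-2)\<close> comes in: with
    \<open>\<beta> \<tau>\<close> below 1 its square does not exceed it, which makes
    \<open>hardy_a'\<close> negative.\<close>
  have \<beta>: "0 < \<beta> \<tau>" "\<beta> \<tau> \<le> 1/2" if "0 < \<tau>" "\<tau> \<le> T" for \<tau>
    using lnT[OF that] by (auto simp: \<beta>_def divide_simps)
  have \<beta>2: "(\<beta> \<tau>)\<^sup>2 \<le> \<beta> \<tau>" if "0 < \<tau>" "\<tau> \<le> T" for \<tau>
    using \<beta>[OF that] by (simp add: power2_eq_square mult_left_le_one_le)
  have ha: "hardy_a m \<tau> = (m + \<beta> \<tau>) / \<tau>" "hardy_a' m \<tau> = ((\<beta> \<tau>)\<^sup>2 - m - \<beta> \<tau>) / \<tau>\<^sup>2" for \<tau>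
    by (simp_all add: hardy_a_def hardy_a'_def \<beta>_def power_divide)
  \<comment> \<open>\<open>A\<close> and \<open>k\<close> match value and slope at \<open>T\<close>.
    The continuation remains positive, so the dimensional term helps, and decays fast enough to keep
    \<open>t * (a t)\<^sup>2\<close> bounded.\<close>
  define A where "A = hardy_a m T"
  define k where "k = - hardy_a' m T / A"
  have A: "A > 0" using \<beta>[of T] T m by (simp add: A_def ha)
  have k: "k > 0" "hardy_a' m T = - k * A"
  proof -
    have "hardy_a' m T < 0" using \<beta>2[of T] m T by (simp add: ha divide_neg_pos)
    then show "k > 0" "hardy_a' m T = - k * A" using A by (auto simp: k_def divide_neg_pos)
  qed
  define \<alpha> where "\<alpha> \<tau> = (if \<tau> \<le> T then hardy_a m \<tau> else A * exp (- k * (\<tau> - T)))" for \<tau>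
  define \<alpha>' where "\<alpha>' \<tau> = (if \<tau> \<le> T then hardy_a' m \<tau> else - k * A * exp (- k * (\<tau> - T)))" for \<tau>
  have d2: "((\<lambda>\<tau>. A * exp (- k * (\<tau> - T))) has_real_derivative - k * A * exp (- k * (\<tau> - T))) (at \<tau>)" for \<tau>
    by (auto intro!: derivative_eq_intros)
  have d: "(\<alpha> has_real_derivative \<alpha>' \<tau>) (at \<tau>)" if "\<tau> > 0" for \<tau>
  proof -
    consider "\<tau> < T" | "\<tau> = T" | "\<tau> > T" by linarith
    then show ?thesis
    proof cases
      case 1
      have "(hardy_a m has_real_derivative \<alpha>' \<tau>) (at \<tau>)"
        using hardy_a_deriv[of \<tau> m] 1 that T1 by (simp add: \<alpha>'_def)
      then show ?thesis
        by (rule DERIV_cong_ev[THEN iffD1, rotated 3])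
           (use 1 in \<open>auto simp: \<alpha>_def intro!: eventually_nhds_in_open[of "{..<T}", THEN eventually_mono]\<close>)
    next
      case 2
      have "(hardy_a m has_real_derivative \<alpha>' T) (at T)" using hardy_a_deriv[of T m] T T1 by (simp add: \<alpha>'_def)
      moreover have "((\<lambda>\<tau>. A * exp (- k * (\<tau> - T))) has_real_derivative \<alpha>' T) (at T)"
        using d2[of T] k(2) by (simp add: \<alpha>'_def)
      ultimately show ?thesis unfolding 2 \<alpha>_def[abs_def] by (rule DERIV_glue) (simp add: A_def)
    next
      case 3
      have "((\<lambda>\<tau>. A * exp (- k * (\<tau> - T))) has_real_derivative \<alpha>' \<tau>) (at \<tau>)" using d2[of \<tau>] 3 by (simp add: \<alpha>'_def)
      then show ?thesis
        by (rule DERIV_cong_ev[THEN iffD1, rotated 3])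
           (use 3 in \<open>auto simp: \<alpha>_def intro!: eventually_nhds_in_open[of "{T<..}", THEN eventually_mono]\<close>)
    qed
  qed
  have c: "continuous_on {0<..} \<alpha>'"
  proof -
    have "continuous_on ({0<..T} \<union> {T..}) (\<lambda>\<tau>. if \<tau> \<le> T then hardy_a' m \<tau> else - k * A * exp (- k * (\<tau> - T)))"
    proof (rule continuous_on_cases_le)
      have "ln \<tau> \<noteq> 0" "\<tau> \<noteq> 0" if "\<tau> \<in> {0<..T}" for \<tau> using lnT[of \<tau>] that by auto
      then show "continuous_on {t \<in> {0<..T} \<union> {T..}. t \<le> T} (hardy_a' m)"
        unfolding hardy_a'_def[abs_def] using T by (intro continuous_intros) (auto dest: lnT)
      show "continuous_on {t \<in> {0<..T} \<union> {T..}. T \<le> t} (\<lambda>\<tau>. - k * A * exp (- k * (\<tau> - T)))"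
        by (intro continuous_intros)
      show "hardy_a' m t = - k * A * exp (- k * (t - T))" if "t \<in> {0<..T} \<union> {T..}" "t = T" for t using that k(2) by simp
    qed (intro continuous_intros)
    moreover have "{0<..T} \<union> {T..} = {0<..}" using T by auto
    ultimately show ?thesis unfolding \<alpha>'_def[abs_def] by simp
  qed
  \<comment> \<open>Comes from bounding \<open>t * exp (- k * (\<tau> - T))\<close> by
    \<open>exp (k * T) / k\<close>; it does not involve \<epsilon>.\<close>
  define C where "C = (2 * k + A) * A * exp (k * T) / k"
  have C: "C \<ge> 0" using A k by (simp add: C_def)
  have low1: "(m\<^sup>2 + (1 / ln (t + \<epsilon>))\<^sup>2) / (t + \<epsilon>) \<le> (2 * m + 2) * \<alpha> (t + \<epsilon>) + 2 * t * \<alpha>' (t + \<epsilon>) - t * (\<alpha> (t + \<epsilon>))\<^sup>2"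
    if "t \<ge> 0" "\<epsilon> > 0" "t + \<epsilon> \<le> T" for t \<epsilon>
  proof -
    define \<tau> where "\<tau> = t + \<epsilon>"
    have \<tau>: "\<tau> > 0" "\<tau> \<le> T" "t = \<tau> - \<epsilon>" using that by (auto simp: \<tau>_def)
    define b where "b = \<beta> \<tau>"
    have a1: "\<alpha> \<tau> = (m + b) / \<tau>" "\<alpha>' \<tau> = (b\<^sup>2 - m - b) / \<tau>\<^sup>2" using \<tau> by (simp_all add: \<alpha>_def \<alpha>'_def ha b_def)
    have neg: "\<alpha>' \<tau> \<le> 0" using \<beta>2[of \<tau>] \<tau> m by (simp add: a1 b_def divide_nonpos_pos)
    \<comment> \<open>The ground state identity, exact when the unshifted variable is \<tau> itself;
      the terms linear in \<open>b\<close> cancel because the dimension is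
      \<open>2 * m + 2\<close>.\<close>
    have "(2 * m + 2) * \<alpha> \<tau> + 2 * \<tau> * \<alpha>' \<tau> - \<tau> * (\<alpha> \<tau>)\<^sup>2 = (m\<^sup>2 + b\<^sup>2) / \<tau>"
      unfolding a1 using \<tau>(1) by (simp add: field_simps power2_eq_square)
    moreover have "(2 * m + 2) * \<alpha> \<tau> + 2 * t * \<alpha>' \<tau> - t * (\<alpha> \<tau>)\<^sup>2
      = ((2 * m + 2) * \<alpha> \<tau> + 2 * \<tau> * \<alpha>' \<tau> - \<tau> * (\<alpha> \<tau>)\<^sup>2) + \<epsilon> * ((\<alpha> \<tau>)\<^sup>2 - 2 * \<alpha>' \<tau>)"
      unfolding \<tau>(3) by (simp add: algebra_simps)
    \<comment> \<open>The whole error of the shift by \<epsilon>; it has the right sign because the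
      coefficient decreases.\<close>
    moreover have "\<epsilon> * ((\<alpha> \<tau>)\<^sup>2 - 2 * \<alpha>' \<tau>) \<ge> 0" using that neg by (intro mult_nonneg_nonneg) (auto intro: order_trans[OF _ zero_le_power2])
    moreover have "(1 / ln \<tau>)\<^sup>2 = b\<^sup>2" by (simp add: b_def \<beta>_def power_divide)
    ultimately show ?thesis unfolding \<tau>_def[symmetric] by simp
  qed
  have low2: "- C \<le> (2 * m + 2) * \<alpha> (t + \<epsilon>) + 2 * t * \<alpha>' (t + \<epsilon>) - t * (\<alpha> (t + \<epsilon>))\<^sup>2"
    if "t \<ge> 0" "\<epsilon> > 0" "T < t + \<epsilon>" for t \<epsilon>
  proof -
    define \<tau> where "\<tau> = t + \<epsilon>"
    define E where "E = exp (- k * (\<tau> - T))"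
    have E: "0 < E" "E \<le> 1" using that k by (auto simp: E_def \<tau>_def)
    have a1: "\<alpha> \<tau> = A * E" "\<alpha>' \<tau> = - k * A * E" using that by (simp_all add: \<alpha>_def \<alpha>'_def E_def \<tau>_def)
    have "k * \<tau> \<le> exp (k * \<tau>)" using exp_ge_add_one_self[of "k * \<tau>"] by linarith
    then have "k * \<tau> * exp (- k * \<tau>) \<le> exp (k * \<tau>) * exp (- k * \<tau>)" by (intro mult_right_mono) auto
    then have kt: "\<tau> * exp (- k * \<tau>) \<le> 1 / k" using k by (simp add: field_simps flip: exp_add)
    have "t * E \<le> \<tau> * E" using that E by (intro mult_right_mono) (auto simp: \<tau>_def)
    also have "\<dots> = (\<tau> * exp (- k * \<tau>)) * exp (k * T)" by (simp add: E_def algebra_simps flip: exp_add)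
    also have "\<dots> \<le> 1 / k * exp (k * T)" by (intro mult_right_mono kt) auto
    finally have tE: "t * E \<le> exp (k * T) / k" by simp
    have "2 * t * (k * A * E) + t * (A * E)\<^sup>2 \<le> 2 * t * (k * A * E) + t * (A * (A * E))"
    proof -
      have "(A * E) * (A * E) \<le> A * (A * E)" using A E by (intro mult_right_mono) (auto simp: mult_le_cancel_left1)
      then show ?thesis using that by (auto simp: power2_eq_square intro: mult_left_mono)
    qed
    also have "\<dots> = (2 * k + A) * A * (t * E)" by (simp add: algebra_simps)
    also have "\<dots> \<le> (2 * k + A) * A * (exp (k * T) / k)" using k A by (intro mult_left_mono tE) auto
    also have "\<dots> = C" by (simp add: C_def)
    finally have "- C \<le> 2 * t * (- k * A * E) - t * (A * E)\<^sup>2" by simp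
    moreover have "(2 * m + 2) * (A * E) \<ge> 0" using m A E by simp
    ultimately show ?thesis unfolding \<tau>_def[symmetric] a1 by linarith
  qed
  show ?thesis
  proof (intro exI[of _ C] conjI allI impI C)
    fix \<epsilon> :: real assume e: "0 < \<epsilon>"
    have "((\<lambda>t. \<alpha> (t + \<epsilon>)) has_real_derivative \<alpha>' (t + \<epsilon>)) (at t)" if "t \<ge> 0" for t
      using DERIV_shift[of \<alpha> "\<alpha>' (t + \<epsilon>)" t \<epsilon>] d[of "t + \<epsilon>"] that e by simp
    moreover have "continuous_on {0..} (\<lambda>t. \<alpha>' (t + \<epsilon>))"
      by (rule continuous_on_compose2[OF c]) (use e in \<open>auto intro!: continuous_intros\<close>)
    ultimately show "\<exists>a a'. (\<forall>t\<ge>0. (a has_real_derivative a' t) (at t)) \<and> continuous_on {0..} a' \<and>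
    (\<forall>t\<ge>0. (t + \<epsilon> \<le> T \<longrightarrow> (m\<^sup>2 + (1 / ln (t + \<epsilon>))\<^sup>2) / (t + \<epsilon>) \<le> (2 * m + 2) * a t + 2 * t * a' t - t * (a t)\<^sup>2) \<and>
      (T < t + \<epsilon> \<longrightarrow> - C \<le> (2 * m + 2) * a t + 2 * t * a' t - t * (a t)\<^sup>2))"
      using low1 low2 e by (intro exI[of _ "\<lambda>t. \<alpha> (t + \<epsilon>)"] exI[of _ "\<lambda>t. \<alpha>' (t + \<epsilon>)"]) auto
  qed
qed

section \<open>The weighted Hardy inequality\<close>

context sqrt_density
begin

text \<open>Fatou's lemma for the shifted fields: after adding \<open>C0\<close> the integrands are
  nonnegative, and their lower limit dominates the singular \<open>dens\<close>. The left side is a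
  nonnegative integral, so its finiteness is part of the conclusion and not presupposed.\<close>

lemma hardy_bounded:
  fixes c C0 C T :: real
  defines "m \<equiv> (real DIM('a) - 2) / 2"
  defines "dens \<equiv> \<lambda>x::'a. if (norm x)\<^sup>2 < T then (m\<^sup>2 + (1 / ln ((norm x)\<^sup>2))\<^sup>2) / (norm x)\<^sup>2 else - C0"
  assumes f: "has_weak_gradient f F" and b: "\<And>x. \<bar>f x\<bar> \<le> B"
    and z: "\<And>x. norm x > R \<Longrightarrow> f x = 0 \<and> F x = 0"
    and F2: "integrable lebesgue (\<lambda>x. (s x)\<^sup>2 * (norm (F x))\<^sup>2)"
    and C0: "C0 \<ge> 0" and T: "T < 1"
    and field: "\<And>\<epsilon>. 0 < \<epsilon> \<Longrightarrow> \<exists>a a'. (\<forall>t\<ge>0. (a has_real_derivative a' t) (at t)) \<and> continuous_on {0..} a' \<and>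
    (\<forall>t\<ge>0. (t + \<epsilon> \<le> T \<longrightarrow> (m\<^sup>2 + (1 / ln (t + \<epsilon>))\<^sup>2) / (t + \<epsilon>) \<le> (2 * m + 2) * a t + 2 * t * a' t - t * (a t)\<^sup>2) \<and>
      (T < t + \<epsilon> \<longrightarrow> - C0 \<le> (2 * m + 2) * a t + 2 * t * a' t - t * (a t)\<^sup>2))"
    and c: "c \<ge> 0"
    and pot: "AE x in lebesgue. s x > 0 \<longrightarrow> (s x)\<^sup>2 * (c / (norm x)\<^sup>2) \<le> h x / 2 - (norm (G x))\<^sup>2 + (s x)\<^sup>2 * (dens x + C)"
  shows "(\<integral>\<^sup>+x. ennreal ((f x)\<^sup>2 * (s x)\<^sup>2 * (c / (norm x)\<^sup>2)) \<partial>lebesgue)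
    \<le> ennreal ((LINT x|lebesgue. (s x)\<^sup>2 * (norm (F x))\<^sup>2) + C * (LINT x|lebesgue. (f x)\<^sup>2 * (s x)\<^sup>2))"
proof -
  have m2: "2 * m + 2 = real DIM('a)" by (simp add: m_def field_simps)
  define e where "e n = inverse (real (Suc n))" for n
  have e: "e n > 0" for n by (simp add: e_def)
  have e0: "e \<longlonglongrightarrow> 0" unfolding e_def by (rule LIMSEQ_inverse_real_of_nat)
  have "\<forall>n. \<exists>a a'. (\<forall>t\<ge>0. (a has_real_derivative a' t) (at t)) \<and> continuous_on {0..} a' \<and>
    (\<forall>t\<ge>0. (t + e n \<le> T \<longrightarrow> (m\<^sup>2 + (1 / ln (t + e n))\<^sup>2) / (t + e n) \<le> (2 * m + 2) * a t + 2 * t * a' t - t * (a t)\<^sup>2) \<and>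
      (T < t + e n \<longrightarrow> - C0 \<le> (2 * m + 2) * a t + 2 * t * a' t - t * (a t)\<^sup>2))"
    using field e by blast
  then obtain a a' where a: "\<And>n t. t \<ge> 0 \<Longrightarrow> (a n has_real_derivative a' n t) (at t)" "\<And>n. continuous_on {0..} (a' n)"
    "\<And>n t. t \<ge> 0 \<Longrightarrow> t + e n \<le> T \<Longrightarrow> (m\<^sup>2 + (1 / ln (t + e n))\<^sup>2) / (t + e n) \<le> (2 * m + 2) * a n t + 2 * t * a' n t - t * (a n t)\<^sup>2"
    "\<And>n t. t \<ge> 0 \<Longrightarrow> T < t + e n \<Longrightarrow> - C0 \<le> (2 * m + 2) * a n t + 2 * t * a' n t - t * (a n t)\<^sup>2"
    by metis
  define D where "D n x = real DIM('a) * a n ((norm x)\<^sup>2) + 2 * (norm x)\<^sup>2 * a' n ((norm x)\<^sup>2) - (norm x)\<^sup>2 * (a n ((norm x)\<^sup>2))\<^sup>2" for n and x :: 'a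
  define p where "p x = (f x)\<^sup>2 * (s x)\<^sup>2" for x
  define q where "q x = (f x)\<^sup>2 * (Pos x * (h x / 2 - (norm (G x))\<^sup>2))" for x
  have fm: "f \<in> borel_measurable lebesgue" using f L1_loc_measurable by (auto simp: has_weak_gradient_def)
  have key: "integrable lebesgue q" "integrable lebesgue (\<lambda>x. p x * D n x)"
    "(LINT x|lebesgue. q x) + (LINT x|lebesgue. p x * D n x) \<le> (LINT x|lebesgue. (s x)\<^sup>2 * (norm (F x))\<^sup>2)" for n
    unfolding p_def q_def[abs_def] D_def
    by (rule radial_field_inequality[OF f b z F2 a(1) a(2)], assumption+)+
  have pm: "p \<in> borel_measurable lebesgue" unfolding p_def[abs_def] using fm meas by measurable
  have ip: "integrable lebesgue p"
  proof (rule integrable_L1_loc_bound[OF s2_L1 pm, where B = "B\<^sup>2" and R = R])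
    show "norm (p x) \<le> B\<^sup>2 * norm ((s x)\<^sup>2)" for x
      using power_mono[OF b[of x], of 2] by (auto simp: p_def intro!: mult_right_mono)
  qed (use z in \<open>simp add: p_def\<close>)
  have iq: "integrable lebesgue q" by (rule key(1))
  have iD: "integrable lebesgue (\<lambda>x. p x * D n x)" for n by (rule key(2))
  have p0: "p x \<ge> 0" for x by (simp add: p_def)
  \<comment> \<open>A bound for the integrals of all \<open>u n\<close>, independent of
    \<open>n\<close>; the potential part \<open>q\<close> does not depend on the field.\<close>
  define Q where "Q = (LINT x|lebesgue. (s x)\<^sup>2 * (norm (F x))\<^sup>2) - (LINT x|lebesgue. q x) + C0 * (LINT x|lebesgue. p x)"
  define u where "u n x = p x * (D n x + C0)" for n x
  define w where "w x = p x * (dens x + C0)" for x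
  have Dn: "D n x \<ge> (m\<^sup>2 + (1 / ln ((norm x)\<^sup>2 + e n))\<^sup>2) / ((norm x)\<^sup>2 + e n)" if "(norm x)\<^sup>2 + e n \<le> T" for n x
    using a(3)[of "(norm x)\<^sup>2" n] that unfolding D_def m2 by simp
  have Dn0: "D n x \<ge> - C0" for n x
  proof (cases "(norm x)\<^sup>2 + e n \<le> T")
    case True
    have "(m\<^sup>2 + (1 / ln ((norm x)\<^sup>2 + e n))\<^sup>2) / ((norm x)\<^sup>2 + e n) \<ge> 0" using e[of n] by simp
    then show ?thesis using Dn[OF True] C0 by linarith
  next
    case False
    then show ?thesis using a(4)[of "(norm x)\<^sup>2" n] unfolding D_def m2 by simp
  qed
  have u0: "u n x \<ge> 0" for n x unfolding u_def using p0[of x] Dn0[of n x] by (intro mult_nonneg_nonneg) auto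
  have ue: "u n = (\<lambda>x. p x * D n x + C0 * p x)" for n by (simp add: u_def fun_eq_iff algebra_simps)
  have ui: "integrable lebesgue (u n)" for n unfolding ue using iD ip by simp
  have uQ: "(LINT x|lebesgue. u n x) \<le> Q" for n
    using key(3)[of n] iD[of n] ip unfolding ue Q_def by simp
  have Q0: "Q \<ge> 0"
  proof -
    have "0 \<le> (LINT x|lebesgue. u 0 x)" by (rule integral_nonneg_AE) (simp add: u0)
    also note uQ
    finally show ?thesis .
  qed
  have lim: "ennreal (w x) \<le> liminf (\<lambda>n. ennreal (u n x))" for x
  proof (cases "(norm x)\<^sup>2 < T")
    case False
    then show ?thesis by (simp add: w_def dens_def)
  next
    case True
    define t where "t = (norm x)\<^sup>2"
    have ev: "\<forall>\<^sub>F n in sequentially. t + e n \<le> T"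
      using order_tendstoD(2)[OF e0, of "T - t"] True by (auto simp: t_def elim: eventually_mono)
    \<comment> \<open>At the origin \<open>dens\<close> is 0 by the convention on division by zero,
      so the approximants take the same value there.\<close>
    define y where "y n = p x * ((if t = 0 then 0 else (m\<^sup>2 + (1 / ln (t + e n))\<^sup>2) / (t + e n)) + C0)" for n
    have "y \<longlonglongrightarrow> w x"
    proof (cases "t = 0")
      case True
      then show ?thesis using \<open>(norm x)\<^sup>2 < T\<close> by (simp add: y_def[abs_def] w_def dens_def t_def)
    next
      case False
      have t: "t > 0" "t < 1" using False True T by (auto simp: t_def)
      then have "ln t \<noteq> 0" by simp
      have "(\<lambda>n. p x * ((m\<^sup>2 + (1 / ln (t + e n))\<^sup>2) / (t + e n) + C0)) \<longlonglongrightarrow> p x * ((m\<^sup>2 + (1 / ln (t + 0))\<^sup>2) / (t + 0) + C0)"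
        by (intro tendsto_intros tendsto_ln e0) (use t \<open>ln t \<noteq> 0\<close> in auto)
      then show ?thesis using False True by (simp add: y_def[abs_def] w_def dens_def t_def)
    qed
    then have "(\<lambda>n. ennreal (y n)) \<longlonglongrightarrow> ennreal (w x)" by (rule tendsto_ennrealI)
    then have "ennreal (w x) = liminf (\<lambda>n. ennreal (y n))" by (intro lim_imp_Liminf[symmetric]) auto
    also have "\<dots> \<le> liminf (\<lambda>n. ennreal (u n x))"
    proof (rule Liminf_mono)
      show "\<forall>\<^sub>F n in sequentially. ennreal (y n) \<le> ennreal (u n x)"
        using ev
      proof eventually_elim
        case (elim n)
        have "(m\<^sup>2 + (1 / ln (t + e n))\<^sup>2) / (t + e n) \<ge> 0" using e[of n] by (simp add: t_def)
        then have "(if t = 0 then 0 else (m\<^sup>2 + (1 / ln (t + e n))\<^sup>2) / (t + e n)) \<le> D n x"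
          using Dn[of x n] elim by (auto simp: t_def)
        then show ?case unfolding y_def u_def using p0[of x] by (intro ennreal_leI mult_left_mono) auto
      qed
    qed
    finally show ?thesis .
  qed
  have dens0: "dens x + C0 \<ge> 0" for x using C0 by (auto simp: dens_def)
  have w0: "w x \<ge> 0" for x unfolding w_def using p0 dens0 by simp
  have densm: "dens \<in> borel_measurable lebesgue"
  proof -
    have "dens \<in> borel_measurable borel" unfolding dens_def by measurable
    then show ?thesis by (simp add: measurable_completion)
  qed
  have wm: "w \<in> borel_measurable lebesgue" unfolding w_def[abs_def] using pm densm by measurable
  have wQ: "(\<integral>\<^sup>+x. ennreal (w x) \<partial>lebesgue) \<le> ennreal Q"
  proof -
    have "(\<integral>\<^sup>+x. ennreal (w x) \<partial>lebesgue) \<le> (\<integral>\<^sup>+x. liminf (\<lambda>n. ennreal (u n x)) \<partial>lebesgue)"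
      by (intro nn_integral_mono lim)
    also have "\<dots> \<le> liminf (\<lambda>n. \<integral>\<^sup>+x. ennreal (u n x) \<partial>lebesgue)"
      by (rule nn_integral_liminf) (use ui[THEN borel_measurable_integrable] in simp)
    also have "\<dots> \<le> liminf (\<lambda>n. ennreal Q)"
    proof (intro Liminf_mono always_eventually allI)
      fix n
      have "(\<integral>\<^sup>+x. ennreal (u n x) \<partial>lebesgue) = ennreal (LINT x|lebesgue. u n x)"
        by (rule nn_integral_eq_integral[OF ui]) (simp add: u0)
      also have "\<dots> \<le> ennreal Q" by (intro ennreal_leI uQ)
      finally show "(\<integral>\<^sup>+x. ennreal (u n x) \<partial>lebesgue) \<le> ennreal Q" .
    qed
    also have "\<dots> = ennreal Q" by (simp add: Liminf_const)
    finally show ?thesis .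
  qed
  have iw: "integrable lebesgue w"
    by (rule integrableI_nonneg[OF wm]) (use w0 le_less_trans[OF wQ] in auto)
  have wQ': "(LINT x|lebesgue. w x) \<le> Q"
    using wQ nn_integral_eq_integral[OF iw] w0 Q0 by (simp add: ennreal_le_iff)
  \<comment> \<open>\<open>w\<close> already contains \<open>C0\<close> times \<open>p\<close>,
    hence the difference of the constants.\<close>
  define r where "r x = q x + w x + (C - C0) * p x" for x
  have ir: "integrable lebesgue r" unfolding r_def[abs_def] using iq iw ip by simp
  have le: "AE x in lebesgue. (f x)\<^sup>2 * (s x)\<^sup>2 * (c / (norm x)\<^sup>2) \<le> r x"
    using pot
  proof eventually_elim
    case (elim x)
    show ?case
    proof (cases "s x = 0")
      case True
      then show ?thesis by (simp add: r_def q_def w_def p_def Pos_def)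
    next
      case False
      then have s: "s x > 0" using s_nonneg[of x] by simp
      have "(f x)\<^sup>2 * ((s x)\<^sup>2 * (c / (norm x)\<^sup>2)) \<le> (f x)\<^sup>2 * (h x / 2 - (norm (G x))\<^sup>2 + (s x)\<^sup>2 * (dens x + C))"
        using elim s by (intro mult_left_mono) auto
      also have "\<dots> = r x" using s by (simp add: r_def q_def w_def p_def Pos_def algebra_simps)
      finally show ?thesis by (simp add: mult.assoc)
    qed
  qed
  have l0: "(f x)\<^sup>2 * (s x)\<^sup>2 * (c / (norm x)\<^sup>2) \<ge> 0" for x using c by simp
  have "(\<integral>\<^sup>+x. ennreal ((f x)\<^sup>2 * (s x)\<^sup>2 * (c / (norm x)\<^sup>2)) \<partial>lebesgue) \<le> (\<integral>\<^sup>+x. ennreal (r x) \<partial>lebesgue)"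
    by (rule nn_integral_mono_AE) (use le in eventually_elim, rule ennreal_leI)
  also have "\<dots> = ennreal (LINT x|lebesgue. r x)"
    by (rule nn_integral_eq_integral[OF ir]) (use le in eventually_elim, use l0 order_trans in blast)
  also have "\<dots> \<le> ennreal ((LINT x|lebesgue. (s x)\<^sup>2 * (norm (F x))\<^sup>2) + C * (LINT x|lebesgue. (f x)\<^sup>2 * (s x)\<^sup>2))"
  proof (rule ennreal_leI)
    have "(LINT x|lebesgue. r x) = (LINT x|lebesgue. q x) + (LINT x|lebesgue. w x) + (C - C0) * (LINT x|lebesgue. p x)"
      unfolding r_def[abs_def] using iq iw ip by simp
    then show "(LINT x|lebesgue. r x) \<le> (LINT x|lebesgue. (s x)\<^sup>2 * (norm (F x))\<^sup>2) + C * (LINT x|lebesgue. (f x)\<^sup>2 * (s x)\<^sup>2)"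
      using wQ' unfolding Q_def p_def[symmetric] by (simp add: algebra_simps)
  qed
  finally show ?thesis .
qed

text \<open>Truncation \<open>\<kappa>\<^sub>n \<cdot> \<phi>/(1 + \<epsilon>\<^sub>n \<phi>\<^sup>2)\<close> reduces a general function to bounded ones of compact support.\<close>

lemma hardy_general:
  assumes \<phi>: "has_weak_gradient \<phi> P"
    and P2: "integrable lebesgue (\<lambda>x. (s x)\<^sup>2 * (norm (P x))\<^sup>2)" and \<phi>2: "integrable lebesgue (\<lambda>x. (\<phi> x)\<^sup>2 * (s x)\<^sup>2)"
    and c: "c \<ge> 0" and C: "C \<ge> 0"
    and bdd: "\<And>f F B R. has_weak_gradient f F \<Longrightarrow> (\<And>x. \<bar>f x\<bar> \<le> B) \<Longrightarrow> (\<And>x. norm x > R \<Longrightarrow> f x = 0 \<and> F x = 0) \<Longrightarrow>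
      integrable lebesgue (\<lambda>x. (s x)\<^sup>2 * (norm (F x))\<^sup>2) \<Longrightarrow>
      (\<integral>\<^sup>+x. ennreal ((f x)\<^sup>2 * (s x)\<^sup>2 * (c / (norm x)\<^sup>2)) \<partial>lebesgue)
    \<le> ennreal ((LINT x|lebesgue. (s x)\<^sup>2 * (norm (F x))\<^sup>2) + C * (LINT x|lebesgue. (f x)\<^sup>2 * (s x)\<^sup>2))"
  shows "(\<integral>\<^sup>+x. ennreal ((\<phi> x)\<^sup>2 * (s x)\<^sup>2 * (c / (norm x)\<^sup>2)) \<partial>lebesgue)
    \<le> ennreal ((LINT x|lebesgue. (s x)\<^sup>2 * (norm (P x))\<^sup>2) + C * (LINT x|lebesgue. (\<phi> x)\<^sup>2 * (s x)\<^sup>2))"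
proof -
  define e where "e n = inverse (real (Suc n))" for n
  have e: "e n > 0" for n by (simp add: e_def)
  have e0: "e \<longlonglongrightarrow> 0" unfolding e_def by (rule LIMSEQ_inverse_real_of_nat)
  note t = small_tendsto[OF e0 e]
  obtain L where "\<forall>R. \<exists>(\<kappa>::'a \<Rightarrow> real) K. C1_gradient \<kappa> K \<and> (\<forall>x. 0 \<le> \<kappa> x \<and> \<kappa> x \<le> 1) \<and>
    (\<forall>x. norm x \<le> R \<longrightarrow> \<kappa> x = 1 \<and> K x = 0) \<and> (\<forall>x. norm x \<ge> R + 3 \<longrightarrow> \<kappa> x = 0 \<and> K x = 0) \<and> (\<forall>x. norm (K x) \<le> L)"
    using smooth_cutoff by blast
  then have "\<forall>n::nat. \<exists>(\<kappa>::'a \<Rightarrow> real) K. C1_gradient \<kappa> K \<and> (\<forall>x. 0 \<le> \<kappa> x \<and> \<kappa> x \<le> 1) \<and>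
    (\<forall>x. norm x \<le> real n \<longrightarrow> \<kappa> x = 1 \<and> K x = 0) \<and> (\<forall>x. norm x \<ge> real n + 3 \<longrightarrow> \<kappa> x = 0 \<and> K x = 0) \<and> (\<forall>x. norm (K x) \<le> L)"
    by blast
  then obtain \<kappa> :: "nat \<Rightarrow> 'a \<Rightarrow> real" and K where k: "\<And>n. C1_gradient (\<kappa> n) (K n)" "\<And>n x. 0 \<le> \<kappa> n x" "\<And>n x. \<kappa> n x \<le> 1"
    "\<And>n x. norm x \<le> real n \<Longrightarrow> \<kappa> n x = 1 \<and> K n x = 0" "\<And>n x. norm x \<ge> real n + 3 \<Longrightarrow> \<kappa> n x = 0 \<and> K n x = 0"
    "\<And>n x. norm (K n x) \<le> L"
    by metis
  \<comment> \<open>A smooth truncation: bounded for each \<open>n\<close>, never larger than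
    \<open>y\<close> in absolute value, and with derivative at most 3, the sum of the bounds 1 and 2
    on the two damping terms.\<close>
  define tr where "tr n y = y * damp (e n) y" for n and y :: real
  define tr' where "tr' n y = damp (e n) y + damp' (e n) y * y" for n and y :: real
  have trd: "(tr n has_real_derivative tr' n y) (at y)" for n y
    unfolding tr_def[abs_def] tr'_def using DERIV_mult[OF DERIV_ident damp_deriv[OF e], of n y] by simp
  have trc: "continuous_on UNIV (tr' n)" for n
    unfolding tr'_def[abs_def] by (intro continuous_intros deriv_continuous[OF e])
  have tr1: "\<bar>tr n y\<bar> \<le> \<bar>y\<bar>" for n y
    unfolding tr_def abs_mult using damp_bounds(1)[OF e] by (intro mult_left_le) auto
  have trB: "\<bar>tr n y\<bar> \<le> 1 + 1 / e n" for n y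
  proof -
    have "\<bar>tr n y\<bar> = \<bar>y\<bar> / (1 + e n * y\<^sup>2)" using damp_den[OF e[of n], of y] by (simp add: tr_def damp_def)
    also have "\<dots> \<le> 1 + 1 / e n"
      using two_abs_le_eps(1)[OF e[of n], of y] damp_den[OF e[of n], of y] by (simp add: divide_le_eq)
    finally show ?thesis .
  qed
  have tr3: "\<bar>tr' n y\<bar> \<le> 3" for n y
    unfolding tr'_def using damp_bounds(1)[OF e[of n], of y] damp_bounds(2)[OF e[of n], of y] by linarith
  define f where "f n x = \<kappa> n x * tr n (\<phi> x)" for n x
  define F where "F n x = \<kappa> n x *\<^sub>R tr' n (\<phi> x) *\<^sub>R P x + tr n (\<phi> x) *\<^sub>R K n x" for n x
  have f: "has_weak_gradient (f n) (F n)" for n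
    unfolding f_def[abs_def] F_def[abs_def]
    by (rule weak_gradient_mult[OF C1_has_weak_gradient[OF k(1)] weak_gradient_chain[OF \<phi> trd trc trB tr3], where Bf = 1])
       (use k(2,3) trB in \<open>auto simp: abs_of_nonneg\<close>)
  have fb: "\<bar>f n x\<bar> \<le> \<bar>\<phi> x\<bar>" for n x
    unfolding f_def abs_mult using k(2,3)[of n x] tr1[of n "\<phi> x"] mult_mono[of "\<bar>\<kappa> n x\<bar>" 1 "\<bar>tr n (\<phi> x)\<bar>" "\<bar>\<phi> x\<bar>"] by simp
  have fB: "\<bar>f n x\<bar> \<le> 1 + 1 / e n" for n x
    unfolding f_def abs_mult using k(2,3)[of n x] trB[of n "\<phi> x"] mult_mono[of "\<bar>\<kappa> n x\<bar>" 1 "\<bar>tr n (\<phi> x)\<bar>" "1 + 1 / e n"] by simp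
  have fz: "f n x = 0 \<and> F n x = 0" if "norm x > real n + 3" for n x
    using k(5)[of n x] that by (simp add: f_def F_def)
  have fm: "f n \<in> borel_measurable lebesgue" "F n \<in> borel_measurable lebesgue" for n
    using f[of n] L1_loc_measurable unfolding has_weak_gradient_def by blast+
  have ml: "\<phi> \<in> borel_measurable lebesgue" "P \<in> borel_measurable lebesgue"
    using \<phi> L1_loc_measurable unfolding has_weak_gradient_def by blast+
  have L0: "L \<ge> 0" using k(6)[of 0 0] norm_ge_zero order_trans by blast
  \<comment> \<open>The bound \<open>L\<close> is the same for all cutoffs, so the squared function
    with a fixed factor can enter a majorant independent of \<open>n\<close>. The 18 is twice the
    square of 3.\<close>
  have Fb: "(norm (F n x))\<^sup>2 \<le> 18 * (norm (P x))\<^sup>2 + 2 * L\<^sup>2 * (\<phi> x)\<^sup>2" for n x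
  proof -
    have "norm (\<kappa> n x *\<^sub>R tr' n (\<phi> x) *\<^sub>R P x) \<le> 1 * (3 * norm (P x))"
      unfolding norm_scaleR using k(2,3)[of n x] tr3[of n "\<phi> x"] by (intro mult_mono mult_right_mono) auto
    moreover have "norm (tr n (\<phi> x) *\<^sub>R K n x) \<le> \<bar>\<phi> x\<bar> * L"
      unfolding norm_scaleR using tr1[of n "\<phi> x"] k(6)[of n x] by (intro mult_mono) auto
    ultimately have "norm (F n x) \<le> 3 * norm (P x) + \<bar>\<phi> x\<bar> * L"
      unfolding F_def by (intro order_trans[OF norm_triangle_ineq]) simp
    then have "(norm (F n x))\<^sup>2 \<le> (3 * norm (P x) + \<bar>\<phi> x\<bar> * L)\<^sup>2" by (intro power_mono) auto
    also have "\<dots> \<le> 2 * (3 * norm (P x))\<^sup>2 + 2 * (\<bar>\<phi> x\<bar> * L)\<^sup>2"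
      using sum_squares_bound[of "3 * norm (P x)" "\<bar>\<phi> x\<bar> * L"] by (simp add: power2_sum)
    finally show ?thesis by (simp add: power_mult_distrib mult_ac)
  qed
  define wd where "wd x = 18 * ((s x)\<^sup>2 * (norm (P x))\<^sup>2) + 2 * L\<^sup>2 * ((\<phi> x)\<^sup>2 * (s x)\<^sup>2)" for x
  have iwd: "integrable lebesgue wd" unfolding wd_def[abs_def] using P2 \<phi>2 by simp
  have Fwd: "(s x)\<^sup>2 * (norm (F n x))\<^sup>2 \<le> wd x" for n x
    using mult_left_mono[OF Fb[of n x], of "(s x)\<^sup>2"] by (simp add: wd_def algebra_simps)
  have F2: "integrable lebesgue (\<lambda>x. (s x)\<^sup>2 * (norm (F n x))\<^sup>2)" for n
  proof (rule Bochner_Integration.integrable_bound[OF iwd])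
    show "(\<lambda>x. (s x)\<^sup>2 * (norm (F n x))\<^sup>2) \<in> borel_measurable lebesgue" using fm(2)[of n] meas by measurable
    show "AE x in lebesgue. norm ((s x)\<^sup>2 * (norm (F n x))\<^sup>2) \<le> norm (wd x)"
      by (rule AE_I2) (use Fwd[of _ n] in \<open>auto intro: order_trans[OF _ abs_ge_self]\<close>)
  qed
  have trl: "(\<lambda>n. tr n y) \<longlonglongrightarrow> y" "(\<lambda>n. tr' n y) \<longlonglongrightarrow> 1" for y
  proof -
    have "(\<lambda>n. y * damp (e n) y) \<longlonglongrightarrow> y * 1" by (intro tendsto_mult tendsto_const t)
    then show "(\<lambda>n. tr n y) \<longlonglongrightarrow> y" by (simp add: tr_def)
    have "(\<lambda>n. damp (e n) y + damp' (e n) y * y) \<longlonglongrightarrow> 1 + 0 * y" by (intro tendsto_add tendsto_mult tendsto_const t)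
    then show "(\<lambda>n. tr' n y) \<longlonglongrightarrow> 1" by (simp add: tr'_def)
  qed
  have kev: "\<forall>\<^sub>F n in sequentially. \<kappa> n x = 1 \<and> K n x = 0" for x
  proof -
    obtain N where N: "norm x \<le> real N" using real_arch_simple by blast
    show ?thesis unfolding eventually_sequentially
      by (rule exI[of _ N]) (use N k(4) in \<open>meson of_nat_le_iff order_trans\<close>)
  qed
  have fl: "(\<lambda>n. f n x) \<longlonglongrightarrow> \<phi> x" for x
    by (rule Lim_transform_eventually[OF trl(1)[of "\<phi> x"]], use kev[of x] in eventually_elim) (simp add: f_def)
  have Fl: "(\<lambda>n. F n x) \<longlonglongrightarrow> P x" for x
  proof (rule Lim_transform_eventually)
    show "(\<lambda>n. tr' n (\<phi> x) *\<^sub>R P x) \<longlonglongrightarrow> P x" using tendsto_scaleR[OF trl(2)[of "\<phi> x"] tendsto_const, of "P x"] by simp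
    show "\<forall>\<^sub>F n in sequentially. tr' n (\<phi> x) *\<^sub>R P x = F n x" using kev[of x] by eventually_elim (simp add: F_def)
  qed
  have lim: "(\<lambda>n. LINT x|lebesgue. (s x)\<^sup>2 * (norm (F n x))\<^sup>2) \<longlonglongrightarrow> (LINT x|lebesgue. (s x)\<^sup>2 * (norm (P x))\<^sup>2)"
  proof (rule integral_dominated_convergence[OF _ _ iwd])
    show "(\<lambda>x. (s x)\<^sup>2 * (norm (P x))\<^sup>2) \<in> borel_measurable lebesgue" using P2 by (rule borel_measurable_integrable)
    show "(\<lambda>x. (s x)\<^sup>2 * (norm (F n x))\<^sup>2) \<in> borel_measurable lebesgue" for n using F2 by (rule borel_measurable_integrable)
    show "AE x in lebesgue. (\<lambda>n. (s x)\<^sup>2 * (norm (F n x))\<^sup>2) \<longlonglongrightarrow> (s x)\<^sup>2 * (norm (P x))\<^sup>2"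
      by (intro AE_I2 tendsto_intros Fl)
    show "AE x in lebesgue. norm ((s x)\<^sup>2 * (norm (F n x))\<^sup>2) \<le> wd x" for n
      by (rule AE_I2) (use Fwd[of _ n] in simp)
  qed
  have f2: "(LINT x|lebesgue. (f n x)\<^sup>2 * (s x)\<^sup>2) \<le> (LINT x|lebesgue. (\<phi> x)\<^sup>2 * (s x)\<^sup>2)" for n
  proof (rule integral_mono_AE[OF _ \<phi>2])
    have le: "(f n x)\<^sup>2 * (s x)\<^sup>2 \<le> (\<phi> x)\<^sup>2 * (s x)\<^sup>2" for x
      using power_mono[OF fb[of n x], of 2] by (intro mult_right_mono) auto
    show "integrable lebesgue (\<lambda>x. (f n x)\<^sup>2 * (s x)\<^sup>2)"
      by (rule Bochner_Integration.integrable_bound[OF \<phi>2]) (use le fm(1)[of n] meas in auto)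
    show "AE x in lebesgue. (f n x)\<^sup>2 * (s x)\<^sup>2 \<le> (\<phi> x)\<^sup>2 * (s x)\<^sup>2" using le by simp
  qed
  \<comment> \<open>Fatou's lemma handles the Hardy term, dominated convergence the gradient energy,
    and the zero-order term only decreases under truncation.\<close>
  have "(\<integral>\<^sup>+x. ennreal ((\<phi> x)\<^sup>2 * (s x)\<^sup>2 * (c / (norm x)\<^sup>2)) \<partial>lebesgue)
     = (\<integral>\<^sup>+x. liminf (\<lambda>n. ennreal ((f n x)\<^sup>2 * (s x)\<^sup>2 * (c / (norm x)\<^sup>2))) \<partial>lebesgue)"
  proof (intro nn_integral_cong lim_imp_Liminf[symmetric])
    show "(\<lambda>n. ennreal ((f n x)\<^sup>2 * (s x)\<^sup>2 * (c / (norm x)\<^sup>2))) \<longlonglongrightarrow> ennreal ((\<phi> x)\<^sup>2 * (s x)\<^sup>2 * (c / (norm x)\<^sup>2))" for x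
      by (intro tendsto_ennrealI tendsto_mult tendsto_power tendsto_const fl)
  qed simp
  also have "\<dots> \<le> liminf (\<lambda>n. \<integral>\<^sup>+x. ennreal ((f n x)\<^sup>2 * (s x)\<^sup>2 * (c / (norm x)\<^sup>2)) \<partial>lebesgue)"
  proof (rule nn_integral_liminf)
    have "(\<lambda>x::'a. c / (norm x)\<^sup>2) \<in> borel_measurable borel" by measurable
    then have "(\<lambda>x::'a. c / (norm x)\<^sup>2) \<in> borel_measurable lebesgue" by (simp add: measurable_completion)
    then show "(\<lambda>x. ennreal ((f n x)\<^sup>2 * (s x)\<^sup>2 * (c / (norm x)\<^sup>2))) \<in> borel_measurable lebesgue" for n
      using fm(1)[of n] meas(1)
      by (intro measurable_compose[OF _ measurable_ennreal] borel_measurable_times borel_measurable_power)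
  qed
  also have "\<dots> \<le> liminf (\<lambda>n. ennreal ((LINT x|lebesgue. (s x)\<^sup>2 * (norm (F n x))\<^sup>2) + C * (LINT x|lebesgue. (\<phi> x)\<^sup>2 * (s x)\<^sup>2)))"
  proof (intro Liminf_mono always_eventually allI)
    fix n
    have "(\<integral>\<^sup>+x. ennreal ((f n x)\<^sup>2 * (s x)\<^sup>2 * (c / (norm x)\<^sup>2)) \<partial>lebesgue)
      \<le> ennreal ((LINT x|lebesgue. (s x)\<^sup>2 * (norm (F n x))\<^sup>2) + C * (LINT x|lebesgue. (f n x)\<^sup>2 * (s x)\<^sup>2))"
      by (rule bdd[OF f fB fz F2])
    also have "\<dots> \<le> ennreal ((LINT x|lebesgue. (s x)\<^sup>2 * (norm (F n x))\<^sup>2) + C * (LINT x|lebesgue. (\<phi> x)\<^sup>2 * (s x)\<^sup>2))"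
      by (intro ennreal_leI add_left_mono mult_left_mono f2 C)
    finally show "(\<integral>\<^sup>+x. ennreal ((f n x)\<^sup>2 * (s x)\<^sup>2 * (c / (norm x)\<^sup>2)) \<partial>lebesgue)
      \<le> ennreal ((LINT x|lebesgue. (s x)\<^sup>2 * (norm (F n x))\<^sup>2) + C * (LINT x|lebesgue. (\<phi> x)\<^sup>2 * (s x)\<^sup>2))" .
  qed
  also have "\<dots> = ennreal ((LINT x|lebesgue. (s x)\<^sup>2 * (norm (P x))\<^sup>2) + C * (LINT x|lebesgue. (\<phi> x)\<^sup>2 * (s x)\<^sup>2))"
    by (intro lim_imp_Liminf tendsto_ennrealI tendsto_add tendsto_const lim) simp
  finally show ?thesis .
qed

end

section \<open>Identification of the constants and conclusion\<close>

lemma c0_mu_eq: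
  fixes \<mu> :: "'a::euclidean_space \<Rightarrow> real"
  assumes "\<bar>c0_mu \<mu>\<bar> \<noteq> \<infinity>"
  shows "c0_mu \<mu> = ereal (hardy_const DIM('a) - real_of_ereal (Limsup (ess_at_0 \<mu>) (\<lambda>y. ereal ((norm y)\<^sup>2 * U_mu \<mu> y))))"
proof -
  let ?S = "Limsup (ess_at_0 \<mu>) (\<lambda>y. ereal ((norm y)\<^sup>2 * U_mu \<mu> y))"
  \<comment> \<open>On the trivial filter every lower limit is infinite, which the finiteness
    assumption excludes.\<close>
  have nb: "ess_at_0 \<mu> \<noteq> bot"
  proof
    assume "ess_at_0 \<mu> = bot"
    have "top \<le> Liminf bot f" for f :: "'a \<Rightarrow> ereal"
      unfolding Liminf_def by (rule SUP_upper2[of "\<lambda>_. False"]) auto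
    with \<open>ess_at_0 \<mu> = bot\<close> have "c0_mu \<mu> = \<infinity>" unfolding c0_mu_def by (simp add: top_ereal_def)
    then show False using assms by simp
  qed
  have "c0_mu \<mu> = Liminf (ess_at_0 \<mu>) (\<lambda>y. ereal (hardy_const DIM('a)) + - ereal ((norm y)\<^sup>2 * U_mu \<mu> y))"
    unfolding c0_mu_def by simp
  also have "\<dots> = ereal (hardy_const DIM('a)) + - ?S"
    by (subst Liminf_add_ereal_left[OF nb]) (simp_all only: ereal_Liminf_uminus abs_ereal.simps ereal.distinct not_False_eq_True PInfty_neq_ereal)
  finally have eq: "c0_mu \<mu> = ereal (hardy_const DIM('a)) + - ?S" .
  \<comment> \<open>An infinite \<open>?S\<close> would make \<open>c0_mu \<mu>\<close> infinite, so
    \<open>real_of_ereal\<close> does not hit its default value.\<close>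
  then show ?thesis using assms by (cases ?S) auto
qed

text \<open>By uniqueness the chosen \<open>weak_gradient \<mu>\<close> agrees almost everywhere
  with \<open>W\<close>. Its squared quotient by the density is four times
  \<open>(norm (G x))\<^sup>2\<close> over the density, and multiplication by
  \<open>(s x)\<^sup>2\<close> clears the denominators.\<close>

lemma (in sqrt_density) U_mu_mult:
  assumes \<mu>: "\<And>x. \<mu> x = (s x)\<^sup>2" and h: "h = weak_laplacian \<mu>"
  shows "AE x in lebesgue. s x > 0 \<longrightarrow> (s x)\<^sup>2 * U_mu \<mu> x = (norm (G x))\<^sup>2 - h x / 2"
proof -
  have mu: "\<mu> = (\<lambda>x. (s x)\<^sup>2)" using \<mu> by auto
  have w: "has_weak_gradient \<mu> W" unfolding mu by (rule mu_grad)
  then have "has_weak_gradient \<mu> (weak_gradient \<mu>)"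
    unfolding weak_gradient_def by (rule someI[of "has_weak_gradient \<mu>"])
  from weak_gradient_unique[OF this w] show ?thesis
  proof eventually_elim
    case (elim x)
    show ?case
    proof
      assume s: "s x > 0"
      have nw: "norm (weak_gradient \<mu> x /\<^sub>R \<mu> x) = 2 * norm (G x) / s x"
        using s by (simp add: elim norm_W \<mu> power2_eq_square field_simps)
      show "(s x)\<^sup>2 * U_mu \<mu> x = (norm (G x))\<^sup>2 - h x / 2"
        unfolding U_mu_def nw unfolding h[symmetric] unfolding \<mu> using s
        by (simp add: power_divide power_mult_distrib right_diff_distrib)
    qed
  qed
qed

text \<open>A nonpositive constant makes the left side nonpositive. For a positive one the
  hypotheses near and away from the origin merge into one pointwise bound on the potential, which
  feeds the inequality for truncated functions.\<close>

lemma weighted_hardy: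
  fixes \<mu> :: "'a::euclidean_space \<Rightarrow> real"
  assumes dim: "DIM('a) \<ge> 3"
    and nonneg: "\<And>x. \<mu> x \<ge> 0"
    and sqrt_H1: "H1_loc (\<lambda>x. sqrt (\<mu> x))"
    and lap_L1: "\<exists>h. has_weak_laplacian \<mu> h"
    and finite_c0: "\<bar>c0_mu \<mu>\<bar> \<noteq> \<infinity>"
    and bdd_away: "\<And>R. R > 0 \<Longrightarrow>
          \<exists>M. AE x in weighted \<mu>. x \<notin> ball 0 R \<longrightarrow> U_rem \<mu> x \<le> M"
    and log_bound: "\<exists>R0>0. AE x in weighted \<mu>. x \<in> ball 0 R0 \<longrightarrow>
          (norm x)\<^sup>2 * U_rem \<mu> x \<le> 1/4 * (1 / \<bar>ln (norm x)\<bar>\<^sup>2)"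
  shows "\<exists>C::real. \<forall>\<phi>\<in>H1_weighted \<mu>.
      c0_mu \<mu> * enn2ereal (\<integral>\<^sup>+x. ennreal ((\<phi> x)\<^sup>2 / (norm x)\<^sup>2) \<partial>weighted \<mu>)
      \<le> enn2ereal (\<integral>\<^sup>+x. ennreal ((norm (weak_gradient \<phi> x))\<^sup>2) \<partial>weighted \<mu>)
        + ereal C * enn2ereal (\<integral>\<^sup>+x. ennreal ((\<phi> x)\<^sup>2) \<partial>weighted \<mu>)"
proof -
  define \<Lambda> where "\<Lambda> = real_of_ereal (Limsup (ess_at_0 \<mu>) (\<lambda>y. ereal ((norm y)\<^sup>2 * U_mu \<mu> y)))"
  define m where "m = (real DIM('a) - 2) / 2"
  have m: "m > 0" using dim by (simp add: m_def)
  define c where "c = m\<^sup>2 - \<Lambda>"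
  have c0: "c0_mu \<mu> = ereal c"
    using c0_mu_eq[OF finite_c0] by (simp add: c_def m_def hardy_const_def \<Lambda>_def)
  show ?thesis
  proof (cases "c \<le> 0")
    case True
    have "ereal c * enn2ereal X \<le> enn2ereal Y + ereal 0 * enn2ereal Z" for X Y Z
    proof -
      \<comment> \<open>Also valid for an infinite integral, since 0 times infinity is 0 in
        \<open>ereal\<close>.\<close>
      have "ereal c * enn2ereal X \<le> 0" using True by (simp add: ereal_mult_le_0_iff)
      also have "0 \<le> enn2ereal Y + ereal 0 * enn2ereal Z" by simp
      finally show ?thesis .
    qed
    then show ?thesis unfolding c0 by blast
  next
    case False
    then have c: "c > 0" by simp
    define s where "s x = sqrt (\<mu> x)" for x
    have s2: "(s x)\<^sup>2 = \<mu> x" for x using nonneg by (simp add: s_def)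
    obtain G where G: "has_weak_gradient s G" "L2_loc G" and sL: "L2_loc s"
      using sqrt_H1 unfolding H1_loc_def s_def[abs_def] by blast
    define h where "h = weak_laplacian \<mu>"
    have h: "has_weak_laplacian \<mu> h" unfolding h_def weak_laplacian_def using lap_L1 by (rule someI_ex)
    interpret sqrt_density s G h
      by unfold_locales (use G sL h nonneg in \<open>auto simp: s2\<close>, auto simp: s_def nonneg)
    have \<mu>m: "\<mu> \<in> borel_measurable lebesgue" using L1_loc_measurable[OF s2_L1] by (simp add: s2)
    then have wm: "(\<lambda>x. ennreal (\<mu> x)) \<in> borel_measurable lebesgue" by simp
    \<comment> \<open>Turns the hypotheses into Lebesgue statements on the set where the potential
      is meaningful.\<close>
    have AEw: "(AE x in weighted \<mu>. Q x) \<longleftrightarrow> (AE x in lebesgue. s x > 0 \<longrightarrow> Q x)" for Q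
      unfolding weighted_def AE_density[OF wm] by (simp add: s_def)
    obtain R0 where R0: "R0 > 0" and lb: "AE x in lebesgue. s x > 0 \<longrightarrow> x \<in> ball 0 R0 \<longrightarrow>
          (norm x)\<^sup>2 * U_rem \<mu> x \<le> 1/4 * (1 / \<bar>ln (norm x)\<bar>\<^sup>2)"
      using log_bound unfolding AEw by blast
    \<comment> \<open>A threshold for the squared norm: inside the ball of the logarithmic bound,
      and small enough for the ground state field.\<close>
    define T where "T = min (exp (-2)) (R0\<^sup>2)"
    have T: "0 < T" "T \<le> exp (-2)" "T \<le> R0\<^sup>2" using R0 by (auto simp: T_def)
    have "exp (-2) < (1::real)" by simp
    then have T1: "T < 1" using T by linarith
    obtain M where M: "AE x in lebesgue. s x > 0 \<longrightarrow> x \<notin> ball 0 (sqrt T) \<longrightarrow> U_rem \<mu> x \<le> M"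
      using bdd_away[of "sqrt T"] T unfolding AEw by auto
    obtain C0 where C0: "C0 \<ge> 0" and field: "\<And>\<epsilon>. 0 < \<epsilon> \<Longrightarrow> \<exists>a a'. (\<forall>t\<ge>0. (a has_real_derivative a' t) (at t)) \<and> continuous_on {0..} a' \<and>
      (\<forall>t\<ge>0. (t + \<epsilon> \<le> T \<longrightarrow> (m\<^sup>2 + (1 / ln (t + \<epsilon>))\<^sup>2) / (t + \<epsilon>) \<le> (2 * m + 2) * a t + 2 * t * a' t - t * (a t)\<^sup>2) \<and>
      (T < t + \<epsilon> \<longrightarrow> - C0 \<le> (2 * m + 2) * a t + 2 * t * a' t - t * (a t)\<^sup>2))"
      using regularized_field[OF m T(1,2)] by auto
    \<comment> \<open>Outside the threshold the remainder is at most \<open>M\<close>, the field may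
      cost \<open>C0\<close>, and the Hardy weight together with the inverse square part of the
      potential is at most \<open>m\<^sup>2 / T\<close>. The absolute value keeps \<open>C\<close>
      nonnegative.\<close>
    define C where "C = \<bar>M\<bar> + C0 + m\<^sup>2 / T"
    have C: "C \<ge> 0" using C0 T by (simp add: C_def)
    have nz: "AE x in lebesgue. x \<noteq> (0::'a)"
      using AE_not_in[of "{0}" "lebesgue :: 'a measure"] by (simp add: null_sets_completionI)
    have pot: "AE x in lebesgue. s x > 0 \<longrightarrow> (s x)\<^sup>2 * (c / (norm x)\<^sup>2) \<le> h x / 2 - (norm (G x))\<^sup>2
       + (s x)\<^sup>2 * ((if (norm x)\<^sup>2 < T then (m\<^sup>2 + (1 / ln ((norm x)\<^sup>2))\<^sup>2) / (norm x)\<^sup>2 else - C0) + C)"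
      using lb M U_mu_mult[OF s2[symmetric] h_def] nz
    proof eventually_elim
      case (elim x)
      show ?case
      proof
        assume s: "s x > 0"
        define t where "t = (norm x)\<^sup>2"
        have t: "t > 0" using elim(4) by (simp add: t_def)
        have U: "U_mu \<mu> x = U_rem \<mu> x + \<Lambda> / t" by (simp add: U_rem_def \<Lambda>_def t_def)
        have "c / t + U_mu \<mu> x \<le> (if t < T then (m\<^sup>2 + (1 / ln t)\<^sup>2) / t else - C0) + C"
        proof (cases "t < T")
          case True
          have "(norm x)\<^sup>2 < R0\<^sup>2" using True T by (simp add: t_def)
          then have "norm x < R0" using R0 by (simp add: power2_less_imp_less)
          then have "t * U_rem \<mu> x \<le> 1/4 * (1 / \<bar>ln (norm x)\<bar>\<^sup>2)" using elim(1) s by (simp add: t_def)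
          \<comment> \<open>Since \<open>t\<close> is the squared norm, its logarithm is twice that
            of the norm; this absorbs the factor 1/4.\<close>
          also have "\<dots> = (1 / ln t)\<^sup>2"
            using elim(4) by (simp add: t_def ln_realpow power_divide power_mult_distrib)
          finally have "U_rem \<mu> x \<le> (1 / ln t)\<^sup>2 / t" using t by (simp add: pos_le_divide_eq mult.commute)
          \<comment> \<open>The \<open>\<Lambda>\<close> in \<open>c\<close> cancels the inverse
            square part of the potential.\<close>
          then have "c / t + U_mu \<mu> x \<le> (m\<^sup>2 + (1 / ln t)\<^sup>2) / t"
            unfolding U c_def by (simp add: add_divide_distrib diff_divide_distrib)
          then show ?thesis using True C by simp
        next
          case False
          have "sqrt T \<le> norm x" using False by (simp add: t_def real_le_lsqrt not_less)
          then have "U_rem \<mu> x \<le> M" using elim(2) s by simp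
          moreover have "m\<^sup>2 / t \<le> m\<^sup>2 / T" using False T by (intro divide_left_mono) auto
          ultimately show ?thesis using False unfolding U c_def C_def by (simp add: diff_divide_distrib)
        qed
        from mult_left_mono[OF this, of "(s x)\<^sup>2"]
        show "(s x)\<^sup>2 * (c / (norm x)\<^sup>2) \<le> h x / 2 - (norm (G x))\<^sup>2
          + (s x)\<^sup>2 * ((if (norm x)\<^sup>2 < T then (m\<^sup>2 + (1 / ln ((norm x)\<^sup>2))\<^sup>2) / (norm x)\<^sup>2 else - C0) + C)"
          using elim(3) s unfolding t_def[symmetric] by (simp add: distrib_left)
      qed
    qed
    have bdd: "(\<integral>\<^sup>+x. ennreal ((f x)\<^sup>2 * (s x)\<^sup>2 * (c / (norm x)\<^sup>2)) \<partial>lebesgue)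
      \<le> ennreal ((LINT x|lebesgue. (s x)\<^sup>2 * (norm (F x))\<^sup>2) + C * (LINT x|lebesgue. (f x)\<^sup>2 * (s x)\<^sup>2))"
      if "has_weak_gradient f F" "\<And>x. \<bar>f x\<bar> \<le> B" "\<And>x. norm x > R \<Longrightarrow> f x = 0 \<and> F x = 0"
        "integrable lebesgue (\<lambda>x. (s x)\<^sup>2 * (norm (F x))\<^sup>2)" for f F B R
      by (rule hardy_bounded[OF that C0 T1 field[unfolded m_def] less_imp_le[OF c] pot[unfolded m_def]])
    have nnw: "(\<integral>\<^sup>+x. ennreal (g x) \<partial>weighted \<mu>) = (\<integral>\<^sup>+x. ennreal ((s x)\<^sup>2 * g x) \<partial>lebesgue)"
      if "g \<in> borel_measurable lebesgue" for g
      unfolding weighted_def using that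
      by (subst nn_integral_density[OF wm]) (auto simp: s2 ennreal_mult' nonneg)
    have "c0_mu \<mu> * enn2ereal (\<integral>\<^sup>+x. ennreal ((\<phi> x)\<^sup>2 / (norm x)\<^sup>2) \<partial>weighted \<mu>)
      \<le> enn2ereal (\<integral>\<^sup>+x. ennreal ((norm (weak_gradient \<phi> x))\<^sup>2) \<partial>weighted \<mu>)
        + ereal C * enn2ereal (\<integral>\<^sup>+x. ennreal ((\<phi> x)\<^sup>2) \<partial>weighted \<mu>)" if "\<phi> \<in> H1_weighted \<mu>" for \<phi>
    proof -
      define P where "P = weak_gradient \<phi>"
      have P: "has_weak_gradient \<phi> P" and \<phi>w: "integrable (weighted \<mu>) (\<lambda>x. (\<phi> x)\<^sup>2)"
        using that unfolding H1_weighted_def P_def weak_gradient_def L2_weighted_def by (auto intro: someI[of "has_weak_gradient \<phi>"])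
      have ml: "\<phi> \<in> borel_measurable lebesgue" "P \<in> borel_measurable lebesgue"
        using P L1_loc_measurable unfolding has_weak_gradient_def by blast+
      have nm: "(\<lambda>x::'a. norm x) \<in> borel_measurable lebesgue" by (simp add: measurable_completion)
      define X where "X = (\<integral>\<^sup>+x. ennreal ((norm (P x))\<^sup>2) \<partial>weighted \<mu>)"
      define Y where "Y = (\<integral>\<^sup>+x. ennreal ((\<phi> x)\<^sup>2) \<partial>weighted \<mu>)"
      define Z where "Z = (\<integral>\<^sup>+x. ennreal ((\<phi> x)\<^sup>2 / (norm x)\<^sup>2) \<partial>weighted \<mu>)"
      have Xe: "X = (\<integral>\<^sup>+x. ennreal ((s x)\<^sup>2 * (norm (P x))\<^sup>2) \<partial>lebesgue)"
        unfolding X_def by (rule nnw) (use ml in measurable)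
      have Ye: "Y = (\<integral>\<^sup>+x. ennreal ((\<phi> x)\<^sup>2 * (s x)\<^sup>2) \<partial>lebesgue)"
        unfolding Y_def by (subst nnw) (use ml in \<open>auto simp: mult.commute\<close>)
      have Zm: "(\<lambda>x. (\<phi> x)\<^sup>2 / (norm x)\<^sup>2) \<in> borel_measurable lebesgue" using ml nm by measurable
      have Ze: "ennreal c * Z = (\<integral>\<^sup>+x. ennreal ((\<phi> x)\<^sup>2 * (s x)\<^sup>2 * (c / (norm x)\<^sup>2)) \<partial>lebesgue)"
      proof -
        have "(\<lambda>x. ennreal ((s x)\<^sup>2 * ((\<phi> x)\<^sup>2 / (norm x)\<^sup>2))) \<in> borel_measurable lebesgue"
          using Zm meas(1) by measurable
        then have "ennreal c * Z = (\<integral>\<^sup>+x. ennreal c * ennreal ((s x)\<^sup>2 * ((\<phi> x)\<^sup>2 / (norm x)\<^sup>2)) \<partial>lebesgue)"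
          unfolding Z_def nnw[OF Zm] by (rule nn_integral_cmult[symmetric])
        also have "\<dots> = (\<integral>\<^sup>+x. ennreal ((\<phi> x)\<^sup>2 * (s x)\<^sup>2 * (c / (norm x)\<^sup>2)) \<partial>lebesgue)"
          using c by (intro nn_integral_cong) (simp add: mult_ac flip: ennreal_mult)
        finally show ?thesis .
      qed
      have Yfin: "Y < \<infinity>" unfolding Y_def
        using \<phi>w unfolding integrable_iff_bounded by (simp add: power2_abs)
      have "ennreal c * Z \<le> X + ennreal C * Y"
      \<comment> \<open>The case split avoids transferring finite energy from the gradient granted
        by \<open>H1_weighted\<close> to the representative chosen by
        \<open>weak_gradient\<close>.\<close>
      proof (cases "X = \<infinity>")
        case True then show ?thesis by simp
      next
        case False
        have iP: "integrable lebesgue (\<lambda>x. (s x)\<^sup>2 * (norm (P x))\<^sup>2)"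
          by (rule integrableI_nonneg) (use ml meas False Xe in \<open>auto simp: less_top\<close>)
        have i\<phi>: "integrable lebesgue (\<lambda>x. (\<phi> x)\<^sup>2 * (s x)\<^sup>2)"
          by (rule integrableI_nonneg) (use ml meas Yfin Ye in auto)
        have "ennreal c * Z \<le> ennreal ((LINT x|lebesgue. (s x)\<^sup>2 * (norm (P x))\<^sup>2) + C * (LINT x|lebesgue. (\<phi> x)\<^sup>2 * (s x)\<^sup>2))"
          unfolding Ze by (rule hardy_general[OF P iP i\<phi> less_imp_le[OF c] C bdd])
        also have "\<dots> = X + ennreal C * Y"
          unfolding Xe Ye nn_integral_eq_integral[OF iP AE_I2, simplified] nn_integral_eq_integral[OF i\<phi> AE_I2, simplified]
          using C by (simp add: ennreal_mult)
        finally show ?thesis .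
      qed
      then have "enn2ereal (ennreal c * Z) \<le> enn2ereal (X + ennreal C * Y)" by (simp add: less_eq_ennreal.rep_eq)
      then show ?thesis
        using c C unfolding c0 X_def[symmetric] Y_def[symmetric] Z_def[symmetric] P_def[symmetric]
        by (simp add: times_ennreal.rep_eq plus_ennreal.rep_eq enn2ereal_ennreal)
    qed
    then show ?thesis by blast
  qed
qed

theorem theorem3p6:
  fixes \<mu> :: "real ^ 'n \<Rightarrow> real"
  assumes dim: "CARD('n) \<ge> 3"
    and nonneg: "\<And>x. \<mu> x \<ge> 0"
    and sqrt_H1: "H1_loc (\<lambda>x. sqrt (\<mu> x))"
    and lap_L1: "\<exists>h. has_weak_laplacian \<mu> h"
    and finite_c0: "\<bar>c0_mu \<mu>\<bar> \<noteq> \<infinity>"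
    and bdd_away: "\<And>R. R > 0 \<Longrightarrow>
          \<exists>M. AE x in weighted \<mu>. x \<notin> ball 0 R \<longrightarrow> U_rem \<mu> x \<le> M"
    and log_bound: "\<exists>R0>0. AE x in weighted \<mu>. x \<in> ball 0 R0 \<longrightarrow>
          (norm x)\<^sup>2 * U_rem \<mu> x \<le> 1/4 * (1 / \<bar>ln (norm x)\<bar>\<^sup>2)"
  shows "\<exists>C::real. \<forall>\<phi>\<in>H1_weighted \<mu>.
      c0_mu \<mu> * enn2ereal (\<integral>\<^sup>+x. ennreal ((\<phi> x)\<^sup>2 / (norm x)\<^sup>2) \<partial>weighted \<mu>)
      \<le> enn2ereal (\<integral>\<^sup>+x. ennreal ((norm (weak_gradient \<phi> x))\<^sup>2) \<partial>weighted \<mu>)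
        + ereal C * enn2ereal (\<integral>\<^sup>+x. ennreal ((\<phi> x)\<^sup>2) \<partial>weighted \<mu>)"
proof (rule weighted_hardy[OF _ nonneg sqrt_H1 lap_L1 finite_c0 bdd_away log_bound])
  show "DIM(real ^ 'n) \<ge> 3" using dim by simp
qed

end
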